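(* Let $T$ be a standard Young tableau with $n$ boxes and let $\widetilde T$ be its associated tabloid. Then $e(\widetilde T)$ (affine evacuation) is a standardizable tabloid, and the standard Young tableau to which it is associated is the (Schützenberger) evacuation of $T$.
   Context: **Tabloids.** $[\overline n]$ is the set of residue classes of integers modulo $n$; $\overline i$ is the class of $i$. A tabloid of shape $\lambda\vdash n$ is a bijective filling of the Young diagram of $\lambda$ with the elements of $[\overline n]$, up to reordering entries within rows. $\mathrm{Des}(T)$ is the set of $\overline i$ such that $\overline{i+1}$ lies in a strictly lower row of $T$ than $\overline i$. Tabloids $T,T'$ are related by a Knuth move if $T'$ is obtained from $T$ by exchanging two elements $\overline i$ and $\overline{i+1}$, and $\mathrm{Des}(T)$, $\mathrm{Des}(T')$ are incomparable under inclusion. The Knuth move has type $\overline i$ if $\overline i$ is in exactly one of $\mathrm{Des}(T),\mathrm{Des}(T')$ and $\overline{i+1}$ is in exactly the other one. $\mathcal A_\lambda$ is the graph on tabloids of shape $\lambda$ whose edges are Knuth moves. $\mathrm{RRSS}(\lambda,\overline k)$ is the tabloid with first row $\overline k,\overline{k-1},\dots,\overline{k-\lambda_1+1}$, second row $\overline{k-\lambda_1},\dots,\overline{k-\lambda_1-\lambda_2+1}$, and so on. **Affine evacuation.** For each $\lambda\vdash n$ there is a unique automorphism $e$ of $\mathcal A_\lambda$ such that $e(\mathrm{RRSS}(\lambda,\overline k))=\mathrm{RRSS}(\lambda,\overline{n-k})$ for all $\overline k\in[\overline n]$ and such that $e$ sends every edge that is a Knuth move of type $\overline k$ to an edge that is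 a Knuth move of type $\overline{n-k-1}$. This $e$ is called affine evacuation. **Associated tabloids.** If $T$ is a standard Young tableau whose row $i$ has entries $a_1,\dots,a_k$, then row $i$ of the associated tabloid $\widetilde T$ has entries $\overline{a_1},\dots,\overline{a_k}$. A tabloid is standardizable if it is the associated tabloid of some standard Young tableau. **Finite evacuation.** It is the involution $T\mapsto e(T)$ on standard Young tableaux of each fixed shape such that if $w\in\mathfrak S_n$ corresponds to $(P,Q)$ under the Robinson–Schensted correspondence, then $w_0ww_0$ corresponds to $(e(P),e(Q))$, where $w_0=n(n-1)\cdots1$ is the longest element of $\mathfrak S_n$. *)

theory Defs
  imports "HOL-Combinatorics.Permutations"
begin

(* Residue classes modulo n are encoded by their representatives in {0, ..., n - 1},
   the class of an integer i being "i mod int n".  Diagrams are drawn in English notation: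
   row 0 is the top row, and a larger row index means a lower row. *)

definition residue_classes :: "nat \<Rightarrow> int set" where
  "residue_classes n = {0..<int n}"

definition is_partition :: "nat \<Rightarrow> nat list \<Rightarrow> bool" where
  "is_partition n lam \<longleftrightarrow> sorted_wrt (\<ge>) lam \<and> 0 \<notin> set lam \<and> sum_list lam = n"


section \<open>Tabloids and Knuth moves\<close>

(* A filling up to reordering entries within rows is the list of the entry sets of its rows. *)
type_synonym tabloid = "int set list"

definition tabloids :: "nat \<Rightarrow> nat list \<Rightarrow> tabloid set" where
  "tabloids n lam = {T. map card T = lam
      \<and> (\<forall>r s. r < s \<and> s < length T \<longrightarrow> T ! r \<inter> T ! s = {})
      \<and> \<Union> (set T) = residue_classes n}"

definition Des :: "nat \<Rightarrow> tabloid \<Rightarrow> int set" where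
  "Des n T = {i \<in> residue_classes n.
      \<exists>r s. r < s \<and> s < length T \<and> i \<in> T ! r \<and> (i + 1) mod int n \<in> T ! s}"

definition exchange :: "int \<Rightarrow> int \<Rightarrow> tabloid \<Rightarrow> tabloid" where
  "exchange i j T = map (\<lambda>R. Transposition.transpose i j ` R) T"

definition knuth_move :: "nat \<Rightarrow> tabloid \<Rightarrow> tabloid \<Rightarrow> bool" where
  "knuth_move n T T' \<longleftrightarrow>
      (\<exists>i \<in> residue_classes n. T' = exchange i ((i + 1) mod int n) T)
      \<and> \<not> Des n T \<subseteq> Des n T' \<and> \<not> Des n T' \<subseteq> Des n T"

definition knuth_move_of_type :: "nat \<Rightarrow> int \<Rightarrow> tabloid \<Rightarrow> tabloid \<Rightarrow> bool" where
  "knuth_move_of_type n i T T' \<longleftrightarrow> knuth_move n T T'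
      \<and> (i \<in> Des n T - Des n T' \<and> (i + 1) mod int n \<in> Des n T' - Des n T
        \<or> i \<in> Des n T' - Des n T \<and> (i + 1) mod int n \<in> Des n T - Des n T')"

definition RRSS :: "nat \<Rightarrow> nat list \<Rightarrow> int \<Rightarrow> tabloid" where
  "RRSS n lam k =
      map (\<lambda>r. (\<lambda>j. (k - int (sum_list (take r lam)) - int j) mod int n) ` {..<lam ! r})
        [0..<length lam]"


section \<open>Affine evacuation\<close>

definition graph_automorphism :: "'v set \<Rightarrow> ('v \<Rightarrow> 'v \<Rightarrow> bool) \<Rightarrow> ('v \<Rightarrow> 'v) \<Rightarrow> bool" where
  "graph_automorphism V adj e \<longleftrightarrow>
      bij_betw e V V \<and> (\<forall>x \<in> V. \<forall>y \<in> V. adj (e x) (e y) \<longleftrightarrow> adj x y)"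

(* Only the values of e on the tabloids of shape lam are constrained; there, these conditions
   determine affine evacuation uniquely. *)
definition is_affine_evacuation :: "nat \<Rightarrow> nat list \<Rightarrow> (tabloid \<Rightarrow> tabloid) \<Rightarrow> bool" where
  "is_affine_evacuation n lam e \<longleftrightarrow>
      graph_automorphism (tabloids n lam) (knuth_move n) e
      \<and> (\<forall>k \<in> residue_classes n. e (RRSS n lam k) = RRSS n lam ((int n - k) mod int n))
      \<and> (\<forall>k \<in> residue_classes n. \<forall>T \<in> tabloids n lam. \<forall>T' \<in> tabloids n lam.
            knuth_move_of_type n k T T' \<longrightarrow>
            knuth_move_of_type n ((int n - k - 1) mod int n) (e T) (e T'))"


section \<open>Standard Young tableaux\<close>

(* A tableau is the list of its rows, each read from left to right. *)
type_synonym tableau = "nat list list"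

definition shape :: "tableau \<Rightarrow> nat list" where
  "shape T = map length T"

definition standard_tableau :: "nat \<Rightarrow> tableau \<Rightarrow> bool" where
  "standard_tableau n T \<longleftrightarrow> is_partition n (shape T)
      \<and> distinct (concat T) \<and> set (concat T) = {1..n}
      \<and> (\<forall>R \<in> set T. sorted_wrt (<) R)
      \<and> (\<forall>r j. Suc r < length T \<and> j < length (T ! Suc r) \<longrightarrow> T ! r ! j < T ! Suc r ! j)"

definition associated_tabloid :: "nat \<Rightarrow> tableau \<Rightarrow> tabloid" where
  "associated_tabloid n T = map (\<lambda>R. (\<lambda>a. int a mod int n) ` set R) T"

definition standardizable :: "nat \<Rightarrow> tabloid \<Rightarrow> bool" where
  "standardizable n X \<longleftrightarrow> (\<exists>T. standard_tableau n T \<and> X = associated_tabloid n T)"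


section \<open>The Robinson--Schensted correspondence\<close>

(* The second component is the entry bumped out of the row, if any. *)
fun row_insert :: "nat \<Rightarrow> nat list \<Rightarrow> nat list \<times> nat option" where
  "row_insert x [] = ([x], None)"
| "row_insert x (y # ys) =
    (if x < y then (x # ys, Some y)
     else (case row_insert x ys of (zs, b) \<Rightarrow> (y # zs, b)))"

(* The second component is the index of the row in which the new box is created. *)
fun insert_entry :: "nat \<Rightarrow> tableau \<Rightarrow> tableau \<times> nat" where
  "insert_entry x [] = ([[x]], 0)"
| "insert_entry x (R # P) =
    (case row_insert x R of
       (R', None) \<Rightarrow> (R' # P, 0)
     | (R', Some y) \<Rightarrow> (case insert_entry y P of (P', i) \<Rightarrow> (R' # P', Suc i)))"

definition add_at_end_of_row :: "nat \<Rightarrow> nat \<Rightarrow> tableau \<Rightarrow> tableau" where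
  "add_at_end_of_row i k Q = (if i < length Q then Q[i := Q ! i @ [k]] else Q @ [[k]])"

definition RS_step :: "nat \<times> nat \<Rightarrow> tableau \<times> tableau \<Rightarrow> tableau \<times> tableau" where
  "RS_step = (\<lambda>(k, x) (P, Q).
      case insert_entry x P of (P', i) \<Rightarrow> (P', add_at_end_of_row i k Q))"

(* The pair (P, Q) of insertion and recording tableau of the word w(1) w(2) ... w(n). *)
definition RS :: "nat \<Rightarrow> (nat \<Rightarrow> nat) \<Rightarrow> tableau \<times> tableau" where
  "RS n w = fold RS_step (map (\<lambda>k. (k, w k)) [1..<Suc n]) ([], [])"


section \<open>Finite evacuation\<close>

definition longest_perm :: "nat \<Rightarrow> nat \<Rightarrow> nat" where
  "longest_perm n i = (if i \<in> {1..n} then Suc n - i else i)"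

(* Only the values of ev on the standard Young tableaux with n boxes are constrained; there,
   these conditions determine Schuetzenberger evacuation uniquely. *)
definition is_evacuation :: "nat \<Rightarrow> (tableau \<Rightarrow> tableau) \<Rightarrow> bool" where
  "is_evacuation n ev \<longleftrightarrow>
      (\<forall>T. standard_tableau n T \<longrightarrow>
          standard_tableau n (ev T) \<and> shape (ev T) = shape T \<and> ev (ev T) = T)
      \<and> (\<forall>w P Q. w permutes {1..n} \<and> RS n w = (P, Q) \<longrightarrow>
          RS n (longest_perm n \<circ> w \<circ> longest_perm n) = (ev P, ev Q))"

end

theory Submission
  imports Defs
begin

text \<open>
  Cut the circle of residues at \<open>n\<close> and list the row indices of \<open>n, n - 1, \<dots>, 1\<close>: a tabloid
  becomes a word of row indices, and a Knuth move of a type \<open>k\<close> between \<open>1\<close> and \<open>n - 2\<close> becomes an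
  elementary Knuth relation between three adjacent letters of that word.  Standard tableaux give
  Yamanouchi words.

  \<^bold>\<open>Reduction to one tableau of each shape.\<close>  A tabloid has at most one neighbour along a move of a
  given type (\<open>knuth_move_type_unique\<close>).  Affine evacuation turns type \<open>k\<close> into type \<open>n - k - 1\<close> by
  definition.  Finite evacuation does the same to tableaux: it reverses and complements a word that
  inserts to the tableau, this turns a dual Knuth move on the entries \<open>a, a + 1, a + 2\<close> of the word
  into one on \<open>n - 1 - a, n - a, n + 1 - a\<close>, and insertion carries dual Knuth moves of words to Knuth
  moves of tabloids (\<open>insertion_tableau_dual_knuth\<close>, \<open>dual_knuth_type\<close>).  Hence the two evacuations
  agree on both ends of a move as soon as they agree on one end (\<open>evacuations_agree_step\<close>).  Since all
  Yamanouchi words with the same letters are Knuth equivalent (\<open>yamanouchi_connected\<close>), a single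
  standard tableau of each shape remains to be treated.

  \<^bold>\<open>Descents under affine evacuation.\<close>  The residues at which a move changes the descent set are
  determined by the types of the move (\<open>Des_flips_iff_types\<close>), so the statement that the descents of
  \<open>e X\<close> are the negatives of those of \<open>X\<close> spreads along the edges of the graph.  It is visible at the
  tabloids \<open>RRSS\<close>, whose words are weakly increasing around the circle.  Every standardizable tabloid
  is connected to one of them: the Yamanouchi word with weakly decreasing letters is sorted by
  alternating Knuth relations with rotations, which only cut the circle at another place
  (\<open>rows_exchange\<close>, \<open>negates_Des_rows_down_up\<close>).

  \<^bold>\<open>The one tableau.\<close>  Let \<open>C\<close> be the tableau whose word lists the row indices column by column, and
  let \<open>D = ev C\<close>.  The descents of \<open>C\<close> are the negatives of those of \<open>D\<close>, hence descents of \<open>e\<close> of the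
  tabloid of \<open>D\<close>.  No other word with the letters of a column word has all its descents
  (\<open>column_word_unique\<close>), because descents force every letter to be at least the corresponding letter
  of the column word while the sums of the letters are equal.  So \<open>e\<close> sends the tabloid of \<open>D\<close> to the
  tabloid of \<open>C = ev D\<close>.
\<close>

section \<open>Knuth equivalence of words\<close>

text \<open>In \<open>witness_right\<close> the first two of the three letters are exchanged, and the third witnesses
  that this is a legitimate move; \<open>witness_left\<close> is the mirror case.\<close>

inductive knuth_step :: "nat list \<Rightarrow> nat list \<Rightarrow> bool" where
  witness_right: "x \<le> y \<Longrightarrow> y < z \<Longrightarrow> knuth_step (p @ [x, z, y] @ q) (p @ [z, x, y] @ q)"
| witness_left: "x < y \<Longrightarrow> y \<le> z \<Longrightarrow> knuth_step (p @ [y, x, z] @ q) (p @ [y, z, x] @ q)"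

declare equivclp_trans [trans]

abbreviation knuth_equiv :: "nat list \<Rightarrow> nat list \<Rightarrow> bool"  (infix "\<approx>" 50) where
  "u \<approx> v \<equiv> equivclp knuth_step u v"

lemma knuth_step_append: "knuth_step u v \<Longrightarrow> knuth_step (p @ u @ q) (p @ v @ q)"
proof (induction rule: knuth_step.induct)
  case (witness_right x y z p' q')
  then show ?case using knuth_step.witness_right[of x y z "p @ p'" "q' @ q"] by simp
next
  case (witness_left x y z p' q')
  then show ?case using knuth_step.witness_left[of x y z "p @ p'" "q' @ q"] by simp
qed

lemma knuth_equiv_append: "u \<approx> v \<Longrightarrow> p @ u @ q \<approx> p @ v @ q"
proof (induction rule: equivclp_induct)
  case base
  show ?case by simp
next
  case (step y z)
  then have "p @ y @ q \<approx> p @ z @ q"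
    using knuth_step_append by (metis equivclp_sym r_into_equivclp)
  then show ?case using step.IH equivclp_trans by metis
qed

lemma knuth_equiv_Cons: "u \<approx> v \<Longrightarrow> x # u \<approx> x # v"
  using knuth_equiv_append[of u v "[x]" "[]"] by simp

lemma knuth_step_mset: "knuth_step u v \<Longrightarrow> mset u = mset v"
  by (induction rule: knuth_step.induct) auto

lemma knuth_equiv_mset: "u \<approx> v \<Longrightarrow> mset u = mset v"
  by (induction rule: equivclp_induct) (auto dest: knuth_step_mset)

lemma knuth_equiv_witness_right: "x \<le> y \<Longrightarrow> y < z \<Longrightarrow> x # z # y # q \<approx> z # x # y # q"
  using witness_right[of x y z "[]" q] by (simp add: r_into_equivclp)

lemma knuth_equiv_witness_left: "x < y \<Longrightarrow> y \<le> z \<Longrightarrow> y # x # z # q \<approx> y # z # x # q"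
  using witness_left[of x y z "[]" q] by (simp add: r_into_equivclp)

text \<open>The multiplicities of the letters form a partition.\<close>

definition dominant :: "nat multiset \<Rightarrow> bool" where
  "dominant M \<longleftrightarrow> (\<forall>r. count M (Suc r) \<le> count M r)"

lemma dominantD: "dominant M \<Longrightarrow> r \<le> s \<Longrightarrow> count M s \<le> count M r"
  unfolding dominant_def by (rule lift_Suc_antimono_le) auto

text \<open>The condition concerns all suffixes: the last letters of the word are the rows of the
  smallest entries.\<close>

fun yamanouchi :: "nat list \<Rightarrow> bool" where
  "yamanouchi [] = True"
| "yamanouchi (x # w) \<longleftrightarrow> dominant (mset (x # w)) \<and> yamanouchi w"

lemma yamanouchi_dominant: "yamanouchi w \<Longrightarrow> dominant (mset w)"
  by (cases w) (auto simp: dominant_def)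

text \<open>Concatenations of runs \<open>h, h - 1, \<dots>, 0\<close>.  In the word of a tableau, such a run stands
  for consecutive entries placed one by one into the rows \<open>0, \<dots>, h\<close>, that is, for a column.\<close>

fun column_word :: "nat list \<Rightarrow> bool" where
  "column_word [] = True"
| "column_word [x] \<longleftrightarrow> x = 0"
| "column_word (x # y # w) \<longleftrightarrow> (x = 0 \<or> x = Suc y) \<and> column_word (y # w)"

text \<open>A partition loses its first column.\<close>

lemma dominant_minus_column:
  assumes "dominant M" "M \<noteq> {#}"
  obtains m M' where "M = mset [0..<Suc m] + M'" "dominant M'"
proof -
  define m where "m = Max (set_mset M)"
  have mM: "m \<in># M" using assms m_def by simp
  have max: "r \<in># M \<Longrightarrow> r \<le> m" for r using assms m_def by simp
  have ge1: "r \<le> m \<Longrightarrow> 1 \<le> count M r" for r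
    using dominantD[OF assms(1), of r m] mM by (metis count_greater_eq_one_iff order_trans)
  have gt0: "r > m \<Longrightarrow> count M r = 0" for r
    using max[of r] by (meson count_inI not_le)
  have cnt: "count (mset [0..<Suc m]) r = (if r \<le> m then 1 else 0)" for r
    using distinct_count_atmost_1[of "[0..<Suc m]"] distinct_upt[of 0 "Suc m"] by (simp add: less_Suc_eq_le)
  have sub: "mset [0..<Suc m] \<subseteq># M"
    using ge1 cnt by (simp add: subseteq_mset_def del: upt_Suc)
  have "dominant (M - mset [0..<Suc m])"
    using assms(1) cnt gt0 unfolding dominant_def by (auto simp del: upt_Suc intro: diff_le_mono)
  moreover have "M = mset [0..<Suc m] + (M - mset [0..<Suc m])"
    by (rule subset_mset.add_diff_inverse[OF sub, symmetric])
  ultimately show ?thesis using that by blast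
qed

lemma yamanouchi_prepend_column:
  assumes "yamanouchi c"
  shows "yamanouchi (rev [0..<k] @ c)"
proof (induction k)
  case 0
  show ?case using assms by simp
next
  case (Suc k)
  have cnt: "count (mset [0..<k]) r = (if r < k then 1 else 0)" for r k :: nat
    using distinct_count_atmost_1[of "[0..<k]"] by simp
  have "dominant (mset (rev [0..<Suc k] @ c))"
    unfolding dominant_def
  proof
    fix r
    have "count (mset c) (Suc r) \<le> count (mset c) r"
      using yamanouchi_dominant[OF assms] dominant_def by blast
    moreover have "count (mset [0..<Suc k]) (Suc r) \<le> count (mset [0..<Suc k]) r"
      using cnt[of "Suc k"] by (auto simp del: upt_Suc)
    ultimately show "count (mset (rev [0..<Suc k] @ c)) (Suc r) \<le> count (mset (rev [0..<Suc k] @ c)) r"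
      by (simp del: upt_Suc)
  qed
  then show ?case using Suc by simp
qed

lemma column_word_prepend_column:
  assumes "column_word c"
  shows "column_word (rev [0..<k] @ c)"
proof (induction k)
  case 0
  show ?case using assms by simp
next
  case (Suc k)
  then show ?case
  proof (cases k)
    case 0
    then show ?thesis using assms by (cases c) auto
  next
    case (Suc j)
    then show ?thesis using \<open>column_word (rev [0..<k] @ c)\<close> by simp
  qed
qed

lemma column_word_exists:
  "dominant M \<Longrightarrow> \<exists>c. mset c = M \<and> yamanouchi c \<and> column_word c"
proof (induction "size M" arbitrary: M rule: less_induct)
  case less
  show ?case
  proof (cases "M = {#}")
    case True
    then show ?thesis by (intro exI[of _ "[]"]) auto
  next
    case False
    then obtain m M' where M: "M = mset [0..<Suc m] + M'" "dominant M'"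
      using dominant_minus_column less.prems by blast
    then have "size M' < size M" by simp
    then obtain c where "mset c = M'" "yamanouchi c" "column_word c"
      using less.hyps M(2) by blast
    then show ?thesis
      using M(1) yamanouchi_prepend_column[of c "Suc m"] column_word_prepend_column[of c "Suc m"]
      by (intro exI[of _ "rev [0..<Suc m] @ c"]) (auto simp del: upt_Suc)
  qed
qed

text \<open>Induction on the length.  If the first letters agree, they can be removed.  If they are \<open>x < y\<close>,
  both can be removed from the content, in either order; the remaining partition still drops strictly
  somewhere between row \<open>x\<close> and row \<open>y\<close>, which provides a third letter \<open>z\<close> with \<open>x \<le> z < y\<close> that can
  be put behind them.  The words \<open>x y z t\<close> and \<open>y x z t\<close> are related by one step, and by induction each of
  them is equivalent to one of the given words.\<close>

lemma yamanouchi_connected: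
  "yamanouchi u \<Longrightarrow> yamanouchi v \<Longrightarrow> mset u = mset v \<Longrightarrow> u \<approx> v"
proof (induction "length u" arbitrary: u v rule: less_induct)
  case less
  have main: "x # u \<approx> y # v"
    if IH: "\<And>u' v'. length u' = length u \<Longrightarrow> yamanouchi u' \<Longrightarrow> yamanouchi v'
        \<Longrightarrow> mset u' = mset v' \<Longrightarrow> u' \<approx> v'"
    and yu: "yamanouchi (x # u)" and yv: "yamanouchi (y # v)"
    and eq: "mset (x # u) = mset (y # v)" and xy: "x < y" for x y u v
  proof -
    \<comment> \<open>\<open>M\<close> is the content without \<open>x\<close> and \<open>y\<close>; it drops strictly after row \<open>z\<close>.\<close>
    define M where "M = mset u - {#y#}"
    have "y \<in># add_mset x (mset u)" using eq by simp
    then have yinu: "y \<in># mset u" using xy by simp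
    then have Mu: "mset u = add_mset y M" unfolding M_def by simp
    then have Mv: "mset v = add_mset x M" using eq by (simp add: add_mset_commute)
    have dM1: "dominant (add_mset y M)" using yamanouchi_dominant[of u] yu Mu by simp
    have dM2: "dominant (add_mset x M)" using yamanouchi_dominant[of v] yv Mv by simp
    have dM12: "dominant (add_mset x (add_mset y M))" using yu Mu by simp
    have dM: "dominant M" unfolding dominant_def
    proof
      fix r
      show "count M (Suc r) \<le> count M r"
        using dM1[unfolded dominant_def, rule_format, of r] dM2[unfolded dominant_def, rule_format, of r] xy
        by (auto split: if_splits)
    qed
    have "count M y < count M x"
    proof -
      have "count (add_mset x M) y \<le> count (add_mset x M) (Suc x)"
        by (rule dominantD[OF dM2]) (use xy in simp)
      moreover have "count (add_mset x (add_mset y M)) y \<le> count (add_mset x (add_mset y M)) (Suc x)"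
        by (rule dominantD[OF dM12]) (use xy in simp)
      moreover have "count (add_mset y M) (Suc x) \<le> count (add_mset y M) x"
        by (rule dominantD[OF dM1]) simp
      ultimately show ?thesis using xy by (auto split: if_splits)
    qed
    have "\<exists>z. x \<le> z \<and> z < y \<and> count M (Suc z) < count M z"
    proof (rule ccontr)
      assume "\<not> ?thesis"
      then have "\<And>z. x \<le> z \<Longrightarrow> z < y \<Longrightarrow> count M z \<le> count M (Suc z)" by (meson not_le)
      then have step: "\<And>d. x + Suc d \<le> y \<Longrightarrow> count M (x + d) \<le> count M (x + Suc d)" by simp
      have "x + d \<le> y \<Longrightarrow> count M x \<le> count M (x + d)" for d
      proof (induction d)
        case (Suc d)
        then show ?case using step[of d] by simp
      qed simp
      from this[of "y - x"] show False using \<open>count M y < count M x\<close> xy by simp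
    qed
    then obtain z where z: "x \<le> z" "z < y" "count M (Suc z) < count M z" by blast
    then have zM: "z \<in># M" by (metis count_inI not_less_zero)
    define N where "N = M - {#z#}"
    have MN: "M = add_mset z N" using zM N_def by simp
    have "dominant N" unfolding dominant_def
    proof
      fix r
      show "count N (Suc r) \<le> count N r"
        using dM[unfolded dominant_def, rule_format, of r] z(3) MN
        by (auto split: if_splits)
    qed
    then obtain t where t: "mset t = N" "yamanouchi t" using column_word_exists by blast
    have y3: "yamanouchi (y # z # t)" "yamanouchi (x # z # t)"
      using t dM dM1 dM2 MN by auto
    have u: "u \<approx> y # z # t" using IH[of u "y # z # t"] y3 yu Mu MN t by simp
    have v: "v \<approx> x # z # t"
      using IH[of v "x # z # t"] y3 yv Mv MN t mset_eq_length[OF eq] by simp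
    have "x # u \<approx> x # y # z # t" using u by (rule knuth_equiv_Cons)
    also have "x # y # z # t \<approx> y # x # z # t" using knuth_equiv_witness_right z by simp
    also have "y # x # z # t \<approx> y # v" using v[THEN equivclp_sym] by (rule knuth_equiv_Cons)
    finally show ?thesis .
  qed
  show ?case
  proof (cases u)
    case Nil
    then show ?thesis using less.prems by simp
  next
    case (Cons x u')
    then obtain y v' where v: "v = y # v'" using less.prems(3) by (cases v) auto
    have len: "length v' = length u'" using less.prems(3) Cons v
      by (metis length_Cons nat.inject size_mset)
    have IH: "a \<approx> b" if "length a = length u'" "yamanouchi a" "yamanouchi b" "mset a = mset b" for a b
      using less.hyps[of a b] that Cons by simp
    consider "x = y" | "x < y" | "y < x" by linarith
    then show ?thesis
    proof cases
      case 1
      then show ?thesis using IH[of u' v'] less.prems v Cons knuth_equiv_Cons by simp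
    next
      case 2
      have "x # u' \<approx> y # v'"
        by (rule main[OF IH]) (use less.prems v Cons 2 in simp_all)
      then show ?thesis using v Cons by simp
    next
      case 3
      have "y # v' \<approx> x # u'"
        by (rule main[OF IH[folded len]]) (use less.prems v Cons 3 in simp_all)
      then show ?thesis using v Cons by (simp add: equivclp_sym)
    qed
  qed
qed

text \<open>Inside a run of the column word each letter exceeds the next one by exactly one, so a strict
  descent of \<open>v\<close> there keeps \<open>v\<close> above \<open>c\<close>; at the end of a run the letter of \<open>c\<close> is zero.  The induction
  runs from the right end of the word.\<close>

lemma column_word_le:
  assumes "column_word c" "length v = length c"
    and "\<And>j. Suc j < length c \<Longrightarrow> c ! Suc j < c ! j \<Longrightarrow> v ! Suc j < v ! j"
  shows "list_all2 (\<le>) c v"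
  using assms
proof (induction c arbitrary: v rule: column_word.induct)
  case 1
  then show ?case by simp
next
  case (2 x)
  then show ?case by (cases v) auto
next
  case (3 x y w)
  then obtain a b v' where v: "v = a # b # v'"
    by (auto simp: length_Suc_conv)
  have "list_all2 (\<le>) (y # w) (b # v')"
  proof (rule "3.IH")
    fix j assume "Suc j < length (y # w)" "(y # w) ! Suc j < (y # w) ! j"
    then show "(b # v') ! Suc j < (b # v') ! j" using "3.prems"(3)[of "Suc j"] v by simp
  qed (use "3.prems" v in auto)
  moreover have "x \<le> a"
    using "3.prems"(1) "3.prems"(3)[of 0] calculation v by auto
  ultimately show ?case using v by simp
qed

lemma list_all2_le_sum_list_eq:
  fixes c v :: "nat list"
  assumes "list_all2 (\<le>) c v" "sum_list v = sum_list c"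
  shows "v = c"
  using assms
proof (induction rule: list_all2_induct)
  case (Cons x xs y ys)
  moreover have "sum_list xs \<le> sum_list ys"
    using Cons.hyps(2) by (induction rule: list_all2_induct) auto
  ultimately show ?case by simp
qed simp

lemma column_word_unique:
  assumes "column_word c" "mset v = mset c"
    and "\<And>j. Suc j < length c \<Longrightarrow> c ! Suc j < c ! j \<Longrightarrow> v ! Suc j < v ! j"
  shows "v = c"
  using list_all2_le_sum_list_eq[OF column_word_le[OF assms(1) _ assms(3)]] assms(2)
  by (metis mset_eq_length sum_mset_sum_list)

section \<open>Exchanging blocks of equal letters\<close>

text \<open>A pair \<open>y z\<close> with \<open>z < y\<close> is a column of height two, and it commutes with \<open>y\<close>.\<close>

lemma descending_pair_commutes: "z < y \<Longrightarrow> replicate b y @ y # z # q \<approx> y # z # replicate b y @ q"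
proof (induction b)
  case (Suc b)
  have "replicate (Suc b) y @ y # z # q \<approx> y # y # z # replicate b y @ q"
    using Suc knuth_equiv_Cons by simp
  also have "\<dots> \<approx> y # z # y # replicate b y @ q"
    using Suc.prems knuth_equiv_witness_left[of z y y] by (metis equivclp_sym knuth_equiv_Cons order_refl)
  finally show ?case by simp
qed simp

text \<open>The letter \<open>y\<close> jumps to the left over one letter of the row at a time; the letter to the right of
  the jump, at the end \<open>z\<close>, is its witness.\<close>

lemma pass_row:
  assumes "sorted R" "\<And>r. r \<in> set R \<Longrightarrow> r \<le> z" "z < y"
  shows "R @ y # z # q \<approx> y # R @ z # q"
  using assms
proof (induction R)
  case (Cons x R)
  have "(x # R) @ y # z # q \<approx> x # y # R @ z # q"
    using Cons knuth_equiv_Cons by simp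
  also have "x # y # R @ z # q \<approx> y # x # R @ z # q"
  proof (cases R)
    case Nil
    then show ?thesis using Cons.prems knuth_equiv_witness_right[of x z y] by simp
  next
    case (Cons r R')
    then have "x \<le> r" "r < y" using Cons.prems by force+
    then show ?thesis using Cons knuth_equiv_witness_right[of x r y] by simp
  qed
  finally show ?case by simp
qed simp

text \<open>The first \<open>y\<close> is brought next to a \<open>z\<close> by \<open>descending_pair_commutes\<close> and then passes the row by
  \<open>pass_row\<close>; its \<open>z\<close> stays behind and extends the row.  This needs one \<open>z\<close> for each \<open>y\<close>, which is why
  the exchange is possible when \<open>b \<le> b'\<close>, that is, when the blocks come from a partition.\<close>

lemma pass_row_block:
  assumes "sorted R" "\<And>r. r \<in> set R \<Longrightarrow> r \<le> z" "z < y" "b \<le> b'"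
  shows "R @ replicate b y @ replicate b' z @ q \<approx> replicate b y @ R @ replicate b' z @ q"
  using assms
proof (induction b arbitrary: R b')
  case (Suc b)
  obtain d where d: "b' = Suc d" "b \<le> d" using Suc.prems by (cases b') auto
  have "R @ replicate (Suc b) y @ replicate b' z @ q
      = R @ (replicate b y @ y # z # replicate d z @ q) @ []"
    using d by (simp add: replicate_app_Cons_same)
  also have "\<dots> \<approx> R @ (y # z # replicate b y @ replicate d z @ q) @ []"
    using descending_pair_commutes Suc.prems knuth_equiv_append by blast
  also have "\<dots> \<approx> y # R @ z # replicate b y @ replicate d z @ q"
    using pass_row[of R z y] Suc.prems by simp
  also have "\<dots> = y # (R @ [z]) @ replicate b y @ replicate d z @ q" by simp
  also have "\<dots> \<approx> y # replicate b y @ (R @ [z]) @ replicate d z @ q"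
    using Suc.IH[of "R @ [z]" d] Suc.prems d knuth_equiv_Cons by (auto simp: sorted_append)
  finally show ?case using d by simp
qed simp

definition row_block :: "nat list \<Rightarrow> nat \<Rightarrow> nat list" where
  "row_block lam i = replicate (lam ! i) i"

text \<open>The word \<open>0 \<dots> 0 1 \<dots> 1 \<dots>\<close> of the first \<open>i\<close> rows; for \<open>i = length lam\<close> it is the word of \<open>RRSS\<close>.\<close>

definition rows_up :: "nat list \<Rightarrow> nat \<Rightarrow> nat list" where
  "rows_up lam i = concat (map (row_block lam) [0..<i])"

definition rows_down :: "nat list \<Rightarrow> nat \<Rightarrow> nat \<Rightarrow> nat list" where
  "rows_down lam i m = concat (map (row_block lam) (rev [i..<m]))"

lemma set_rows_up: "r \<in> set (rows_up lam i) \<Longrightarrow> r < i"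
  by (auto simp: rows_up_def row_block_def)

lemma sorted_rows_up: "sorted (rows_up lam i)"
proof (induction i)
  case (Suc i)
  then show ?case using set_rows_up[of _ lam i]
    by (auto simp: rows_up_def row_block_def sorted_append intro: less_imp_le)
qed (simp add: rows_up_def)

lemma rows_up_Suc: "rows_up lam (Suc i) = rows_up lam i @ row_block lam i"
  by (simp add: rows_up_def)

lemma rows_down_Suc: "i \<le> m \<Longrightarrow> rows_down lam i (Suc m) = row_block lam m @ rows_down lam i m"
  by (simp add: rows_down_def)

text \<open>All blocks except the last one pass, one after another, to the left of the increasing word; the
  last block \<open>i\<close> then extends that word.  After a rotation of the circle the same argument applies to
  the next block, so that iteration sorts the word.\<close>

lemma rows_exchange:
  assumes "sorted_wrt (\<ge>) lam" "i < m" "m \<le> length lam"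
  shows "rows_up lam i @ rows_down lam i m \<approx> rows_down lam (Suc i) m @ rows_up lam (Suc i)"
  using assms(2,3)
proof (induction m)
  case (Suc m)
  show ?case
  proof (cases "i = m")
    case True
    then show ?thesis by (simp add: rows_down_def rows_up_Suc)
  next
    case False
    then have im: "i < m" using Suc.prems by simp
    then obtain k where k: "m = Suc k" by (cases m) auto
    have le: "lam ! m \<le> lam ! k"
      using sorted_wrt_nth_less[OF assms(1), of k m] Suc.prems k by simp
    define q where "q = rows_down lam i k"
    have qd: "rows_down lam i m = row_block lam k @ q"
      using rows_down_Suc[of i k] im k q_def by simp
    have ik: "i \<le> k" using im k by simp
    have "rows_up lam i @ rows_down lam i (Suc m)
        = rows_up lam i @ row_block lam m @ row_block lam k @ q"
      using rows_down_Suc im qd by simp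
    also have "\<dots> \<approx> row_block lam m @ rows_up lam i @ row_block lam k @ q"
      unfolding row_block_def
      using pass_row_block[of "rows_up lam i" k m] sorted_rows_up set_rows_up le k ik
      by (metis lessI less_imp_le order_less_le_trans)
    also have "\<dots> = row_block lam m @ (rows_up lam i @ rows_down lam i m) @ []"
      using qd by simp
    also have "\<dots> \<approx> row_block lam m @ (rows_down lam (Suc i) m @ rows_up lam (Suc i)) @ []"
      using Suc im knuth_equiv_append by (meson Suc_leD)
    finally show ?thesis using rows_down_Suc[of "Suc i" m lam] im by simp
  qed
qed simp

lemma count_rows_up: "count (mset (rows_up lam i)) r = (if r < i then lam ! r else 0)"
  by (induction i) (auto simp: rows_up_def row_block_def less_Suc_eq)

lemma mset_rows_down: "i \<le> m \<Longrightarrow> mset (rows_up lam i @ rows_down lam i m) = mset (rows_up lam m)"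
proof (induction m)
  case (Suc m)
  then show ?case
    by (cases "i = Suc m") (auto simp: rows_down_Suc rows_up_Suc rows_down_def)
qed (simp add: rows_up_def rows_down_def)

lemma yamanouchi_rows_down:
  assumes "sorted_wrt (\<ge>) lam" "m \<le> length lam"
  shows "yamanouchi (rows_down lam 0 m)"
  using assms(2)
proof (induction m)
  case (Suc m)
  have le: "lam ! Suc r \<le> lam ! r" if "Suc r < Suc m" for r
    using sorted_wrt_nth_less[OF assms(1), of r "Suc r"] Suc.prems that by simp
  have ms: "mset (rows_down lam 0 m) = mset (rows_up lam m)"
    using mset_rows_down[of 0 m lam] by (simp add: rows_up_def)
  have "b \<le> lam ! m \<Longrightarrow> yamanouchi (replicate b m @ rows_down lam 0 m)" for b
  proof (induction b)
    case 0
    then show ?case using Suc by simp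
  next
    case (Suc b)
    have "dominant (mset (replicate (Suc b) m @ rows_down lam 0 m))"
      unfolding dominant_def
    proof
      fix r
      have "lam ! m \<le> lam ! r" if "Suc r = m" using that le[of r] by simp
      then show "count (mset (replicate (Suc b) m @ rows_down lam 0 m)) (Suc r)
          \<le> count (mset (replicate (Suc b) m @ rows_down lam 0 m)) r"
        using le[of r] Suc.prems by (auto simp: ms count_rows_up)
    qed
    then show ?case using Suc by simp
  qed
  then show ?case by (simp add: rows_down_Suc row_block_def)
qed (simp add: rows_down_def)

section \<open>Tabloids as row functions\<close>

text \<open>A tabloid given by the row index of each residue.  Descents and exchanges are easy to compute in
  this form, and every tabloid has it.\<close>

definition tabloid_of_rows :: "nat \<Rightarrow> nat \<Rightarrow> (int \<Rightarrow> nat) \<Rightarrow> tabloid" where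
  "tabloid_of_rows n l \<rho> = map (\<lambda>r. {i \<in> residue_classes n. \<rho> i = r}) [0..<l]"

lemma succ_residue:
  assumes "i \<in> residue_classes n"
  shows "(i + 1) mod int n \<in> residue_classes n"
  using assms by (simp add: residue_classes_def)

lemma nth_tabloid_of_rows: "r < l \<Longrightarrow> tabloid_of_rows n l \<rho> ! r = {i \<in> residue_classes n. \<rho> i = r}"
  by (simp add: tabloid_of_rows_def)

lemma length_tabloid_of_rows [simp]: "length (tabloid_of_rows n l \<rho>) = l"
  by (simp add: tabloid_of_rows_def)

lemma Des_tabloid_of_rows:
  assumes "\<forall>i \<in> residue_classes n. \<rho> i < l"
  shows "Des n (tabloid_of_rows n l \<rho>) = {i \<in> residue_classes n. \<rho> i < \<rho> ((i + 1) mod int n)}"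
proof -
  have "(\<exists>r s. r < s \<and> s < l \<and> i \<in> tabloid_of_rows n l \<rho> ! r \<and> (i + 1) mod int n \<in> tabloid_of_rows n l \<rho> ! s)
     \<longleftrightarrow> \<rho> i < \<rho> ((i + 1) mod int n)" if "i \<in> residue_classes n" for i
  proof
    assume "\<rho> i < \<rho> ((i + 1) mod int n)"
    then show "\<exists>r s. r < s \<and> s < l \<and> i \<in> tabloid_of_rows n l \<rho> ! r \<and> (i + 1) mod int n \<in> tabloid_of_rows n l \<rho> ! s"
      using that succ_residue[OF that] bspec[OF assms succ_residue[OF that]]
      by (intro exI[of _ "\<rho> i"] exI[of _ "\<rho> ((i + 1) mod int n)"]) (simp add: nth_tabloid_of_rows)
  qed (auto simp: nth_tabloid_of_rows)
  then show ?thesis unfolding Des_def by auto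
qed

lemma tabloid_of_rows_cong:
  assumes "\<And>i. i \<in> residue_classes n \<Longrightarrow> \<rho> i = \<rho>' i"
  shows "tabloid_of_rows n l \<rho> = tabloid_of_rows n l \<rho>'"
  using assms unfolding tabloid_of_rows_def by auto

lemma transpose_residue:
  assumes "i \<in> residue_classes n" "j \<in> residue_classes n"
  shows "Transposition.transpose i j x \<in> residue_classes n \<longleftrightarrow> x \<in> residue_classes n"
  using assms by (auto simp: Transposition.transpose_def)

lemma exchange_tabloid_of_rows:
  assumes "i \<in> residue_classes n" "j \<in> residue_classes n"
  shows "exchange i j (tabloid_of_rows n l \<rho>) = tabloid_of_rows n l (\<rho> \<circ> Transposition.transpose i j)"
  unfolding exchange_def tabloid_of_rows_def
  using transpose_residue[OF assms] by (auto simp: in_transpose_image_iff)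

lemma tabloid_rows_exist:
  assumes "X \<in> tabloids n lam"
  obtains \<rho> where "\<forall>i \<in> residue_classes n. \<rho> i < length lam"
    "X = tabloid_of_rows n (length lam) \<rho>"
proof -
  have len: "length X = length lam" using assms by (auto simp: tabloids_def)
  have disj: "\<And>r s. r < s \<Longrightarrow> s < length X \<Longrightarrow> X ! r \<inter> X ! s = {}"
    and un: "\<Union> (set X) = residue_classes n"
    using assms by (auto simp: tabloids_def)
  have ex: "\<exists>r. r < length X \<and> i \<in> X ! r" if "i \<in> residue_classes n" for i
    using that un by (metis UnionE in_set_conv_nth)
  have unique: "r = s" if "r < length X" "s < length X" "i \<in> X ! r" "i \<in> X ! s" for i r s
    using disj[of r s] disj[of s r] that by (metis disjoint_iff linorder_neqE_nat)
  define \<rho> where "\<rho> i = (THE r. r < length X \<and> i \<in> X ! r)" for i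
  have \<rho>: "\<rho> i = r" if "r < length X" "i \<in> X ! r" for i r
    unfolding \<rho>_def using that unique by blast
  have lt: "\<rho> i < length lam" if "i \<in> residue_classes n" for i
    using ex[OF that] \<rho> len by metis
  have sub: "X ! r \<subseteq> residue_classes n" if "r < length X" for r
    using un that nth_mem by blast
  have "X = tabloid_of_rows n (length lam) \<rho>"
  proof (rule nth_equalityI)
    fix r assume r: "r < length X"
    have "X ! r = {i \<in> residue_classes n. \<rho> i = r}"
      using \<rho>[OF r] sub[OF r] ex \<rho> by blast
    then show "X ! r = tabloid_of_rows n (length lam) \<rho> ! r"
      using r len by (simp add: nth_tabloid_of_rows)
  qed (simp add: len)
  then show ?thesis using that lt by blast
qed

lemma tabloid_of_rows_in_tabloids:
  assumes "\<forall>i \<in> residue_classes n. \<rho> i < length lam"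
    and "\<And>r. r < length lam \<Longrightarrow> card {i \<in> residue_classes n. \<rho> i = r} = lam ! r"
  shows "tabloid_of_rows n (length lam) \<rho> \<in> tabloids n lam"
  unfolding tabloids_def
proof (intro CollectI conjI allI impI)
  show "map card (tabloid_of_rows n (length lam) \<rho>) = lam"
    using assms(2) by (intro nth_equalityI) (auto simp: nth_tabloid_of_rows)
  show "\<Union> (set (tabloid_of_rows n (length lam) \<rho>)) = residue_classes n"
    using assms(1) by (auto simp: tabloid_of_rows_def)
qed (auto simp: nth_tabloid_of_rows)

text \<open>The neighbours \<open>j - 1, j, j + 1, j + 2\<close> of a residue.  For \<open>n = 3\<close> the first and the last coincide,
  and this is the only coincidence.\<close>

lemma residue_cases:
  assumes "j \<in> residue_classes n" "3 \<le> n"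
  defines "p \<equiv> (j - 1) mod int n" and "q \<equiv> (j + 1) mod int n" and "s \<equiv> (j + 2) mod int n"
  shows "p \<in> residue_classes n" "q \<in> residue_classes n" "s \<in> residue_classes n"
    and "(p + 1) mod int n = j" "(q + 1) mod int n = s"
    and "p \<noteq> j" "q \<noteq> j" "s \<noteq> j" "s \<noteq> q" "p \<noteq> q"
    and "\<And>y. y \<in> residue_classes n \<Longrightarrow> (y + 1) mod int n = j \<Longrightarrow> y = p"
    and "\<And>y. y \<in> residue_classes n \<Longrightarrow> (y + 1) mod int n = q \<Longrightarrow> y = j"
proof -
  have m: "(y + 1) mod int n = (if y = int n - 1 then 0 else y + 1)" if "y \<in> residue_classes n" for y
    using that by (auto simp: residue_classes_def)
  have p: "p = (if j = 0 then int n - 1 else j - 1)"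
    using assms by (auto simp: residue_classes_def zmod_minus1)
  have q: "q = (if j = int n - 1 then 0 else j + 1)" using m[OF assms(1)] q_def by simp
  have s: "s = (if j = int n - 1 then 1 else if j = int n - 2 then 0 else j + 2)"
  proof -
    have "(j + 2) mod int n = 1" if "j = int n - 1"
    proof -
      have "j + 2 = 1 + int n" using that by simp
      then have "(j + 2) mod int n = 1 mod int n" by (metis mod_add_self2)
      then show ?thesis using assms(2) by simp
    qed
    moreover have "(j + 2) mod int n = 0" if "j = int n - 2" using that by simp
    ultimately show ?thesis using assms by (auto simp: residue_classes_def)
  qed
  show pr: "p \<in> residue_classes n" and qr: "q \<in> residue_classes n" "s \<in> residue_classes n"
    using assms by (simp_all add: residue_classes_def)
  have j: "0 \<le> j" "j < int n" using assms(1) by (auto simp: residue_classes_def)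
  show "(p + 1) mod int n = j" using m[OF pr] p j by auto
  show "(q + 1) mod int n = s" using m[OF qr(1)] q s j assms(2) by auto
  show "p \<noteq> j" "q \<noteq> j" "s \<noteq> j" "s \<noteq> q" "p \<noteq> q"
    using p q s j assms(2) by (auto split: if_splits)
  show "y = p" if "y \<in> residue_classes n" "(y + 1) mod int n = j" for y
    using m[OF that(1)] that p j by (auto simp: residue_classes_def split: if_splits)
  show "y = j" if "y \<in> residue_classes n" "(y + 1) mod int n = q" for y
    using m[OF that(1)] that q j by (auto simp: residue_classes_def split: if_splits)
qed

lemma Des_exchange_iff:
  assumes \<rho>: "\<forall>i \<in> residue_classes n. \<rho> i < l" and j: "j \<in> residue_classes n" and n: "3 \<le> n"
  defines "p \<equiv> (j - 1) mod int n" and "q \<equiv> (j + 1) mod int n" and "s \<equiv> (j + 2) mod int n"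
    and "X \<equiv> tabloid_of_rows n l \<rho>"
  shows "p \<in> Des n X \<longleftrightarrow> \<rho> p < \<rho> j" "j \<in> Des n X \<longleftrightarrow> \<rho> j < \<rho> q" "q \<in> Des n X \<longleftrightarrow> \<rho> q < \<rho> s"
    and "p \<in> Des n (exchange j q X) \<longleftrightarrow> \<rho> p < \<rho> q" "j \<in> Des n (exchange j q X) \<longleftrightarrow> \<rho> q < \<rho> j"
      "q \<in> Des n (exchange j q X) \<longleftrightarrow> \<rho> j < \<rho> s"
    and "\<And>y. y \<notin> {p, j, q} \<Longrightarrow> y \<in> Des n (exchange j q X) \<longleftrightarrow> y \<in> Des n X"
proof -
  note rc = residue_cases[OF j n, folded p_def q_def s_def]
  have ex: "exchange j q X = tabloid_of_rows n l (\<rho> \<circ> Transposition.transpose j q)"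
    unfolding X_def using exchange_tabloid_of_rows j rc(2) by simp
  have d: "Des n X = {i \<in> residue_classes n. \<rho> i < \<rho> ((i + 1) mod int n)}"
    unfolding X_def by (rule Des_tabloid_of_rows[OF \<rho>])
  have d': "Des n (exchange j q X) = {i \<in> residue_classes n. \<rho> (Transposition.transpose j q i) < \<rho> (Transposition.transpose j q ((i + 1) mod int n))}"
    unfolding ex by (subst Des_tabloid_of_rows) (auto simp: \<rho> transpose_residue[OF j rc(2)])
  have q': "(j + 1) mod int n = q" by (simp add: q_def)
  show "p \<in> Des n X \<longleftrightarrow> \<rho> p < \<rho> j" "j \<in> Des n X \<longleftrightarrow> \<rho> j < \<rho> q" "q \<in> Des n X \<longleftrightarrow> \<rho> q < \<rho> s"
    using rc(1-10) j q' by (simp_all add: d)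
  show "p \<in> Des n (exchange j q X) \<longleftrightarrow> \<rho> p < \<rho> q" "j \<in> Des n (exchange j q X) \<longleftrightarrow> \<rho> q < \<rho> j"
      "q \<in> Des n (exchange j q X) \<longleftrightarrow> \<rho> j < \<rho> s"
    using rc(1-10) j q' by (simp_all add: d')
  show "y \<in> Des n (exchange j q X) \<longleftrightarrow> y \<in> Des n X" if "y \<notin> {p, j, q}" for y
  proof (cases "y \<in> residue_classes n")
    case True
    then have "(y + 1) mod int n \<noteq> j" "(y + 1) mod int n \<noteq> q" using rc(11,12)[of y] that by blast+
    then show ?thesis using that by (simp add: d d')
  qed (simp add: d d')
qed

text \<open>Write \<open>a, b, c\<close> for the rows of \<open>k, k + 1, k + 2\<close>.  A move of type \<open>k\<close> exchanges \<open>k\<close> and \<open>k + 1\<close>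
  with \<open>c\<close> as intermediate row, or \<open>k + 1\<close> and \<open>k + 2\<close> with \<open>a\<close> as intermediate row.  Other exchanges
  are excluded because an exchange of \<open>j\<close> and \<open>j + 1\<close> changes descents only at \<open>j - 1, j, j + 1\<close>, and at
  \<open>j - 1\<close> and \<open>j + 1\<close> only in the direction opposite to that at \<open>j\<close>.\<close>

lemma exchange_type_cases:
  assumes \<rho>: "\<forall>i \<in> residue_classes n. \<rho> i < l" and j: "j \<in> residue_classes n" and n: "3 \<le> n"
    and X: "X = tabloid_of_rows n l \<rho>" and k: "k \<in> residue_classes n"
    and type: "knuth_move_of_type n k X (exchange j ((j + 1) mod int n) X)"
  defines "k1 \<equiv> (k + 1) mod int n" and "k2 \<equiv> (k + 2) mod int n"
  shows "j = k \<and> min (\<rho> k) (\<rho> k1) < \<rho> k2 \<and> \<rho> k2 \<le> max (\<rho> k) (\<rho> k1)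
    \<or> j = k1 \<and> min (\<rho> k1) (\<rho> k2) \<le> \<rho> k \<and> \<rho> k < max (\<rho> k1) (\<rho> k2)"
proof -
  define X' where "X' = exchange j ((j + 1) mod int n) X"
  have t: "k \<in> Des n X - Des n X' \<and> k1 \<in> Des n X' - Des n X \<or> k \<in> Des n X' - Des n X \<and> k1 \<in> Des n X - Des n X'"
    using type by (simp add: knuth_move_of_type_def X'_def k1_def)
  note de = Des_exchange_iff[where \<rho> = \<rho> and l = l, OF \<rho> j n, folded X, folded X'_def]
  note rc = residue_cases[OF j n]
  note rk = residue_cases[OF k n, folded k1_def k2_def]
  have kin: "k \<in> {(j - 1) mod int n, j, (j + 1) mod int n}" "k1 \<in> {(j - 1) mod int n, j, (j + 1) mod int n}"
    using t de(7) by blast+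
  consider "j = k" | "j = k1" | "j \<noteq> k" "j \<noteq> k1" by blast
  then show ?thesis
  proof cases
    case 1
    have e: "(j + 1) mod int n = k1" "(j + 2) mod int n = k2" using 1 k1_def k2_def by simp_all
    show ?thesis using t 1 de(2,3,5,6)[unfolded e] by auto
  next
    case 2
    then have e: "(j - 1) mod int n = k" "(j + 1) mod int n = k2"
      using rc(11)[of k] k rk(5) by (auto simp: k1_def)
    show ?thesis using t 2 de(1,2,4,5)[unfolded e] by auto
  next
    case 3
    then have "k = (j - 1) mod int n \<or> k = (j + 1) mod int n" using kin by blast
    moreover have "k \<noteq> (j - 1) mod int n" using rc(4) 3 by (auto simp: k1_def)
    ultimately have e: "k = (j + 1) mod int n" by blast
    then have "k1 = (j - 1) mod int n" using kin 3 rk(7) by auto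
    then show ?thesis using t de(1,2,3,4,5,6) e by auto
  qed
qed

text \<open>The two cases of \<open>exchange_type_cases\<close> exclude each other.\<close>

lemma knuth_move_type_unique:
  assumes X: "X \<in> tabloids n lam" and n: "3 \<le> n" and k: "k \<in> residue_classes n"
    and t': "knuth_move_of_type n k X X'" and t'': "knuth_move_of_type n k X X''"
  shows "X' = X''"
proof -
  obtain \<rho> where \<rho>: "\<forall>i \<in> residue_classes n. \<rho> i < length lam" "X = tabloid_of_rows n (length lam) \<rho>"
    using tabloid_rows_exist[OF X] by blast
  obtain j' where j': "j' \<in> residue_classes n" "X' = exchange j' ((j' + 1) mod int n) X"
    using t' by (auto simp: knuth_move_of_type_def knuth_move_def)
  obtain j'' where j'': "j'' \<in> residue_classes n" "X'' = exchange j'' ((j'' + 1) mod int n) X"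
    using t'' by (auto simp: knuth_move_of_type_def knuth_move_def)
  have "j' = j''"
    using exchange_type_cases[OF \<rho>(1) j'(1) n \<rho>(2) k t'[unfolded j'(2)]]
      exchange_type_cases[OF \<rho>(1) j''(1) n \<rho>(2) k t''[unfolded j''(2)]]
    by (auto simp: min_def max_def split: if_splits)
  then show ?thesis using j' j'' by simp
qed

text \<open>An exchange of \<open>j\<close> and \<open>j + 1\<close> can change \<open>j\<close>, and any other change is at a neighbour of \<open>j\<close> and in
  the opposite direction.  As the descent sets are incomparable, \<open>j\<close> and at least one neighbour change,
  and each neighbour that changes gives a type.  For \<open>n = 2\<close> the
  residues \<open>j - 1\<close> and \<open>j + 1\<close> coincide, whence the hypothesis on \<open>n\<close>.\<close>

lemma Des_flips_iff_types:
  assumes X: "X \<in> tabloids n lam" and n: "3 \<le> n" and move: "knuth_move n X X'"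
  shows "(x \<in> Des n X \<longleftrightarrow> x \<notin> Des n X') \<longleftrightarrow>
    (\<exists>i \<in> residue_classes n. knuth_move_of_type n i X X' \<and> (x = i \<or> x = (i + 1) mod int n))"
proof
  assume "\<exists>i \<in> residue_classes n. knuth_move_of_type n i X X' \<and> (x = i \<or> x = (i + 1) mod int n)"
  then show "x \<in> Des n X \<longleftrightarrow> x \<notin> Des n X'" by (auto simp: knuth_move_of_type_def)
next
  assume flip: "x \<in> Des n X \<longleftrightarrow> x \<notin> Des n X'"
  obtain \<rho> where \<rho>: "\<forall>i \<in> residue_classes n. \<rho> i < length lam" "X = tabloid_of_rows n (length lam) \<rho>"
    using tabloid_rows_exist[OF X] by blast
  obtain j where j: "j \<in> residue_classes n" "X' = exchange j ((j + 1) mod int n) X"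
    using move by (auto simp: knuth_move_def)
  define p q where "p = (j - 1) mod int n" and "q = (j + 1) mod int n"
  note de = Des_exchange_iff[where \<rho> = \<rho> and l = "length lam", OF \<rho>(1) j(1) n, folded \<rho>(2), folded j(2), folded p_def q_def]
  note rc = residue_cases[OF j(1) n, folded p_def q_def]
  have tp: "knuth_move_of_type n p X X' \<longleftrightarrow>
      (p \<in> Des n X - Des n X' \<and> j \<in> Des n X' - Des n X \<or> p \<in> Des n X' - Des n X \<and> j \<in> Des n X - Des n X')"
    using move rc(4) by (simp add: knuth_move_of_type_def)
  have tj: "knuth_move_of_type n j X X' \<longleftrightarrow>
      (j \<in> Des n X - Des n X' \<and> q \<in> Des n X' - Des n X \<or> j \<in> Des n X' - Des n X \<and> q \<in> Des n X - Des n X')"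
    using move by (simp add: knuth_move_of_type_def q_def)
  have inc: "\<not> Des n X \<subseteq> Des n X'" "\<not> Des n X' \<subseteq> Des n X"
    using move by (auto simp: knuth_move_def)
  have "x = p \<or> x = j \<or> x = q" using flip de(7) by blast
  moreover have "knuth_move_of_type n p X X'" if "x = p"
    using flip unfolding that tp by (simp only: Diff_iff de(1-6)) linarith
  moreover have "knuth_move_of_type n j X X'" if "x = q"
    using flip unfolding that tj by (simp only: Diff_iff de(1-6)) linarith
  moreover have "knuth_move_of_type n p X X' \<or> knuth_move_of_type n j X X'"
  proof -
    have "p \<in> Des n X - Des n X' \<or> j \<in> Des n X - Des n X' \<or> q \<in> Des n X - Des n X'"
    proof -
      obtain y where "y \<in> Des n X" "y \<notin> Des n X'" using inc(1) by blast
      then show ?thesis using de(7)[of y] by auto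
    qed
    moreover have "p \<in> Des n X' - Des n X \<or> j \<in> Des n X' - Des n X \<or> q \<in> Des n X' - Des n X"
    proof -
      obtain y where "y \<in> Des n X'" "y \<notin> Des n X" using inc(2) by blast
      then show ?thesis using de(7)[of y] by auto
    qed
    ultimately show ?thesis unfolding tp tj by (simp only: Diff_iff de(1-6)) linarith
  qed
  ultimately show "\<exists>i \<in> residue_classes n. knuth_move_of_type n i X X' \<and> (x = i \<or> x = (i + 1) mod int n)"
    using rc(1,4) j(1) q_def by metis
qed

lemma finite_tabloids: "finite (tabloids n lam)"
proof -
  have "tabloids n lam \<subseteq> {X. set X \<subseteq> Pow (residue_classes n) \<and> length X = length lam}"
    by (auto simp: tabloids_def)
  moreover have "finite {X. set X \<subseteq> Pow (residue_classes n) \<and> length X = length lam}"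
    by (rule finite_lists_length_eq) (simp add: residue_classes_def)
  ultimately show ?thesis by (rule finite_subset)
qed

section \<open>Tabloids as circular words\<close>

text \<open>Letter number \<open>m\<close> is the row of the residue \<open>k - m\<close>, so the word is read against the direction of
  the residues and \<open>k\<close> says where the circle is cut.  With this direction the word of \<open>RRSS\<close> is weakly
  increasing.\<close>

definition tabloid_of_word :: "nat \<Rightarrow> nat list \<Rightarrow> int \<Rightarrow> tabloid" where
  "tabloid_of_word l w k =
     tabloid_of_rows (length w) l (\<lambda>i. w ! nat ((k - i) mod int (length w)))"

lemma mod_residue: "0 < n \<Longrightarrow> x mod int n \<in> residue_classes n"
  by (simp add: residue_classes_def)

text \<open>Moving the cut of the circle rotates the word.\<close>

lemma tabloid_of_word_rotate: "tabloid_of_word l (u @ v) k = tabloid_of_word l (v @ u) (k - int (length u))"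
proof (cases "u @ v = []")
  case False
  define n where "n = length u + length v"
  have n: "0 < n" using False by (auto simp: n_def)
  have "(u @ v) ! nat ((k - i) mod int n) = (v @ u) ! nat ((k - int (length u) - i) mod int n)" for i
  proof -
    define m where "m = nat ((k - int (length u) - i) mod int n)"
    have im: "int m = (k - int (length u) - i) mod int n" and m: "m < n"
      using n by (simp_all add: m_def nat_less_iff)
    have "int ((length u + m) mod n) = (int (length u) + (k - int (length u) - i) mod int n) mod int n"
      by (simp add: zmod_int im)
    also have "\<dots> = (k - i) mod int n" by (simp add: mod_simps)
    finally have "(length u + m) mod n = nat ((k - i) mod int n)" by simp
    moreover have "(v @ u) ! m = rotate (length u) (u @ v) ! m" by (simp add: rotate_append)
    ultimately show ?thesis using m by (simp add: nth_rotate n_def m_def)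
  qed
  then show ?thesis by (simp add: tabloid_of_word_def n_def add.commute)
qed (simp add: tabloid_of_word_def)

lemma bij_betw_residue_position:
  assumes "0 < n"
  shows "bij_betw (\<lambda>i. nat ((k - i) mod int n)) (residue_classes n) {..<n}"
proof (rule bij_betw_byWitness[where f' = "\<lambda>m. (k - int m) mod int n"])
  show "\<forall>i\<in>residue_classes n. (k - int (nat ((k - i) mod int n))) mod int n = i"
    using assms by (auto simp: residue_classes_def mod_simps)
  show "\<forall>m\<in>{..<n}. nat ((k - (k - int m) mod int n) mod int n) = m"
    using assms by (auto simp: mod_simps)
qed (use assms in \<open>auto simp: residue_classes_def nat_less_iff\<close>)

lemma position_residue:
  assumes "m < n"
  shows "nat ((k - (k - int m) mod int n) mod int n) = m"
  using assms by (simp add: mod_simps)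

lemma position_less:
  assumes "i \<in> residue_classes n"
  shows "nat ((k - i) mod int n) < n"
  using assms by (simp add: residue_classes_def nat_less_iff)

lemma residue_position:
  assumes "i \<in> residue_classes n"
  shows "(k - int (nat ((k - i) mod int n))) mod int n = i"
  using assms by (auto simp: residue_classes_def mod_simps)

lemma nth_tabloid_of_word:
  assumes "r < l"
  shows "tabloid_of_word l w k ! r = (\<lambda>m. (k - int m) mod int (length w)) ` {m. m < length w \<and> w ! m = r}"
proof (rule set_eqI)
  fix i
  let ?n = "length w"
  have "i \<in> (\<lambda>m. (k - int m) mod int ?n) ` {m. m < ?n \<and> w ! m = r}"
    if "i \<in> residue_classes ?n" "w ! nat ((k - i) mod int ?n) = r"
    using that residue_position[OF that(1)] position_less[OF that(1)]
    by (intro image_eqI[of _ _ "nat ((k - i) mod int ?n)"]) simp_all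
  moreover have "(k - int m) mod int ?n \<in> residue_classes ?n" if "m < ?n" for m
    by (rule mod_residue) (use that in linarith)
  ultimately show "i \<in> tabloid_of_word l w k ! r \<longleftrightarrow> i \<in> (\<lambda>m. (k - int m) mod int ?n) ` {m. m < ?n \<and> w ! m = r}"
    using assms position_residue[of _ ?n k]
    by (auto simp: tabloid_of_word_def nth_tabloid_of_rows)
qed

lemma word_rows_bounded:
  assumes "set w \<subseteq> {..<l}" "n = length w"
  shows "\<forall>i \<in> residue_classes n. w ! nat ((k - i) mod int n) < l"
  using assms position_less[of _ n k] by (auto simp: subset_iff)

lemma card_row_word:
  assumes "0 < n" "length w = n"
  shows "card {i \<in> residue_classes n. w ! nat ((k - i) mod int n) = r} = count (mset w) r"
proof -
  let ?f = "\<lambda>i. nat ((k - i) mod int n)"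
  have "bij_betw ?f {i \<in> residue_classes n. w ! ?f i = r} {m \<in> {..<n}. w ! m = r}"
    using bij_betw_residue_position[OF assms(1), of k] unfolding bij_betw_def
    by (auto simp: inj_on_def)
  then have "card {i \<in> residue_classes n. w ! ?f i = r} = card {m. m < n \<and> w ! m = r}"
    by (auto dest!: bij_betw_same_card)
  also have "\<dots> = count (mset w) r"
    using assms(2) by (simp add: count_mset count_list_eq_length_filter length_filter_conv_card eq_commute[of r])
  finally show ?thesis .
qed

lemma tabloid_of_word_in_tabloids:
  assumes "0 < n" "length w = n" "set w \<subseteq> {..<length lam}"
    and "\<And>r. r < length lam \<Longrightarrow> count (mset w) r = lam ! r"
  shows "tabloid_of_word (length lam) w k \<in> tabloids n lam"
  unfolding tabloid_of_word_def assms(2)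
proof (rule tabloid_of_rows_in_tabloids)
  show "\<forall>i \<in> residue_classes n. w ! nat ((k - i) mod int n) < length lam"
    using word_rows_bounded assms by metis
qed (simp add: card_row_word[OF assms(1,2)] assms(4))

lemma tabloid_of_word_exists:
  assumes "X \<in> tabloids n lam" "0 < n"
  obtains w where "X = tabloid_of_word (length lam) w k" "length w = n" "set w \<subseteq> {..<length lam}"
    "\<And>r. r < length lam \<Longrightarrow> count (mset w) r = lam ! r"
proof -
  obtain \<rho> where \<rho>: "\<forall>i \<in> residue_classes n. \<rho> i < length lam"
    and X: "X = tabloid_of_rows n (length lam) \<rho>"
    using tabloid_rows_exist[OF assms(1)] by blast
  define w where "w = map (\<lambda>m. \<rho> ((k - int m) mod int n)) [0..<n]"
  have len: "length w = n" by (simp add: w_def)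
  have wn: "w ! nat ((k - i) mod int n) = \<rho> i" if "i \<in> residue_classes n" for i
    using position_less[OF that] residue_position[OF that] by (simp add: w_def)
  have Xw: "X = tabloid_of_word (length lam) w k"
    unfolding X tabloid_of_word_def len by (rule tabloid_of_rows_cong) (simp add: wn)
  have "set w \<subseteq> {..<length lam}"
    using \<rho> assms(2) by (auto simp: w_def residue_classes_def)
  moreover have "count (mset w) r = lam ! r" if "r < length lam" for r
  proof -
    have "map card X = lam" using assms(1) by (simp add: tabloids_def)
    then have "lam ! r = card (X ! r)" using that by (metis length_map nth_map)
    also have "X ! r = {i \<in> residue_classes n. w ! nat ((k - i) mod int n) = r}"
      using that len by (simp add: Xw tabloid_of_word_def nth_tabloid_of_rows)
    finally show ?thesis using card_row_word[OF assms(2) len] by simp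
  qed
  ultimately show ?thesis using that Xw len by blast
qed

lemma Des_tabloid_of_word:
  assumes "set w \<subseteq> {..<l}" "n = length w"
  shows "Des n (tabloid_of_word l w k) = {i \<in> residue_classes n.
     w ! nat ((k - i) mod int n) < w ! nat ((k - i - 1) mod int n)}"
proof -
  have "(k - (i + 1) mod int n) mod int n = (k - i - 1) mod int n" for i
    by (simp add: mod_simps algebra_simps)
  then show ?thesis
    unfolding tabloid_of_word_def assms(2)[symmetric]
    by (subst Des_tabloid_of_rows[OF word_rows_bounded[OF assms]]) simp
qed

lemma Des_tabloid_of_word_position:
  assumes "set w \<subseteq> {..<l}" "n = length w" "Suc j < n"
  shows "(k - int j - 1) mod int n \<in> Des n (tabloid_of_word l w k) \<longleftrightarrow> w ! Suc j < w ! j"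
proof -
  have "(k - (k - int j - 1) mod int n) mod int n = int (Suc j)"
    using assms(3) by (simp add: mod_simps)
  moreover have "(k - (k - int j - 1) mod int n - 1) mod int n = int j"
  proof -
    have "(k - 1 - (k - int j - 1) mod int n) mod int n = int j"
      using assms(3) by (simp add: mod_simps)
    then show ?thesis by (simp add: algebra_simps)
  qed
  ultimately show ?thesis
    using assms(3) by (simp add: Des_tabloid_of_word[OF assms(1,2)] residue_classes_def nat_add_distrib)
qed

text \<open>A step on the letters number \<open>j, j + 1, j + 2\<close> concerns the residues \<open>k - j, k - j - 1, k - j - 2\<close>,
  and the last of these is the type.\<close>

lemma knuth_step_type:
  assumes "knuth_step w w'" "set w \<subseteq> {..<l}"
  defines "n \<equiv> length w"
  shows "\<exists>j. j + 2 < n \<and> knuth_move_of_type n ((k - int j - 2) mod int n)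
     (tabloid_of_word l w k) (tabloid_of_word l w' k)"
proof -
  have main: ?thesis
    if len: "length w' = n" and j: "j + 2 < n" and a: "a = j \<or> a = Suc j"
      and sw: "\<And>m. m < n \<Longrightarrow> w' ! m = w ! Transposition.transpose a (Suc a) m"
      and pat: "w ! Suc j < w ! j \<longleftrightarrow> \<not> w ! (j + 2) < w ! Suc j"
        "w' ! (j + 2) < w' ! Suc j \<longleftrightarrow> \<not> w ! (j + 2) < w ! Suc j"
        "w' ! Suc j < w' ! j \<longleftrightarrow> w ! (j + 2) < w ! Suc j" for a j
  proof -
    let ?X = "tabloid_of_word l w k" and ?X' = "tabloid_of_word l w' k"
    define i where "i = (k - int a - 1) mod int n"
    have n: "n = length w" "3 \<le> n" using j n_def by simp_all
    have ir: "i \<in> residue_classes n" unfolding i_def by (rule mod_residue) (use n in linarith)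
    have i1: "(i + 1) mod int n = (k - int a) mod int n" by (simp add: i_def mod_simps)
    have i1r: "(i + 1) mod int n \<in> residue_classes n" by (rule succ_residue[OF ir])
    have set: "set w' \<subseteq> {..<l}"
    proof
      fix x assume "x \<in> set w'"
      then obtain m where m: "m < n" "x = w' ! m" using len by (metis in_set_conv_nth)
      have "Transposition.transpose a (Suc a) m < n"
        using m a j by (auto simp: Transposition.transpose_def)
      then have "w ! Transposition.transpose a (Suc a) m \<in> set w" using n(1) by simp
      then show "x \<in> {..<l}" using m sw assms(2) by auto
    qed
    have "?X' = exchange i ((i + 1) mod int n) ?X"
      unfolding tabloid_of_word_def len n(1)[symmetric] exchange_tabloid_of_rows[OF ir i1r]
    proof (rule tabloid_of_rows_cong)
      fix x assume x: "x \<in> residue_classes n"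
      let ?pos = "\<lambda>x. nat ((k - x) mod int n)"
      have "Suc a < n" using a j by auto
      then have pi: "?pos i = Suc a" "?pos ((i + 1) mod int n) = a"
        using position_residue[of "Suc a" n k] position_residue[of a n k] unfolding i1
        by (simp_all add: i_def algebra_simps)
      have inj: "?pos x = ?pos y \<longleftrightarrow> x = y" if "y \<in> residue_classes n" for y
        using residue_position[OF x, of k] residue_position[OF that, of k] by metis
      have "?pos (Transposition.transpose i ((i + 1) mod int n) x) = Transposition.transpose a (Suc a) (?pos x)"
        using inj[OF ir] inj[OF i1r] pi by (auto simp: Transposition.transpose_def)
      then show "w' ! ?pos x = ((\<lambda>x. w ! ?pos x) \<circ> Transposition.transpose i ((i + 1) mod int n)) x"
        using sw[OF position_less[OF x, of k]] by simp
    qed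
    moreover have "(k - int j - 1) mod int n \<in> Des n ?X \<longleftrightarrow> (k - int j - 2) mod int n \<notin> Des n ?X"
      "(k - int j - 2) mod int n \<in> Des n ?X' \<longleftrightarrow> (k - int j - 2) mod int n \<notin> Des n ?X"
      "(k - int j - 1) mod int n \<in> Des n ?X' \<longleftrightarrow> (k - int j - 2) mod int n \<in> Des n ?X"
      using Des_tabloid_of_word_position[OF assms(2) n(1), of j k]
        Des_tabloid_of_word_position[OF assms(2) n(1), of "Suc j" k]
        Des_tabloid_of_word_position[OF set len[symmetric], of j k]
        Des_tabloid_of_word_position[OF set len[symmetric], of "Suc j" k] pat j
      by (simp_all add: algebra_simps)
    moreover have "((k - int j - 2) mod int n + 1) mod int n = (k - int j - 1) mod int n"
      by (simp add: mod_simps algebra_simps)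
    ultimately have "knuth_move_of_type n ((k - int j - 2) mod int n) ?X ?X'"
      using ir unfolding knuth_move_of_type_def knuth_move_def by auto
    then show ?thesis using j by blast
  qed
  from assms(1) show ?thesis
  proof cases
    case (witness_right x y z p q)
    show ?thesis
      by (rule main[where j = "length p" and a = "length p"])
        (use witness_right in \<open>auto simp: n_def nth_append nth_Cons' Transposition.transpose_def\<close>)
  next
    case (witness_left x y z p q)
    show ?thesis
      by (rule main[where j = "length p" and a = "Suc (length p)"])
        (use witness_left in \<open>auto simp: n_def nth_append nth_Cons' Transposition.transpose_def\<close>)
  qed
qed

lemma nth_rows_up:
  assumes "i \<le> length lam" "r < i"
  shows "{m. m < length (rows_up lam i) \<and> rows_up lam i ! m = r} = {sum_list (take r lam)..<sum_list (take r lam) + lam ! r}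
    \<and> length (rows_up lam i) = sum_list (take i lam)"
  using assms
proof (induction i arbitrary: r)
  case (Suc i)
  have len: "length (rows_up lam i) = sum_list (take i lam)"
    using Suc.IH[of 0] Suc.prems by (cases i) (simp_all add: rows_up_def)
  have len': "length (rows_up lam (Suc i)) = sum_list (take i lam) + lam ! i"
    by (simp add: rows_up_Suc row_block_def len)
  have set: "rows_up lam i ! m < i" if "m < sum_list (take i lam)" for m
    using set_rows_up len that by (metis nth_mem)
  have nth: "rows_up lam (Suc i) ! m = (if m < sum_list (take i lam) then rows_up lam i ! m else i)"
    if "m < sum_list (take i lam) + lam ! i" for m
    using that by (simp add: rows_up_Suc row_block_def nth_append len)
  have tk: "sum_list (take (Suc i) lam) = sum_list (take i lam) + lam ! i"
    using Suc.prems by (simp add: take_Suc_conv_app_nth)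
  show ?case
  proof (cases "r = i")
    case True
    have "{m. m < length (rows_up lam (Suc i)) \<and> rows_up lam (Suc i) ! m = r}
        = {sum_list (take r lam)..<sum_list (take r lam) + lam ! r}"
      using less_imp_neq[OF set] unfolding True len' by (auto simp: nth split: if_splits)
    then show ?thesis using len' tk by simp
  next
    case False
    then have r: "r < i" using Suc.prems by simp
    have "{m. m < length (rows_up lam (Suc i)) \<and> rows_up lam (Suc i) ! m = r}
       = {m. m < length (rows_up lam i) \<and> rows_up lam i ! m = r}"
      using False unfolding len' len by (auto simp: nth split: if_splits)
    then show ?thesis using Suc.IH[of r] Suc.prems r len len' tk by simp
  qed
qed simp

lemma length_rows_up: "length (rows_up lam (length lam)) = sum_list lam"
proof (cases lam)
  case (Cons a list)
  then show ?thesis using nth_rows_up[of "length lam" lam 0] by simp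
qed (simp add: rows_up_def)

lemma RRSS_word:
  assumes "sum_list lam = n"
  shows "RRSS n lam k = tabloid_of_word (length lam) (rows_up lam (length lam)) k"
proof (rule nth_equalityI)
  show "length (RRSS n lam k) = length (tabloid_of_word (length lam) (rows_up lam (length lam)) k)"
    by (simp add: RRSS_def tabloid_of_word_def)
  fix r assume "r < length (RRSS n lam k)"
  then have r: "r < length lam" by (simp add: RRSS_def)
  let ?s = "sum_list (take r lam)"
  have "tabloid_of_word (length lam) (rows_up lam (length lam)) k ! r
     = (\<lambda>m. (k - int m) mod int n) ` {?s..<?s + lam ! r}"
    unfolding nth_tabloid_of_word[OF r] nth_rows_up[OF order_refl r, THEN conjunct1]
    using assms length_rows_up by simp
  also have "{?s..<?s + lam ! r} = (\<lambda>j. ?s + j) ` {..<lam ! r}"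
    by (simp add: image_add_atLeastLessThan lessThan_atLeast0 add.commute)
  also have "(\<lambda>m. (k - int m) mod int n) ` (\<lambda>j. ?s + j) ` {..<lam ! r} = RRSS n lam k ! r"
    using r by (simp add: RRSS_def image_image diff_diff_eq)
  finally show "RRSS n lam k ! r = tabloid_of_word (length lam) (rows_up lam (length lam)) k ! r" by simp
qed

section \<open>Affine evacuation negates descents\<close>

lemma affine_evacuation_tabloid:
  assumes "is_affine_evacuation n lam e" "X \<in> tabloids n lam"
  shows "e X \<in> tabloids n lam"
  using assms by (auto simp: is_affine_evacuation_def graph_automorphism_def bij_betw_def)

text \<open>The definition only says that types are sent forward.  Since \<open>k \<mapsto> n - k - 1\<close> is an involution,
  \<open>e\<close> injects the finite set of moves of type \<open>k\<close> into that of type \<open>n - k - 1\<close> and vice versa, so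
  both injections are bijections.\<close>

lemma affine_evacuation_type_iff:
  assumes e: "is_affine_evacuation n lam e" and k: "k \<in> residue_classes n"
    and X: "X \<in> tabloids n lam" "X' \<in> tabloids n lam"
  shows "knuth_move_of_type n ((int n - k - 1) mod int n) (e X) (e X') \<longleftrightarrow> knuth_move_of_type n k X X'"
proof -
  define V where "V = tabloids n lam"
  define E where "E k = {(x, y) \<in> V \<times> V. knuth_move_of_type n k x y}" for k
  define k' where "k' = (int n - k - 1) mod int n"
  define ee where "ee = map_prod e e"
  have n: "0 < n" using k by (auto simp: residue_classes_def)
  have kr: "k' \<in> residue_classes n" "(int n - k' - 1) mod int n = k"
    using n k by (auto simp: k'_def residue_classes_def mod_simps)
  have bij: "bij_betw e V V" using e by (simp add: is_affine_evacuation_def graph_automorphism_def V_def)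
  have fin: "finite (E k)" for k
    by (rule finite_subset[of _ "V \<times> V"]) (auto simp: E_def V_def finite_tabloids)
  have inj: "inj_on ee (V \<times> V)"
    using bij unfolding ee_def by (auto simp: bij_betw_def intro: map_prod_inj_on)
  have maps: "ee ` E k \<subseteq> E ((int n - k - 1) mod int n)" if "k \<in> residue_classes n" for k
    using e that bij_betwE[OF bij] unfolding E_def ee_def is_affine_evacuation_def V_def by fastforce
  have card_le: "card (E k) \<le> card (E ((int n - k - 1) mod int n))" if "k \<in> residue_classes n" for k
  proof -
    have "card (E k) = card (ee ` E k)"
      by (rule card_image[symmetric], rule inj_on_subset[OF inj]) (auto simp: E_def)
    also have "\<dots> \<le> card (E ((int n - k - 1) mod int n))" by (rule card_mono[OF fin maps[OF that]])
    finally show ?thesis .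
  qed
  have "card (ee ` E k) = card (E k)"
    by (rule card_image, rule inj_on_subset[OF inj]) (auto simp: E_def)
  moreover have "card (E k) = card (E k')"
    using card_le[OF k] card_le[OF kr(1)] kr(2) by (simp add: k'_def)
  ultimately have eq: "ee ` E k = E k'"
    using card_subset_eq[OF fin[of k'], of "ee ` E k"] maps[OF k] by (simp add: k'_def)
  have "(e X, e X') \<in> E k' \<longleftrightarrow> (X, X') \<in> E k"
  proof
    assume "(e X, e X') \<in> E k'"
    then obtain y where y: "y \<in> E k" "ee y = (e X, e X')" unfolding eq[symmetric] by auto
    then have "y = (X, X')"
      using inj_onD[OF inj, of y "(X, X')"] X by (auto simp: E_def ee_def V_def)
    then show "(X, X') \<in> E k" using y by simp
  next
    assume "(X, X') \<in> E k"
    then show "(e X, e X') \<in> E k'" unfolding eq[symmetric] by (force simp: ee_def)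
  qed
  then show ?thesis using X affine_evacuation_tabloid[OF e] by (simp add: E_def V_def k'_def)
qed

definition negates_Des :: "nat \<Rightarrow> (tabloid \<Rightarrow> tabloid) \<Rightarrow> tabloid \<Rightarrow> bool" where
  "negates_Des n e X \<longleftrightarrow> (\<forall>i \<in> residue_classes n. i \<in> Des n (e X) \<longleftrightarrow> (- i) mod int n \<in> Des n X)"

text \<open>The residues at which the descents change are read off the types on both sides, and the types
  \<open>k\<close> and \<open>n - k - 1\<close> correspond: \<open>{k, k + 1}\<close> is the set of negatives of \<open>{n - k - 1, n - k}\<close>.\<close>

lemma negates_Des_knuth_move:
  assumes e: "is_affine_evacuation n lam e" and n: "3 \<le> n"
    and X: "X \<in> tabloids n lam" "X' \<in> tabloids n lam"
    and move: "knuth_move n X X'" and neg: "negates_Des n e X"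
  shows "negates_Des n e X'"
  unfolding negates_Des_def
proof
  fix i assume i: "i \<in> residue_classes n"
  let ?nk = "\<lambda>k. (int n - k - 1) mod int n"
  have n0: "0 < n" using n by simp
  have nk: "?nk k \<in> residue_classes n" "?nk (?nk k) = k" "(?nk k + 1) mod int n = (- k) mod int n"
    "(- ((k + 1) mod int n)) mod int n = ?nk k"
    if "k \<in> residue_classes n" for k
  proof -
    show "?nk k \<in> residue_classes n" by (rule mod_residue[OF n0])
    show "?nk (?nk k) = k" using that by (simp add: mod_simps residue_classes_def)
    have "(?nk k + 1) mod int n = (int n + (- k)) mod int n" by (simp add: mod_simps)
    then show "(?nk k + 1) mod int n = (- k) mod int n" by (simp only: mod_add_self1)
    have "?nk k = (int n + (- k - 1)) mod int n" by (simp add: algebra_simps)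
    then have "?nk k = (- k - 1) mod int n" by (simp only: mod_add_self1)
    then show "(- ((k + 1) mod int n)) mod int n = ?nk k" by (simp add: mod_simps)
  qed
  have neg_eq: "i = (- k) mod int n \<longleftrightarrow> (- i) mod int n = k" if "k \<in> residue_classes n" for k
    using that i by (auto simp: residue_classes_def mod_simps)
  have move': "knuth_move n (e X) (e X')"
    using e X move by (simp add: is_affine_evacuation_def graph_automorphism_def)
  have "(i \<in> Des n (e X) \<longleftrightarrow> i \<notin> Des n (e X')) \<longleftrightarrow>
      (\<exists>k' \<in> residue_classes n. knuth_move_of_type n k' (e X) (e X') \<and> (i = k' \<or> i = (k' + 1) mod int n))"
    by (rule Des_flips_iff_types[OF affine_evacuation_tabloid[OF e X(1)] n move'])
  also have "\<dots> \<longleftrightarrow> (\<exists>k \<in> residue_classes n. knuth_move_of_type n (?nk k) (e X) (e X') \<and>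
      (i = ?nk k \<or> i = (?nk k + 1) mod int n))"
    using nk(1,2) by metis
  also have "\<dots> \<longleftrightarrow> (\<exists>k \<in> residue_classes n. knuth_move_of_type n k X X' \<and>
      ((- i) mod int n = (k + 1) mod int n \<or> (- i) mod int n = k))"
  proof (rule bex_cong[OF refl])
    fix k assume k: "k \<in> residue_classes n"
    have "(k + 1) mod int n \<in> residue_classes n" by (rule mod_residue[OF n0])
    then have "i = ?nk k \<longleftrightarrow> (- i) mod int n = (k + 1) mod int n"
      using neg_eq[of "(k + 1) mod int n"] nk(4)[OF k] by simp
    then show "knuth_move_of_type n (?nk k) (e X) (e X') \<and> (i = ?nk k \<or> i = (?nk k + 1) mod int n) \<longleftrightarrow>
      knuth_move_of_type n k X X' \<and> ((- i) mod int n = (k + 1) mod int n \<or> (- i) mod int n = k)"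
      using affine_evacuation_type_iff[OF e k X] neg_eq[OF k] nk(3)[OF k] by simp
  qed
  also have "\<dots> \<longleftrightarrow> ((- i) mod int n \<in> Des n X \<longleftrightarrow> (- i) mod int n \<notin> Des n X')"
    unfolding Des_flips_iff_types[OF X(1) n move] by blast
  finally show "i \<in> Des n (e X') \<longleftrightarrow> (- i) mod int n \<in> Des n X'"
    using neg i unfolding negates_Des_def by blast
qed

lemma exchange_involutory: "exchange i j (exchange i j X) = X"
  unfolding exchange_def by (simp add: image_image comp_def)

lemma knuth_move_sym: "knuth_move n X X' \<Longrightarrow> knuth_move n X' X"
  unfolding knuth_move_def using exchange_involutory by metis

lemma knuth_move_of_type_sym: "knuth_move_of_type n k X X' \<Longrightarrow> knuth_move_of_type n k X' X"
  using knuth_move_sym unfolding knuth_move_of_type_def by blast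

definition has_content :: "nat list \<Rightarrow> nat list \<Rightarrow> bool" where
  "has_content lam w \<longleftrightarrow> mset w = mset (rows_up lam (length lam))"

lemma has_contentD:
  assumes "has_content lam w" "sum_list lam = n"
  shows "length w = n" "set w \<subseteq> {..<length lam}" "\<And>r. r < length lam \<Longrightarrow> count (mset w) r = lam ! r"
proof -
  have eq: "mset w = mset (rows_up lam (length lam))" using assms by (simp add: has_content_def)
  show "length w = n" using mset_eq_length[OF eq] length_rows_up assms(2) by simp
  show "set w \<subseteq> {..<length lam}"
    using mset_eq_setD[OF eq] set_rows_up by auto
  show "\<And>r. r < length lam \<Longrightarrow> count (mset w) r = lam ! r" unfolding eq by (simp add: count_rows_up)
qed

lemma has_content_tabloid:
  assumes "has_content lam w" "sum_list lam = n" "0 < n"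
  shows "tabloid_of_word (length lam) w k \<in> tabloids n lam"
  by (rule tabloid_of_word_in_tabloids[OF assms(3) has_contentD[OF assms(1,2)]])

lemma negates_Des_knuth_equiv:
  assumes "u \<approx> v" and e: "is_affine_evacuation n lam e" and lam: "sum_list lam = n"
    and u: "has_content lam u" "negates_Des n e (tabloid_of_word (length lam) u k)"
  shows "negates_Des n e (tabloid_of_word (length lam) v k)"
  using assms(1)
proof (induction rule: equivclp_induct)
  case base
  show ?case by (rule u(2))
next
  case (step y z)
  let ?T = "\<lambda>w. tabloid_of_word (length lam) w k"
  have c: "has_content lam y" "has_content lam z"
    using step.hyps u(1) knuth_equiv_mset knuth_step_mset unfolding has_content_def by metis+
  have "3 \<le> n"
    using step.hyps(2) has_contentD(1)[OF c(1) lam] has_contentD(1)[OF c(2) lam]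
    by (auto elim!: knuth_step.cases)
  moreover have "\<exists>i. knuth_move_of_type n i (?T y) (?T z)"
    using step.hyps(2)
  proof
    assume "knuth_step y z"
    then show ?thesis
      using knuth_step_type[of y z "length lam" k] has_contentD[OF c(1) lam] by blast
  next
    assume "knuth_step z y"
    then show ?thesis
      using knuth_step_type[of z y "length lam" k] has_contentD[OF c(2) lam] knuth_move_of_type_sym by blast
  qed
  then have "knuth_move n (?T y) (?T z)" by (auto simp: knuth_move_of_type_def)
  ultimately show ?case
    using negates_Des_knuth_move[OF e _ has_content_tabloid[OF c(1) lam] has_content_tabloid[OF c(2) lam]] step.IH
    by simp
qed

text \<open>The word is weakly increasing, so its only possible descent is at the cut, at the residue \<open>k\<close>;
  and \<open>e\<close> replaces \<open>k\<close> by \<open>- k\<close>.\<close>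

lemma negates_Des_RRSS:
  assumes e: "is_affine_evacuation n lam e" and lam: "sum_list lam = n" and n: "0 < n"
  shows "negates_Des n e (tabloid_of_word (length lam) (rows_up lam (length lam)) k)"
proof -
  let ?w = "rows_up lam (length lam)"
  let ?T = "tabloid_of_word (length lam) ?w"
  have len: "length ?w = n" "set ?w \<subseteq> {..<length lam}"
    using has_contentD[of lam ?w] lam by (auto simp: has_content_def)
  have T_mod: "?T (k mod int n) = ?T k" for k
    unfolding tabloid_of_word_def by (rule tabloid_of_rows_cong) (simp add: len mod_simps)
  have Des: "Des n (?T k) = (if ?w ! 0 < ?w ! (n - 1) then {k mod int n} else {})" for k
  proof -
    have "i \<in> Des n (?T k) \<longleftrightarrow> i = k mod int n \<and> ?w ! 0 < ?w ! (n - 1)" if i: "i \<in> residue_classes n" for i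
    proof -
      define m where "m = nat ((k - i) mod int n)"
      have m: "m < n" "int m = (k - i) mod int n" using n by (simp_all add: m_def nat_less_iff)
      have prev: "(k - i - 1) mod int n = (int m - 1) mod int n" by (simp add: m mod_simps)
      have ik: "i = k mod int n \<longleftrightarrow> m = 0"
      proof
        assume "m = 0"
        then show "i = k mod int n" using residue_position[OF i, of k] m_def by simp
      next
        assume "i = k mod int n"
        then show "m = 0" by (simp add: m_def mod_simps)
      qed
      have D: "i \<in> Des n (?T k) \<longleftrightarrow> ?w ! m < ?w ! nat ((k - i - 1) mod int n)"
        using i unfolding Des_tabloid_of_word[OF len(2) len(1)[symmetric]] m_def by simp
      show ?thesis
      proof (cases m)
        case 0
        then have "nat ((k - i - 1) mod int n) = n - 1" using prev n by (simp add: zmod_minus1 nat_diff_distrib)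
        then show ?thesis using D ik 0 by simp
      next
        case (Suc j)
        then have "nat ((k - i - 1) mod int n) = j" using prev m by simp
        moreover have "?w ! j \<le> ?w ! m"
          using sorted_rows_up[of lam "length lam"] m len Suc by (simp add: sorted_iff_nth_Suc)
        ultimately show ?thesis using D ik Suc by simp
      qed
    qed
    moreover have "k mod int n \<in> residue_classes n" by (rule mod_residue[OF n])
    moreover have "Des n (?T k) \<subseteq> residue_classes n" by (auto simp: Des_def)
    ultimately show ?thesis by auto
  qed
  have kr: "k mod int n \<in> residue_classes n" by (rule mod_residue[OF n])
  have "e (?T k) = e (RRSS n lam (k mod int n))" by (simp add: RRSS_word[OF lam] T_mod)
  also have "\<dots> = RRSS n lam ((int n - k mod int n) mod int n)"
    using e kr by (simp add: is_affine_evacuation_def)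
  also have "\<dots> = ?T (- k)"
  proof -
    have "(int n - k mod int n) mod int n = (int n + (- k)) mod int n" by (simp add: mod_simps)
    then have "(int n - k mod int n) mod int n = (- k) mod int n" by (simp only: mod_add_self1)
    then show ?thesis by (simp add: RRSS_word[OF lam] T_mod)
  qed
  finally have eT: "e (?T k) = ?T (- k)" .
  have "i = (- k) mod int n \<longleftrightarrow> (- i) mod int n = k mod int n" if "i \<in> residue_classes n" for i
    using that by (auto simp: residue_classes_def mod_simps) (metis mod_minus_eq minus_minus mod_pos_pos_trivial)
  then show ?thesis unfolding negates_Des_def eT Des by auto
qed

text \<open>Downward induction on \<open>i\<close>, from the word of \<open>RRSS\<close> at \<open>i = length lam\<close> to the decreasing word at
  \<open>i = 0\<close>.  The cut \<open>k\<close> has to be arbitrary, because each rotation moves it.\<close>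

lemma negates_Des_rows_down_up:
  assumes e: "is_affine_evacuation n lam e" and lam: "is_partition n lam" and n: "0 < n"
    and i: "i \<le> length lam"
  shows "negates_Des n e (tabloid_of_word (length lam) (rows_down lam i (length lam) @ rows_up lam i) k)"
  using i
proof (induction "length lam - i" arbitrary: i k)
  case 0
  then have "i = length lam" by simp
  then show ?case
    using negates_Des_RRSS[OF e _ n] lam by (simp add: rows_down_def is_partition_def)
next
  case (Suc d)
  let ?l = "length lam"
  let ?u = "rows_up lam i" and ?d = "rows_down lam i ?l"
  have il: "i < ?l" using Suc by simp
  have sum: "sum_list lam = n" and srt: "sorted_wrt (\<ge>) lam" using lam by (simp_all add: is_partition_def)
  have content: "has_content lam (rows_down lam (Suc i) ?l @ rows_up lam (Suc i))"
    unfolding has_content_def using mset_rows_down[of "Suc i" ?l lam] il by (simp add: add.commute)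
  have "negates_Des n e (tabloid_of_word ?l (rows_down lam (Suc i) ?l @ rows_up lam (Suc i)) (k - int (length ?d)))"
    using Suc by simp
  then have "negates_Des n e (tabloid_of_word ?l (?u @ ?d) (k - int (length ?d)))"
    using negates_Des_knuth_equiv[OF equivclp_sym[OF rows_exchange[OF srt il order_refl]] e sum content] by blast
  then show ?case by (simp add: tabloid_of_word_rotate[of ?l ?d ?u k])
qed

text \<open>The decreasing word is a Yamanouchi word, hence equivalent to all others of its content.\<close>

lemma negates_Des_yamanouchi:
  assumes e: "is_affine_evacuation n lam e" and lam: "is_partition n lam" and n: "0 < n"
    and w: "yamanouchi w" "has_content lam w"
  shows "negates_Des n e (tabloid_of_word (length lam) w 0)"
proof -
  let ?l = "length lam"
  let ?d = "rows_down lam 0 ?l"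
  have sum: "sum_list lam = n" and srt: "sorted_wrt (\<ge>) lam" using lam by (simp_all add: is_partition_def)
  have d: "mset ?d = mset (rows_up lam ?l)" using mset_rows_down[of 0 ?l lam] by (simp add: rows_up_def)
  then have "?d \<approx> w"
    using yamanouchi_connected[OF yamanouchi_rows_down[OF srt order_refl] w(1)] w(2) by (simp add: has_content_def)
  moreover have "negates_Des n e (tabloid_of_word ?l ?d 0)"
    using negates_Des_rows_down_up[OF e lam n, of 0 0] by (simp add: rows_up_def)
  ultimately show ?thesis
    using negates_Des_knuth_equiv[OF _ e sum] d by (simp add: has_content_def)
qed

section \<open>Descents under row insertion\<close>

definition bump_in :: "tableau \<Rightarrow> nat \<Rightarrow> tableau" where
  "bump_in P x = fst (insert_entry x P)"

definition insertion_tableau :: "nat list \<Rightarrow> tableau" where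
  "insertion_tableau xs = foldl bump_in [] xs"

lemma bump_in_Nil [simp]: "bump_in [] x = [[x]]"
  by (simp add: bump_in_def)

lemma bump_in_None: "row_insert x R = (R', None) \<Longrightarrow> bump_in (R # P) x = R' # P"
  by (simp add: bump_in_def)

lemma bump_in_Some: "row_insert x R = (R', Some y) \<Longrightarrow> bump_in (R # P) x = R' # bump_in P y"
  by (simp add: bump_in_def split: prod.splits)

lemma fst_RS: "fst (RS n w) = insertion_tableau (map w [1..<Suc n])"
proof -
  have "fst (fold RS_step (map (\<lambda>k. (k, w k)) ks) PQ) = foldl bump_in (fst PQ) (map w ks)" for ks PQ
    by (induction ks arbitrary: PQ) (auto simp: RS_step_def bump_in_def split: prod.splits)
  then show ?thesis by (simp add: RS_def insertion_tableau_def del: upt_Suc)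
qed

lemma row_insert_append: "(\<And>a. a \<in> set A \<Longrightarrow> \<not> x < a) \<Longrightarrow> row_insert x A = (A @ [x], None)"
  by (induction A) auto

lemma row_insert_bump:
  "\<forall>a \<in> set A. \<not> x < a \<Longrightarrow> x < y \<Longrightarrow> row_insert x (A @ y # B) = (A @ x # B, Some y)"
  by (induction A) auto

lemma row_insert_cases:
  obtains "row_insert x R = (R @ [x], None)" "\<And>r. r \<in> set R \<Longrightarrow> \<not> x < r"
  | A y B where "R = A @ y # B" "row_insert x R = (A @ x # B, Some y)" "x < y"
      "\<forall>a \<in> set A. \<not> x < a"
proof (cases "\<exists>r \<in> set R. x < r")
  case True
  then obtain A y B where R: "R = A @ y # B" "x < y" "\<forall>a \<in> set A. \<not> x < a"
    using split_list_first_prop[of R "\<lambda>r. x < r"] by blast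
  then show ?thesis using that(2)[of A y B] row_insert_bump[of A x y B] by simp
next
  case False
  then show ?thesis using that(1) row_insert_append[of R x] by blast
qed

definition row_strict :: "tableau \<Rightarrow> bool" where
  "row_strict P \<longleftrightarrow> (\<forall>R \<in> set P. sorted_wrt (<) R) \<and> distinct (concat P)"

lemma row_strict_Cons:
  "row_strict (R # P) \<longleftrightarrow> sorted_wrt (<) R \<and> distinct R \<and> set R \<inter> set (concat P) = {} \<and> row_strict P"
  by (auto simp: row_strict_def)

lemma set_bump_in: "set (concat (bump_in P x)) = insert x (set (concat P))"
proof (induction P arbitrary: x)
  case (Cons R P)
  show ?case
  proof (cases rule: row_insert_cases[of x R])
    case 1
    then show ?thesis by (simp add: bump_in_None)
  next
    case (2 A y B)
    then show ?thesis using Cons[of y] by (auto simp: bump_in_Some)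
  qed
qed simp

text \<open>The situation after one bump: the entry \<open>y\<close> has been replaced by \<open>x\<close> and is waiting above \<open>P\<close>.\<close>

lemma row_bump_strict:
  assumes "row_strict ([x] # (A @ y # B) # P)" "x < y" "\<forall>a \<in> set A. \<not> x < a"
  shows "\<And>a. a \<in> set A \<Longrightarrow> a < x" "\<And>b. b \<in> set B \<Longrightarrow> y < b"
    "sorted_wrt (<) (A @ x # B)" "row_strict ([y] # P)" "row_strict ((A @ x # B) # P)" "y \<notin> set (A @ x # B)"
proof -
  show lt: "a < x" if "a \<in> set A" for a
    using assms that by (fastforce simp: row_strict_Cons)
  show "b \<in> set B \<Longrightarrow> y < b" for b
    using assms by (auto simp: row_strict_Cons sorted_wrt_append)
  then show "sorted_wrt (<) (A @ x # B)" "row_strict ([y] # P)" "row_strict ((A @ x # B) # P)" "y \<notin> set (A @ x # B)"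
    using assms lt by (fastforce simp: row_strict_Cons sorted_wrt_append)+
qed

lemma row_strict_bump_in: "row_strict ([x] # P) \<Longrightarrow> row_strict (bump_in P x)"
proof (induction P arbitrary: x)
  case (Cons R P)
  show ?case
  proof (cases rule: row_insert_cases[of x R])
    case 1
    have "r < x" if "r \<in> set R" for r
    proof -
      have "r \<noteq> x" using Cons.prems that by (auto simp: row_strict_Cons)
      then show ?thesis using 1(2)[OF that] by linarith
    qed
    then show ?thesis using 1 Cons.prems by (auto simp: bump_in_None row_strict_Cons sorted_wrt_append)
  next
    case (2 A y B)
    note rb = row_bump_strict[OF Cons.prems[unfolded 2(1)] 2(3,4)]
    show ?thesis
      using rb(4,5,6) Cons.IH[OF rb(4)] set_bump_in[of P y] 2
      by (auto simp: bump_in_Some row_strict_Cons)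
  qed
qed simp

text \<open>The recursion over the rows matches that of the insertion: a bumped entry is a new row on top of
  the remaining ones.\<close>

fun descent :: "nat \<Rightarrow> tableau \<Rightarrow> bool" where
  "descent i [] = False"
| "descent i (R # P) \<longleftrightarrow> i \<in> set R \<and> Suc i \<in> set (concat P) \<or> descent i P"

text \<open>Regard the entry that is being inserted as a row of its own above the tableau.  Then inserting it,
  and likewise each single bump, preserves whether \<open>i + 1\<close> is strictly below \<open>i\<close>: of two
  consecutive values in a row, the smaller one is bumped first.\<close>

lemma descent_bump_in: "row_strict ([x] # P) \<Longrightarrow> descent i (bump_in P x) \<longleftrightarrow> descent i ([x] # P)"
proof (induction P arbitrary: x)
  case (Cons R P)
  show ?case
  proof (cases rule: row_insert_cases[of x R])
    case 1
    then show ?thesis using 1(2)[of "Suc x"] by (auto simp: bump_in_None)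
  next
    case (2 A y B)
    note rb = row_bump_strict[OF Cons.prems[unfolded 2(1)] 2(3,4)]
    have "Suc x \<in> set B \<Longrightarrow> False" "Suc x \<in> set A \<Longrightarrow> False" "Suc i = y \<Longrightarrow> i \<in> set A \<Longrightarrow> False"
      "Suc i = y \<Longrightarrow> i \<in> set B \<Longrightarrow> False" "y \<in> set (concat P) \<Longrightarrow> False" "y = x \<Longrightarrow> False"
      using rb(1)[of i] rb(1)[of "Suc x"] rb(2)[of "Suc x"] rb(2)[of i] rb(4) 2(3)
      by (auto simp: row_strict_Cons)
    then show ?thesis
      using Cons.IH[OF rb(4)] set_bump_in[of P y] 2 rb(6)
      by (auto simp: bump_in_Some)
  qed
qed simp

lemma insertion_tableau_snoc: "insertion_tableau (xs @ [x]) = bump_in (insertion_tableau xs) x"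
  by (simp add: insertion_tableau_def)

lemma set_insertion_tableau: "set (concat (insertion_tableau xs)) = set xs"
proof (induction xs rule: rev_induct)
  case (snoc x xs)
  then show ?case using set_bump_in[of "insertion_tableau xs" x] by (simp add: insertion_tableau_snoc)
qed (simp add: insertion_tableau_def)

lemma row_strict_insertion_tableau: "distinct xs \<Longrightarrow> row_strict (insertion_tableau xs)"
proof (induction xs rule: rev_induct)
  case (snoc x xs)
  then show ?case
    using set_insertion_tableau[of xs]
    by (auto simp: insertion_tableau_snoc row_strict_Cons intro!: row_strict_bump_in)
qed (simp add: insertion_tableau_def row_strict_def)

definition before :: "nat list \<Rightarrow> nat \<Rightarrow> nat \<Rightarrow> bool" where
  "before xs u v \<longleftrightarrow> (\<exists>p q. xs = p @ v # q \<and> u \<in> set p)"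

lemma before_snoc: "before (xs @ [x]) u v \<longleftrightarrow> before xs u v \<or> x = v \<and> u \<in> set xs"
  unfolding before_def
proof
  assume "\<exists>p q. xs @ [x] = p @ v # q \<and> u \<in> set p"
  then obtain p q where "xs @ [x] = p @ v # q" "u \<in> set p" by blast
  then show "(\<exists>p q. xs = p @ v # q \<and> u \<in> set p) \<or> x = v \<and> u \<in> set xs"
    by (cases q rule: rev_cases) auto
next
  assume "(\<exists>p q. xs = p @ v # q \<and> u \<in> set p) \<or> x = v \<and> u \<in> set xs"
  then show "\<exists>p q. xs @ [x] = p @ v # q \<and> u \<in> set p"
    by (metis append.assoc append_Cons)
qed

lemma before_in: "before xs u v \<Longrightarrow> u \<in> set xs \<and> v \<in> set xs"
  by (auto simp: before_def)

lemma before_append: "before xs u v \<Longrightarrow> before (xs @ ys) u v"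
  unfolding before_def by (metis append.assoc append_Cons)

lemma before_total: "u \<in> set xs \<Longrightarrow> v \<in> set xs \<Longrightarrow> u \<noteq> v \<Longrightarrow> before xs u v \<or> before xs v u"
  by (induction xs rule: rev_induct) (auto simp: before_snoc)

lemma before_asym: "distinct xs \<Longrightarrow> before xs u v \<Longrightarrow> \<not> before xs v u"
  by (induction xs rule: rev_induct) (auto simp: before_snoc dest: before_in)

text \<open>The order of two letters is settled as soon as both have occurred.\<close>

lemma before_prefix:
  assumes "distinct (xs @ ys)" "u \<in> set xs" "v \<in> set xs" "u \<noteq> v"
  shows "before xs u v \<longleftrightarrow> before (xs @ ys) u v"
  using before_total[OF assms(2-4)] before_asym[OF assms(1), of u v] before_asym[OF assms(1), of v u]
    before_append[of xs] by blast

lemma before_rev: "before (rev xs) u v \<longleftrightarrow> before xs v u"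
proof -
  have "before (rev xs) u v" if "before xs v u" for xs u v
  proof -
    obtain p q where pq: "xs = p @ u # q" "v \<in> set p" using \<open>before xs v u\<close> by (auto simp: before_def)
    obtain p1 p2 where "p = p1 @ v # p2" using split_list[OF pq(2)] by blast
    then have "rev xs = (rev q @ u # rev p2) @ v # rev p1" using pq by simp
    then show ?thesis unfolding before_def by (metis in_set_conv_decomp)
  qed
  from this[of xs] this[of "rev xs" u v] show ?thesis by auto
qed

lemma before_map:
  assumes "inj_on f (insert u (insert v (set xs)))"
  shows "before (map f xs) (f u) (f v) \<longleftrightarrow> before xs u v"
  using assms
proof (induction xs rule: rev_induct)
  case (snoc x xs)
  have "f u \<in> f ` set xs \<longleftrightarrow> u \<in> set xs" "f x = f v \<longleftrightarrow> x = v"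
    using snoc.prems by (auto simp: inj_on_def)
  moreover have "inj_on f (insert u (insert v (set xs)))"
    by (rule inj_on_subset[OF snoc.prems]) auto
  ultimately show ?case using snoc.IH by (simp add: before_snoc)
qed (simp add: before_def)

text \<open>Each insertion preserves the descents by \<open>descent_bump_in\<close>, and a letter \<open>x\<close> arriving above the
  tableau creates the descent \<open>x\<close> precisely if \<open>x + 1\<close> has arrived earlier.\<close>

lemma descent_insertion_tableau:
  "distinct xs \<Longrightarrow> descent i (insertion_tableau xs) \<longleftrightarrow> before xs (Suc i) i"
proof (induction xs rule: rev_induct)
  case (snoc x xs)
  have "row_strict ([x] # insertion_tableau xs)"
    using row_strict_insertion_tableau[of xs] set_insertion_tableau[of xs] snoc.prems
    by (auto simp: row_strict_Cons)
  then show ?case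
    using snoc set_insertion_tableau[of xs]
    by (auto simp: insertion_tableau_snoc descent_bump_in before_snoc)
qed (simp add: insertion_tableau_def before_def)

text \<open>The entries of \<open>r\<close> bump those of \<open>s\<close> one after another and in the same order, so the rest of the
  tableau sees the insertion of \<open>s\<close>.  The list \<open>A\<close> holds the entries of \<open>r\<close> that are already in place.\<close>

lemma foldl_bump_in_row:
  assumes "\<And>a x. a \<in> set A \<Longrightarrow> x \<in> set r \<Longrightarrow> a < x" "sorted_wrt (<) r"
    "length s \<le> length r" "\<And>j. j < length s \<Longrightarrow> r ! j < s ! j"
  shows "foldl bump_in ((A @ s) # P) r = (A @ r) # foldl bump_in P s"
  using assms
proof (induction r arbitrary: A s P)
  case (Cons x r)
  have A: "\<not> x < a" if "a \<in> set A" for a using Cons.prems(1)[OF that, of x] by simp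
  have Ax: "a < z" if "a \<in> set (A @ [x])" "z \<in> set r" for a z
    using Cons.prems(1,2) that by auto
  show ?case
  proof (cases s)
    case Nil
    have "bump_in (A # P) x = (A @ [x]) # P"
      by (rule bump_in_None) (rule row_insert_append, rule A)
    then show ?thesis using Cons.IH[of "A @ [x]" "[]" P] Ax Cons.prems Nil by simp
  next
    case (Cons y s')
    have "x < y" using Cons.prems(4)[of 0] Cons by simp
    then have "bump_in ((A @ s) # P) x = (A @ x # s') # bump_in P y"
      unfolding Cons by (intro bump_in_Some row_insert_bump) (use A in auto)
    moreover have "r ! j < s' ! j" if "j < length s'" for j
      using Cons.prems(4)[of "Suc j"] Cons that by simp
    ultimately show ?thesis
      using Cons.IH[of "A @ [x]" s' "bump_in P y"] Ax Cons.prems Cons by simp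
  qed
qed simp

text \<open>The rows are inserted from the bottom to the top, and each new row pushes the rows below it down
  by one.\<close>

lemma insertion_tableau_reading_word:
  assumes "\<And>R. R \<in> set T \<Longrightarrow> R \<noteq> [] \<and> sorted_wrt (<) R"
    and "\<And>r. Suc r < length T \<Longrightarrow> length (T ! Suc r) \<le> length (T ! r)
        \<and> (\<forall>j < length (T ! Suc r). T ! r ! j < T ! Suc r ! j)"
  shows "insertion_tableau (concat (rev T)) = T"
proof -
  have "insertion_tableau (concat (rev T)) = T \<and> (\<forall>R P. T = R # P \<longrightarrow> foldl bump_in P R = T)"
    using assms
  proof (induction T)
    case (Cons R T)
    have "insertion_tableau (concat (rev T)) = T \<and> (\<forall>S P. T = S # P \<longrightarrow> foldl bump_in P S = T)"
      by (rule Cons.IH) (use Cons.prems(1) Cons.prems(2)[of "Suc _"] in auto)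
    then have IH: "insertion_tableau (concat (rev T)) = T" "\<And>S P. T = S # P \<Longrightarrow> foldl bump_in P S = T"
      by auto
    have R: "R \<noteq> []" "sorted_wrt (<) R" using Cons.prems(1) by auto
    have "foldl bump_in T R = R # T"
    proof (cases T)
      case Nil
      obtain x r where r: "R = x # r" using R by (cases R) auto
      show ?thesis
        using foldl_bump_in_row[of "[x]" r "[]" "[]"] R r Nil by simp
    next
      case (Cons S P)
      show ?thesis
        using foldl_bump_in_row[of "[]" R S P] IH(2)[OF Cons] Cons.prems(2)[of 0] R Cons by simp
    qed
    then show ?case using IH by (simp add: insertion_tableau_def)
  qed (simp add: insertion_tableau_def)
  then show ?thesis by blast
qed

abbreviation swap_entries :: "nat \<Rightarrow> tableau \<Rightarrow> tableau" where
  "swap_entries v P \<equiv> map (map (Transposition.transpose v (Suc v))) P"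

lemma row_insert_transpose:
  fixes v :: nat
  defines "f \<equiv> Transposition.transpose v (Suc v)"
  assumes "\<not> (x = v \<and> Suc v \<in> set R)" "\<not> (x = Suc v \<and> v \<in> set R)"
  shows "row_insert (f x) (map f R) = map_prod (map f) (map_option f) (row_insert x R)"
  using assms(2,3)
proof (induction R)
  case (Cons y R)
  have "f x < f y \<longleftrightarrow> x < y"
    using Cons.prems unfolding f_def Transposition.transpose_def by auto
  then show ?case using Cons by (auto simp: map_prod_def split: prod.splits)
qed simp

text \<open>Insertion compares only the inserted entry with entries of the row, so it commutes with the
  exchange of \<open>v\<close> and \<open>v + 1\<close> unless these two are compared with each other.\<close>

lemma bump_in_swap_row:
  fixes v :: nat
  defines "f \<equiv> Transposition.transpose v (Suc v)"
  assumes "\<not> (x = v \<and> Suc v \<in> set R)" "\<not> (x = Suc v \<and> v \<in> set R)"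
  shows "row_insert x R = (R', None) \<Longrightarrow> bump_in (map (map f) (R # P)) (f x) = map (map f) (R' # P)"
    "row_insert x R = (R', Some y) \<Longrightarrow> bump_in (map (map f) (R # P)) (f x) = map f R' # bump_in (map (map f) P) (f y)"
  using row_insert_transpose[OF assms(2,3), folded f_def] by (simp_all add: bump_in_None bump_in_Some)

section \<open>Dual Knuth moves under row insertion\<close>

lemma descent_entries: "descent i P \<Longrightarrow> i \<in> set (concat P) \<and> Suc i \<in> set (concat P)"
  by (induction P) auto

lemma descent_bump_row:
  assumes "row_strict ([x] # R # P)" "row_insert x R = (R', Some y)"
  shows "descent i ([x] # R # P) \<longleftrightarrow> i \<in> set R' \<and> Suc i \<in> set (concat ([y] # P)) \<or> descent i ([y] # P)"
    "row_strict ([y] # P)" "insert x (set R) = insert y (set R')" "y \<in> set R" "set R' \<inter> set (concat ([y] # P)) = {}"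
proof -
  obtain A B where R: "R = A @ y # B" "R' = A @ x # B" "x < y" "\<forall>a \<in> set A. \<not> x < a"
    by (rule row_insert_cases[of x R]) (use assms(2) in auto)
  note rb = row_bump_strict[OF assms(1)[unfolded R(1)] R(3,4)]
  have "descent i (bump_in (R # P) x) \<longleftrightarrow> descent i ([x] # R # P)"
    by (rule descent_bump_in[OF assms(1)])
  then show "descent i ([x] # R # P) \<longleftrightarrow> i \<in> set R' \<and> Suc i \<in> set (concat ([y] # P)) \<or> descent i ([y] # P)"
    unfolding bump_in_Some[OF assms(2)] using set_bump_in[of P y] descent_bump_in[OF rb(4)] by auto
  show "row_strict ([y] # P)" by (rule rb(4))
  show "insert x (set R) = insert y (set R')" "y \<in> set R" using R by auto
  show "set R' \<inter> set (concat ([y] # P)) = {}"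
    using rb(5,6) unfolding R(2) row_strict_Cons by auto
qed

lemma set_concat_swap_entries:
  "set (concat (swap_entries v P)) = Transposition.transpose v (Suc v) ` set (concat P)"
  by (induction P) auto

text \<open>The exchange of \<open>a + 1\<close> and \<open>a + 2\<close> changes whether \<open>a\<close> is a descent exactly if \<open>a\<close> lies, in terms
  of rows, between them.  Then the upper one is not bumped into the row of the other, since \<open>a\<close>
  would no longer lie between them, so that they are never compared.  The condition is an invariant of the insertion because
  descents are (\<open>descent_bump_in\<close>, applied to the tableau and to its image).\<close>

lemma bump_in_swap_upper:
  fixes a :: nat
  defines "f \<equiv> Transposition.transpose (Suc a) (Suc (Suc a))"
  assumes "row_strict ([x] # P)" "row_strict (map (map f) ([x] # P))"
    and "Suc a \<in> set (concat ([x] # P)) \<Longrightarrow> Suc (Suc a) \<in> set (concat ([x] # P)) \<Longrightarrow>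
      descent a ([x] # P) \<noteq> descent a (map (map f) ([x] # P))"
  shows "bump_in (map (map f) P) (f x) = map (map f) (bump_in P x)"
  using assms(2-)
proof (induction P arbitrary: x)
  case (Cons R P)
  have fa: "f a = a" by (simp add: f_def)
  have f_iff: "f y = a \<longleftrightarrow> y = a" "f y = Suc a \<longleftrightarrow> y = Suc (Suc a)" "f y = Suc (Suc a) \<longleftrightarrow> y = Suc a" for y
    by (auto simp: f_def Transposition.transpose_def)
  have setf: "z \<in> set (map f L) \<longleftrightarrow> f z \<in> set L" for z L
    unfolding f_def by (auto simp: in_transpose_image_iff)
  have setfc: "z \<in> set (concat (map (map f) L)) \<longleftrightarrow> f z \<in> set (concat L)" for z L
    unfolding f_def set_concat_swap_entries by (simp add: in_transpose_image_iff)
  have no: "\<not> descent a L" if "Suc a \<notin> set (concat L)" for L using descent_entries that by blast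
  have nf: "\<not> descent a (map (map f) L)" if "Suc (Suc a) \<notin> set (concat L)" for L
    using no[of "map (map f) L"] that setfc[of "Suc a" L] by (auto simp: f_def)
  \<comment> \<open>If the exchanged entries met, \<open>a\<close> would be a descent neither before nor after the exchange.\<close>
  have c1: "\<not> (x = Suc a \<and> Suc (Suc a) \<in> set R)"
  proof
    assume h: "x = Suc a \<and> Suc (Suc a) \<in> set R"
    then have "Suc a \<notin> set (concat (R # P))" "Suc (Suc a) \<notin> set (concat P)"
      using Cons.prems(1) by (auto simp: row_strict_Cons)
    then have "\<not> descent a ([x] # R # P)" "\<not> descent a (map (map f) ([x] # R # P))"
      using h no[of "R # P"] nf[of P] setfc[of "Suc a" P] by (auto simp: f_def)
    then show False using Cons.prems(3) h by simp
  qed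
  have c2: "\<not> (x = Suc (Suc a) \<and> Suc a \<in> set R)"
  proof
    assume h: "x = Suc (Suc a) \<and> Suc a \<in> set R"
    then have "Suc (Suc a) \<notin> set (concat (R # P))" "Suc a \<notin> set (concat P)"
      using Cons.prems(1) by (auto simp: row_strict_Cons)
    then have "\<not> descent a ([x] # R # P)" "\<not> descent a (map (map f) ([x] # R # P))"
      using h no[of P] nf[of "R # P"] setfc[of "Suc a" P] by (auto simp: f_def)
    then show False using Cons.prems(3) h by simp
  qed
  show ?case
  proof (cases "row_insert x R")
    case (Pair R' yo)
    show ?thesis
    proof (cases yo)
      case None
      then show ?thesis
        using bump_in_swap_row(1)[OF c1 c2, folded f_def] Pair by (simp add: bump_in_None)
    next
      case (Some y)
      have ins: "row_insert x R = (R', Some y)" using Pair Some by simp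
      have ins': "row_insert (f x) (map f R) = (map f R', Some (f y))"
        using row_insert_transpose[OF c1 c2, folded f_def] ins by simp
      note s = descent_bump_row[OF Cons.prems(1) ins]
      have rs: "row_strict ([f x] # map f R # map (map f) P)" using Cons.prems(2) by simp
      note s' = descent_bump_row[OF rs ins']
      have "bump_in (map (map f) P) (f y) = map (map f) (bump_in P y)"
      proof (rule Cons.IH)
        show "row_strict ([y] # P)" by (rule s(2))
        show "row_strict (map (map f) ([y] # P))" using s'(2) by simp
        assume in': "Suc a \<in> set (concat ([y] # P))" "Suc (Suc a) \<in> set (concat ([y] # P))"
        then have "Suc a \<in> set (concat ([f y] # map (map f) P))"
          using setfc[of "Suc a" "[y] # P"] by (simp add: f_def)
        moreover have "set (concat ([y] # P)) \<subseteq> set (concat ([x] # R # P))"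
          using s(4) by auto
        then have "descent a ([x] # R # P) \<noteq> descent a ([f x] # map f R # map (map f) P)"
          using Cons.prems(3)[OF subsetD subsetD, OF _ in'(1) _ in'(2)] unfolding list.map by blast
        moreover have "a \<in> set (map f R') \<longleftrightarrow> a \<in> set R'" using setf fa by simp
        ultimately show "descent a ([y] # P) \<noteq> descent a (map (map f) ([y] # P))"
          using s(1)[of a] s'(1)[of a] in'(1) unfolding list.map by blast
      qed
      then show ?thesis
        using bump_in_swap_row(2)[OF c1 c2 ins, folded f_def] by (simp add: bump_in_Some[OF ins] f_def)
    qed
  qed
qed simp

text \<open>If \<open>a\<close> meets a row with \<open>a + 1\<close> and \<open>a + 2\<close>, it bumps \<open>a + 1\<close>; if the roles of \<open>a\<close> and \<open>a + 1\<close> are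
  exchanged, \<open>a + 1\<close> bumps \<open>a + 2\<close>.  The results no longer differ by exchanging \<open>a\<close> and \<open>a + 1\<close>, but by
  exchanging \<open>a + 1\<close> and \<open>a + 2\<close>.  This is how the tableaux of two words related by one kind of dual
  Knuth move can be related by the other kind.\<close>

lemma bump_in_swap_row_contact:
  fixes a :: nat
  defines "f \<equiv> Transposition.transpose a (Suc a)" and "g \<equiv> Transposition.transpose (Suc a) (Suc (Suc a))"
  assumes "row_strict ([a] # R # P)" "Suc a \<in> set R" "Suc (Suc a) \<in> set R"
  shows "bump_in (map (map f) (R # P)) (Suc a) = map (map g) (bump_in (R # P) a)"
proof -
  obtain A y B where R: "R = A @ y # B" "a < y" "\<forall>r \<in> set A. \<not> a < r"
    by (rule row_insert_cases[of a R]) (use assms(4) in auto)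
  note rb = row_bump_strict[OF assms(3)[unfolded R(1)] R(2,3)]
  have y: "y = Suc a"
    using assms(4) R rb(2)[of "Suc a"] by auto
  have cB: "Suc (Suc a) \<in> set B" using assms(5) R y by force
  obtain B' where B: "B = Suc (Suc a) # B'"
  proof (cases B)
    case (Cons b B')
    have "Suc a < b" using rb(2) y Cons by simp
    moreover have "b \<le> Suc (Suc a)"
      using cB Cons rb(3) by (auto simp: sorted_wrt_append)
    ultimately show ?thesis using that Cons by simp
  qed (use cB in simp)
  have P: "z \<notin> set (concat P)" if "z \<in> {a, Suc a, Suc (Suc a)}" for z
    using assms(3-5) that by (auto simp: row_strict_Cons)
  have A: "z < a" if "z \<in> set A" for z using rb(1)[OF that] .
  have B': "Suc (Suc a) < z" if "z \<in> set B'" for z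
    using rb(3) B that by (auto simp: sorted_wrt_append)
  have fA: "map f A = A" "map g A = A" "map f B' = B'" "map g B' = B'"
    using A B' by (auto intro!: map_idI simp: f_def g_def Transposition.transpose_def dest: less_imp_neq)
      (use A B' in fastforce)+
  have fP: "map (map f) P = P" "map (map g) P = P"
    using P by (auto intro!: map_idI simp: f_def g_def Transposition.transpose_def)
  have 1: "row_insert a R = (A @ a # Suc (Suc a) # B', Some (Suc a))"
    using row_insert_bump[OF R(3) R(2), of B] R(1) y B by simp
  have fR: "map f R = (A @ [a]) @ Suc (Suc a) # B'" using R(1) y B fA by (simp add: f_def)
  have 2: "row_insert (Suc a) (map f R) = (A @ a # Suc a # B', Some (Suc (Suc a)))"
    using row_insert_bump[of "A @ [a]" "Suc a" "Suc (Suc a)" B'] A unfolding fR by fastforce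
  have "bump_in (map (map g) P) (g (Suc a)) = map (map g) (bump_in P (Suc a))"
    unfolding g_def
  proof (rule bump_in_swap_upper)
    show rs: "row_strict ([Suc a] # P)" using rb(4) y by simp
    show "row_strict (map (map (Transposition.transpose (Suc a) (Suc (Suc a)))) ([Suc a] # P))"
      using rs P fP(2) unfolding g_def by (simp add: row_strict_Cons)
  qed (use P in auto)
  then show ?thesis
    using bump_in_Some[OF 1, of P] bump_in_Some[OF 2, of P] fP fA by (simp add: g_def)
qed

text \<open>As in \<open>bump_in_swap_upper\<close>, with \<open>a + 2\<close> between the exchanged entries.  Since \<open>a + 2\<close> may share a
  row with the lower one of them, the two can now be compared, and then
  \<open>bump_in_swap_row_contact\<close> applies.\<close>

lemma bump_in_swap_lower:
  fixes a :: nat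
  defines "f \<equiv> Transposition.transpose a (Suc a)" and "g \<equiv> Transposition.transpose (Suc a) (Suc (Suc a))"
  assumes "row_strict ([x] # P)" "row_strict (map (map f) ([x] # P))"
    and "a \<in> set (concat ([x] # P)) \<Longrightarrow> Suc a \<in> set (concat ([x] # P)) \<Longrightarrow>
      descent (Suc a) ([x] # P) \<noteq> descent (Suc a) (map (map f) ([x] # P))"
  shows "bump_in (map (map f) P) (f x) = map (map f) (bump_in P x) \<or>
    {a, Suc a, Suc (Suc a)} \<subseteq> set (concat ([x] # P)) \<and>
    bump_in (map (map f) P) (f x) = map (map g) (bump_in P x)"
  using assms(3-)
proof (induction P arbitrary: x)
  case (Cons R P)
  have fc: "f (Suc (Suc a)) = Suc (Suc a)" "f a = Suc a" "f (Suc a) = a" by (simp_all add: f_def)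
  have ff: "f (f z) = z" "g (g z) = z" for z by (simp_all add: f_def g_def)
  have setf: "z \<in> set (map f L) \<longleftrightarrow> f z \<in> set L" for z L
    unfolding f_def by (auto simp: in_transpose_image_iff)
  have setfc: "z \<in> set (concat (map (map f) L)) \<longleftrightarrow> f z \<in> set (concat L)" for z L
    unfolding f_def set_concat_swap_entries by (simp add: in_transpose_image_iff)
  have no: "\<not> descent (Suc a) L" if "Suc a \<notin> set (concat L)" for L using descent_entries that by blast
  have nf: "\<not> descent (Suc a) (map (map f) L)" if "a \<notin> set (concat L)" for L
    using no[of "map (map f) L"] that setfc[of "Suc a" L] fc by auto
  show ?case
  proof (cases "x = a \<and> Suc a \<in> set R \<or> x = Suc a \<and> a \<in> set R")
    case True
    \<comment> \<open>The exchange changes the descent \<open>a + 1\<close>, so the row in which the two meet contains \<open>a + 2\<close>.\<close>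
    have cR: "Suc (Suc a) \<in> set R"
    proof -
      have neq: "descent (Suc a) ([x] # R # P) \<noteq> descent (Suc a) (map (map f) ([x] # R # P))"
        by (rule Cons.prems(3)) (use True in auto)
      have nP: "a \<notin> set (concat P)" "Suc a \<notin> set (concat P)"
        using Cons.prems(1) True by (auto simp: row_strict_Cons)
      have ds: "\<not> descent (Suc a) P" "\<not> descent (Suc a) (map (map f) P)" using no nf nP by blast+
      have m: "Suc a \<in> set (map f R) \<longleftrightarrow> a \<in> set R"
        "Suc (Suc a) \<in> set (map f R) \<longleftrightarrow> Suc (Suc a) \<in> set R"
        "Suc (Suc a) \<in> set (concat (map (map f) P)) \<longleftrightarrow> Suc (Suc a) \<in> set (concat P)"
        unfolding setf setfc fc by (rule refl)+
      have fx: "f x = Suc a \<longleftrightarrow> x = a"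
        unfolding f_def by (auto simp: Transposition.transpose_def)
      have "descent (Suc a) ([x] # R # P) \<longleftrightarrow> x = Suc a \<and> (Suc (Suc a) \<in> set R \<or> Suc (Suc a) \<in> set (concat P))
          \<or> Suc a \<in> set R \<and> Suc (Suc a) \<in> set (concat P)"
        using ds(1) by auto
      moreover have "descent (Suc a) (map (map f) ([x] # R # P)) \<longleftrightarrow>
          x = a \<and> (Suc (Suc a) \<in> set R \<or> Suc (Suc a) \<in> set (concat P))
          \<or> a \<in> set R \<and> Suc (Suc a) \<in> set (concat P)"
        unfolding list.map descent.simps concat.simps set_append Un_iff m
        using ds(2) m(1) fx by auto
      ultimately show ?thesis using neq True nP by blast
    qed
    have three: "{a, Suc a, Suc (Suc a)} \<subseteq> set (concat ([x] # R # P))" using True cR by auto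
    have "bump_in (map (map f) (R # P)) (f x) = map (map g) (bump_in (R # P) x)"
      using True
    proof
      assume h: "x = a \<and> Suc a \<in> set R"
      then show ?thesis
        using bump_in_swap_row_contact[of a R P] Cons.prems(1) cR fc unfolding f_def g_def by simp
    next
      assume h: "x = Suc a \<and> a \<in> set R"
      have "bump_in (map (map f) (map f R # map (map f) P)) (Suc a)
          = map (map g) (bump_in (map f R # map (map f) P) a)"
        unfolding f_def g_def
      proof (rule bump_in_swap_row_contact)
        show "row_strict ([a] # map (Transposition.transpose a (Suc a)) R # swap_entries a P)"
          using Cons.prems(2) h unfolding f_def by simp
      qed (use h cR fc setf in \<open>auto simp: f_def[symmetric]\<close>)
      then have "map (map g) (bump_in (R # P) (Suc a)) = bump_in (map f R # map (map f) P) a"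
        by (simp add: comp_def ff)
      then show ?thesis using h fc by simp
    qed
    then show ?thesis using three by blast
  next
    case False
    then have c1: "\<not> (x = a \<and> Suc a \<in> set R)" and c2: "\<not> (x = Suc a \<and> a \<in> set R)" by auto
    show ?thesis
    proof (cases "row_insert x R")
      case (Pair R' yo)
      show ?thesis
      proof (cases yo)
        case None
        then show ?thesis
          using bump_in_swap_row(1)[OF c1 c2, folded f_def] Pair by (simp add: bump_in_None)
      next
        case (Some y)
        have ins: "row_insert x R = (R', Some y)" using Pair Some by simp
        have ins': "row_insert (f x) (map f R) = (map f R', Some (f y))"
          using row_insert_transpose[OF c1 c2, folded f_def] ins by simp
        note s = descent_bump_row[OF Cons.prems(1) ins]
        have rs: "row_strict ([f x] # map f R # map (map f) P)" using Cons.prems(2) by simp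
        note s' = descent_bump_row[OF rs ins']
        have step: "bump_in (map (map f) (R # P)) (f x) = map f R' # bump_in (map (map f) P) (f y)"
          using bump_in_swap_row(2)[OF c1 c2 ins, folded f_def] by simp
        have "bump_in (map (map f) P) (f y) = map (map f) (bump_in P y) \<or>
          {a, Suc a, Suc (Suc a)} \<subseteq> set (concat ([y] # P)) \<and>
          bump_in (map (map f) P) (f y) = map (map g) (bump_in P y)"
        proof (rule Cons.IH)
          show "row_strict ([y] # P)" by (rule s(2))
          show "row_strict (map (map f) ([y] # P))" using s'(2) by simp
          assume in': "a \<in> set (concat ([y] # P))" "Suc a \<in> set (concat ([y] # P))"
          have "set (concat ([y] # P)) \<subseteq> set (concat ([x] # R # P))"
            using s(4) by auto
          then have "descent (Suc a) ([x] # R # P) \<noteq> descent (Suc a) ([f x] # map f R # map (map f) P)"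
            using Cons.prems(3)[OF subsetD subsetD, OF _ in'(1) _ in'(2)] unfolding list.map by blast
          moreover have "Suc a \<notin> set R'" "a \<notin> set R'" using s(5) in' by blast+
          moreover have "Suc a \<in> set (map f R') \<longleftrightarrow> a \<in> set R'" using setf fc by simp
          ultimately show "descent (Suc a) ([y] # P) \<noteq> descent (Suc a) (map (map f) ([y] # P))"
            using s(1)[of "Suc a"] s'(1)[of "Suc a"] unfolding list.map by blast
        qed
        then show ?thesis
        proof
          assume "bump_in (map (map f) P) (f y) = map (map f) (bump_in P y)"
          then show ?thesis unfolding step by (simp add: bump_in_Some[OF ins])
        next
          assume h: "{a, Suc a, Suc (Suc a)} \<subseteq> set (concat ([y] # P)) \<and>
            bump_in (map (map f) P) (f y) = map (map g) (bump_in P y)"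
          then have "z \<notin> {a, Suc a, Suc (Suc a)}" if "z \<in> set R'" for z using s(5) that by blast
          \<comment> \<open>The kind of exchange changes only below this row, which then contains none of the three.\<close>
          then have "map f R' = map g R'"
            by (auto simp: f_def g_def Transposition.transpose_def)
          moreover have "{a, Suc a, Suc (Suc a)} \<subseteq> set (concat ([x] # R # P))"
            using h s(4) by auto
          ultimately show ?thesis unfolding step using h by (simp add: bump_in_Some[OF ins])
        qed
      qed
    qed
  qed
qed simp

text \<open>The letter that is not exchanged stands between the two exchanged ones.  Stating this through
  the order of the three letters in both words gives the descents of the insertion tableaux at once.
  The relation is oriented: \<open>a\<close> is a descent on the left and \<open>a + 1\<close> on the right.\<close>

definition dual_knuth :: "nat \<Rightarrow> nat list \<Rightarrow> nat list \<Rightarrow> bool" where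
  "dual_knuth a xs xs' \<longleftrightarrow> (\<exists>v \<in> {a, Suc a}. xs' = map (Transposition.transpose v (Suc v)) xs)
     \<and> before xs (Suc a) a \<and> before xs (Suc a) (Suc (Suc a))
     \<and> before xs' a (Suc a) \<and> before xs' (Suc (Suc a)) (Suc a)"

lemma before_prefix_closed:
  assumes "distinct (ys @ q)" "before (ys @ q) u w" "w \<in> set ys"
  shows "u \<in> set ys"
proof (rule ccontr)
  assume u: "u \<notin> set ys"
  then have "u \<in> set q" using before_in[OF assms(2)] by simp
  then obtain q1 q2 where "q = q1 @ u # q2" by (meson split_list)
  then have "before (ys @ q) w u" using assms(3) unfolding before_def
    by (intro exI[of _ "ys @ q1"] exI[of _ q2]) simp
  then show False using before_asym assms by blast
qed

text \<open>Both words are inserted in parallel, and the two tableaux always differ by an exchange of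
  consecutive entries.  The exchange is that of the words until all three letters have arrived; it
  may change once, in the situation of \<open>bump_in_swap_row_contact\<close>.  The order of the three letters
  in both words determines whether \<open>a\<close> and \<open>a + 1\<close> are descents of the two tableaux
  (\<open>descent_insertion_tableau\<close>), and this is the condition under which one insertion is controlled.\<close>

theorem insertion_tableau_dual_knuth:
  assumes "distinct xs" "dual_knuth a xs xs'"
  shows "\<exists>v \<in> {a, Suc a}. insertion_tableau xs' = swap_entries v (insertion_tableau xs)"
proof -
  let ?tr = "\<lambda>v. Transposition.transpose v (Suc v)"
  let ?b = "Suc a" and ?c = "Suc (Suc a)"
  obtain v0 where v0: "v0 \<in> {a, ?b}" "xs' = map (?tr v0) xs" using assms(2) by (auto simp: dual_knuth_def)
  note ord = assms(2)[unfolded dual_knuth_def, THEN conjunct2]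
  have dist': "distinct xs'" using v0(2) assms(1) by (simp add: distinct_map)
  \<comment> \<open>In \<open>xs\<close>, the letter that stays precedes the later one of the two exchanged letters.\<close>
  have late: "{a, ?b, ?c} \<subseteq> set ys" if ys: "xs = ys @ q" and "v0 \<in> set ys" "Suc v0 \<in> set ys" for ys q
  proof -
    have *: "before xs' (?tr v0 u) (?tr v0 w) \<longleftrightarrow> before xs u w" for u w
      unfolding v0(2) by (rule before_map) (rule inj_on_transpose)
    consider "v0 = a" | "v0 = ?b" using v0(1) by blast
    then show ?thesis
    proof cases
      case 1
      then have "before xs ?c a" using ord *[of ?c a] by simp
      then have "?c \<in> set ys" using before_prefix_closed[of ys q] assms(1) ys that(2) 1 by blast
      then show ?thesis using that 1 by simp
    next
      case 2
      then have "before xs a ?c" using ord *[of a ?c] by simp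
      then have "a \<in> set ys" using before_prefix_closed[of ys q] assms(1) ys that(3) 2 by blast
      then show ?thesis using that 2 by simp
    qed
  qed
  have "\<exists>v \<in> {a, ?b}. insertion_tableau (map (?tr v0) ys) = swap_entries v (insertion_tableau ys)
      \<and> (\<not> {a, ?b, ?c} \<subseteq> set ys \<longrightarrow> v = v0)" if "xs = ys @ q" for ys q
    using that
  proof (induction ys arbitrary: q rule: rev_induct)
    case Nil
    then show ?case using v0(1) by (auto simp: insertion_tableau_def)
  next
    case (snoc x zs)
    obtain v where v: "v \<in> {a, ?b}" "insertion_tableau (map (?tr v0) zs) = swap_entries v (insertion_tableau zs)"
      "\<not> {a, ?b, ?c} \<subseteq> set zs \<Longrightarrow> v = v0"
      using snoc.IH[of "x # q"] snoc.prems by auto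
    let ?ys = "zs @ [x]"
    let ?P = "insertion_tableau zs"
    have dys: "distinct ?ys" using assms(1) snoc.prems by simp
    have dys': "distinct (map (?tr v0) ?ys)" by (simp only: distinct_map inj_on_transpose dys simp_thms)
    have trx: "?tr v0 x = ?tr v x"
    proof (cases "v = v0")
      case False
      then have "{a, ?b, ?c} \<subseteq> set zs" using v(3) by blast
      then have "x \<notin> {a, ?b, ?c}" using dys by auto
      then show ?thesis using v(1) v0(1) by (auto simp: Transposition.transpose_def)
    qed simp
    have img: "map (map (?tr v)) ([x] # ?P) = [?tr v0 x] # insertion_tableau (map (?tr v0) zs)"
      using v(2) trx by simp
    have rs: "row_strict ([x] # ?P)"
      using row_strict_insertion_tableau[of zs] set_insertion_tableau[of zs] dys by (auto simp: row_strict_Cons)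
    have rs': "row_strict (map (map (?tr v)) ([x] # ?P))"
      unfolding img using row_strict_insertion_tableau[of "map (?tr v0) zs"]
        set_insertion_tableau[of "map (?tr v0) zs"] dys' by (auto simp: row_strict_Cons)
    have set: "set (concat ([x] # ?P)) = set ?ys" using set_insertion_tableau[of zs] by auto
    have D: "descent i ([x] # ?P) \<longleftrightarrow> before ?ys (Suc i) i" for i
      using descent_bump_in[OF rs] descent_insertion_tableau[OF dys] by (simp add: insertion_tableau_snoc)
    have D': "descent i (map (map (?tr v)) ([x] # ?P)) \<longleftrightarrow> before (map (?tr v0) ?ys) (Suc i) i" for i
      using descent_bump_in[OF rs'[unfolded img]] descent_insertion_tableau[OF dys']
      unfolding img by (simp add: insertion_tableau_snoc)
    have all3: "{a, ?b, ?c} \<subseteq> set ?ys" if "v \<in> set ?ys" "Suc v \<in> set ?ys"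
    proof (cases "{a, ?b, ?c} \<subseteq> set zs")
      case False
      then show ?thesis using late[OF snoc.prems] v(3)[OF False] that by blast
    next
      case True
      then show ?thesis by (simp only: set_append) blast
    qed
    have flip: "descent i ([x] # ?P) \<noteq> descent i (map (map (?tr v)) ([x] # ?P))"
      if three: "{a, ?b, ?c} \<subseteq> set ?ys" and i: "i \<in> {a, ?b}" for i
    proof -
      have "?tr v0 z \<in> {a, ?b, ?c}" if "z \<in> {a, ?b, ?c}" for z
        using v0(1) that by (auto simp: Transposition.transpose_def)
      then have three': "{a, ?b, ?c} \<subseteq> set (map (?tr v0) ?ys)"
        using three unfolding set_map subset_iff in_transpose_image_iff by blast
      have p: "before ?ys u w \<longleftrightarrow> before xs u w" if "u \<in> set ?ys" "w \<in> set ?ys" "u \<noteq> w" for u w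
        unfolding snoc.prems by (rule before_prefix[OF assms(1)[unfolded snoc.prems] that])
      have xs': "xs' = map (?tr v0) ?ys @ map (?tr v0) q" unfolding v0(2) snoc.prems by simp
      have p': "before (map (?tr v0) ?ys) u w \<longleftrightarrow> before xs' u w"
        if "u \<in> set (map (?tr v0) ?ys)" "w \<in> set (map (?tr v0) ?ys)" "u \<noteq> w" for u w
        unfolding xs' by (rule before_prefix[OF dist'[unfolded xs'] that])
      show ?thesis
        unfolding D D'
      proof -
        have "before ?ys ?b a \<longleftrightarrow> before xs ?b a" "before ?ys ?c ?b \<longleftrightarrow> before xs ?c ?b"
          by (rule p; use three in simp)+
        moreover have "before (map (?tr v0) ?ys) ?b a \<longleftrightarrow> before xs' ?b a"
          "before (map (?tr v0) ?ys) ?c ?b \<longleftrightarrow> before xs' ?c ?b"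
          by (rule p'; use three' in simp)+
        moreover have "\<not> before xs ?c ?b" "\<not> before xs' ?b a"
          using before_asym[OF assms(1)] before_asym[OF dist'] ord by blast+
        ultimately show "before ?ys (Suc i) i \<noteq> before (map (?tr v0) ?ys) (Suc i) i"
          using i ord by blast
      qed
    qed
    have eq: "insertion_tableau (map (?tr v0) ?ys) = bump_in (swap_entries v ?P) (?tr v x)"
      using v(2) trx by (simp add: insertion_tableau_snoc)
    have eq': "insertion_tableau ?ys = bump_in ?P x" by (simp add: insertion_tableau_snoc)
    have last: "\<not> {a, ?b, ?c} \<subseteq> set ?ys \<Longrightarrow> v = v0" using v(3) by auto
    consider "v = a" | "v = ?b" using v(1) by blast
    then show ?case
    proof cases
      case 1
      have "bump_in (swap_entries a ?P) (?tr a x) = swap_entries a (bump_in ?P x) \<or>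
        {a, ?b, ?c} \<subseteq> set (concat ([x] # ?P)) \<and>
        bump_in (swap_entries a ?P) (?tr a x) = swap_entries ?b (bump_in ?P x)"
        by (rule bump_in_swap_lower[OF rs rs'[unfolded 1]])
          (use all3 flip[of ?b] 1 set in auto)
      then show ?thesis unfolding eq eq' using 1 last set by blast
    next
      case 2
      have "bump_in (swap_entries ?b ?P) (?tr ?b x) = swap_entries ?b (bump_in ?P x)"
        by (rule bump_in_swap_upper[OF rs rs'[unfolded 2]])
          (use all3 flip[of a] 2 set in auto)
      then show ?thesis unfolding eq eq' using 2 last by blast
    qed
  qed
  from this[of xs "[]"] show ?thesis using v0(2) by auto
qed

section \<open>From tableaux to tabloids\<close>

lemma descent_iff_nth:
  "descent i P \<longleftrightarrow> (\<exists>r s. r < s \<and> s < length P \<and> i \<in> set (P ! r) \<and> Suc i \<in> set (P ! s))"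
proof (induction P)
  case (Cons R P)
  have "(\<exists>r s. r < s \<and> s < length (R # P) \<and> i \<in> set ((R # P) ! r) \<and> Suc i \<in> set ((R # P) ! s))
    \<longleftrightarrow> (\<exists>r s. r < Suc s \<and> s < length P \<and> i \<in> set ((R # P) ! r) \<and> Suc i \<in> set (P ! s))"
    (is "?L \<longleftrightarrow> ?M")
  proof
    assume ?L
    then obtain r s where h: "r < s" "s < length (R # P)" "i \<in> set ((R # P) ! r)" "Suc i \<in> set ((R # P) ! s)"
      by blast
    then show ?M by (cases s) auto
  next
    assume ?M
    then show ?L by (metis Suc_less_eq length_Cons nth_Cons_Suc)
  qed
  also have "\<dots> \<longleftrightarrow> (\<exists>s. s < length P \<and> i \<in> set R \<and> Suc i \<in> set (P ! s)) \<or>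
      (\<exists>r s. r < s \<and> s < length P \<and> i \<in> set (P ! r) \<and> Suc i \<in> set (P ! s))" (is "?M \<longleftrightarrow> ?N")
  proof
    assume ?M
    then obtain r s where h: "r < Suc s" "s < length P" "i \<in> set ((R # P) ! r)" "Suc i \<in> set (P ! s)"
      by blast
    then show ?N by (cases r) auto
  next
    assume ?N
    then show ?M by (metis Suc_less_eq nth_Cons_0 nth_Cons_Suc zero_less_Suc)
  qed
  also have "(\<exists>s. s < length P \<and> i \<in> set R \<and> Suc i \<in> set (P ! s)) \<longleftrightarrow> i \<in> set R \<and> Suc i \<in> set (concat P)"
    by (auto simp: in_set_conv_nth) (metis in_set_conv_nth nth_mem)+
  finally show ?case using Cons.IH by simp
qed simp

lemma mod_inj_entries:
  assumes "a \<in> {1..n}" "b \<in> {1..n}" "int a mod int n = int b mod int n"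
  shows "a = b"
proof -
  have "a mod n = b mod n" using assms(3) by (simp flip: of_nat_mod)
  moreover have "c mod n = (if c = n then 0 else c)" if "c \<in> {1..n}" for c
    using that by auto
  ultimately show ?thesis using assms(1,2) by (auto split: if_splits)
qed

lemma in_associated_tabloid:
  assumes "set (concat T) = {1..n}" "r < length T" "a \<in> {1..n}"
  shows "int a mod int n \<in> associated_tabloid n T ! r \<longleftrightarrow> a \<in> set (T ! r)"
proof -
  have "set (T ! r) \<subseteq> {1..n}" unfolding assms(1)[symmetric] using nth_mem[OF assms(2)] by auto
  then have "inj_on (\<lambda>a. int a mod int n) (insert a (set (T ! r)))"
    using assms(3) by (intro inj_onI) (rule mod_inj_entries, auto)
  from inj_on_image_mem_iff[OF this insertI1 subset_insertI] show ?thesis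
    using assms(2) by (simp add: associated_tabloid_def)
qed

text \<open>The residue \<open>0\<close>, which stands for the entry \<open>n\<close>, is left out: there the tabloid compares \<open>n\<close> with \<open>1\<close>.\<close>

lemma Des_associated_tabloid:
  assumes "set (concat T) = {1..n}" "i \<in> {1..<n}"
  shows "int i \<in> Des n (associated_tabloid n T) \<longleftrightarrow> descent i T"
proof -
  have i: "int i = int i mod int n" "(int i + 1) mod int n = int (Suc i) mod int n"
    using assms(2) by (simp_all add: add.commute)
  have "int i \<in> residue_classes n" using assms(2) by (simp add: residue_classes_def)
  moreover have "int i \<in> associated_tabloid n T ! r \<longleftrightarrow> i \<in> set (T ! r)"
    "(int i + 1) mod int n \<in> associated_tabloid n T ! r \<longleftrightarrow> Suc i \<in> set (T ! r)" if "r < length T" for r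
    using in_associated_tabloid[OF assms(1) that, of i] in_associated_tabloid[OF assms(1) that, of "Suc i"]
      assms(2) unfolding i(1)[symmetric] i(2) by auto
  moreover have "length (associated_tabloid n T) = length T" by (simp add: associated_tabloid_def)
  ultimately show ?thesis
    unfolding Des_def descent_iff_nth by (auto intro: less_trans)
qed

lemma associated_tabloid_swap:
  assumes "set (concat T) = {1..n}" "v \<in> {1..<n}"
  shows "associated_tabloid n (swap_entries v T)
    = exchange (int v) ((int v + 1) mod int n) (associated_tabloid n T)"
proof -
  have "int (Transposition.transpose v (Suc v) a) mod int n
      = Transposition.transpose (int v) ((int v + 1) mod int n) (int a mod int n)" if a: "a \<in> {1..n}" for a
  proof -
    have v: "int v mod int n = int v" "int (Suc v) mod int n = (int v + 1) mod int n"
      using assms(2) by (simp_all add: add.commute)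
    have "int a mod int n = int v \<longleftrightarrow> a = v"
      using mod_inj_entries[OF a, of v] assms(2) v(1) by fastforce
    moreover have "int a mod int n = (int v + 1) mod int n \<longleftrightarrow> a = Suc v"
      using mod_inj_entries[OF a, of "Suc v"] assms(2) v(2) by fastforce
    ultimately show ?thesis using v by (auto simp: Transposition.transpose_def)
  qed
  moreover have "a \<in> {1..n}" if "R \<in> set T" "a \<in> set R" for R a
    unfolding assms(1)[symmetric] using that by auto
  ultimately have "(\<lambda>a. int a mod int n) ` Transposition.transpose v (Suc v) ` set R
      = Transposition.transpose (int v) ((int v + 1) mod int n) ` (\<lambda>a. int a mod int n) ` set R"
    if "R \<in> set T" for R
    unfolding image_image using that by (intro image_cong refl) blast
  then show ?thesis by (simp add: associated_tabloid_def exchange_def)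
qed

text \<open>The tableaux differ by an exchange of consecutive entries, and their descents at \<open>a\<close> and \<open>a + 1\<close> are
  known from the order of the letters in the words.\<close>

lemma dual_knuth_type:
  assumes "distinct xs" "set xs = {1..n}" "dual_knuth a xs xs'" "1 \<le> a" "a + 2 \<le> n"
  shows "knuth_move_of_type n (int a) (associated_tabloid n (insertion_tableau xs))
    (associated_tabloid n (insertion_tableau xs'))"
proof -
  let ?T = "insertion_tableau xs" and ?T' = "insertion_tableau xs'"
  obtain v where v: "v \<in> {a, Suc a}" "?T' = swap_entries v ?T"
    using insertion_tableau_dual_knuth[OF assms(1,3)] by blast
  obtain v0 where v0: "v0 \<in> {a, Suc a}" "xs' = map (Transposition.transpose v0 (Suc v0)) xs"
    using assms(3) by (auto simp: dual_knuth_def)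
  have xs': "distinct xs'" "set xs' = {1..n}"
  proof -
    show "distinct xs'" unfolding v0(2) using assms(1) by (simp only: distinct_map inj_on_transpose simp_thms)
    show "set xs' = {1..n}" unfolding v0(2) set_map assms(2) by (rule transpose_image_eq) (use v0 assms in auto)
  qed
  have sT: "set (concat ?T) = {1..n}" "set (concat ?T') = {1..n}"
    using set_insertion_tableau assms(2) xs' by simp_all
  have exch: "associated_tabloid n ?T' = exchange (int v) ((int v + 1) mod int n) (associated_tabloid n ?T)"
    unfolding v(2) by (rule associated_tabloid_swap[OF sT(1)]) (use v assms in auto)
  have vr: "int v \<in> residue_classes n" using v assms by (auto simp: residue_classes_def)
  note ord = assms(3)[unfolded dual_knuth_def, THEN conjunct2]
  have D: "int i \<in> Des n (associated_tabloid n ?T) \<longleftrightarrow> before xs (Suc i) i"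
    "int i \<in> Des n (associated_tabloid n ?T') \<longleftrightarrow> before xs' (Suc i) i" if "i \<in> {a, Suc a}" for i
    using Des_associated_tabloid[OF sT(1), of i] Des_associated_tabloid[OF sT(2), of i]
      descent_insertion_tableau[OF assms(1)] descent_insertion_tableau[OF xs'(1)] that assms by auto
  have a1: "(int a + 1) mod int n = int (Suc a)" using assms by simp
  have "int a \<in> Des n (associated_tabloid n ?T)" "int (Suc a) \<notin> Des n (associated_tabloid n ?T)"
    "int a \<notin> Des n (associated_tabloid n ?T')" "int (Suc a) \<in> Des n (associated_tabloid n ?T')"
    using D[of a] D[of "Suc a"] ord before_asym[OF assms(1), of "Suc a" "Suc (Suc a)"] before_asym[OF xs'(1), of a "Suc a"] by auto
  then show ?thesis
    unfolding knuth_move_of_type_def knuth_move_def a1 using exch vr by blast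
qed

text \<open>If the letter \<open>a + 1\<close> comes first or last of the three, the other two decide which exchange is
  possible: the letter in the middle must be the one that stays.\<close>

lemma dual_knuth_exists:
  assumes "distinct xs" "{a, Suc a, Suc (Suc a)} \<subseteq> set xs"
    and "before xs (Suc a) a \<longleftrightarrow> \<not> before xs (Suc (Suc a)) (Suc a)"
  shows "\<exists>xs'. dual_knuth a xs xs' \<or> dual_knuth a xs' xs"
proof -
  let ?b = "Suc a" and ?c = "Suc (Suc a)"
  let ?f = "Transposition.transpose a ?b" and ?g = "Transposition.transpose ?b ?c"
  have f: "before (map ?f xs) (?f u) (?f w) \<longleftrightarrow> before xs u w" for u w
    by (rule before_map) (rule inj_on_transpose)
  have g: "before (map ?g xs) (?g u) (?g w) \<longleftrightarrow> before xs u w" for u w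
    by (rule before_map) (rule inj_on_transpose)
  have f3: "?f a = ?b" "?f ?b = a" "?f ?c = ?c" and g3: "?g a = a" "?g ?b = ?c" "?g ?c = ?b" by simp_all
  have ff: "map ?f (map ?f xs) = xs" "map ?g (map ?g xs) = xs" by (simp_all add: map_idI)
  have F: "before (map ?f xs) a ?b \<longleftrightarrow> before xs ?b a" "before (map ?f xs) ?b a \<longleftrightarrow> before xs a ?b"
    "before (map ?f xs) ?c ?b \<longleftrightarrow> before xs ?c a" "before (map ?f xs) ?b ?c \<longleftrightarrow> before xs a ?c"
    using f[of ?b a] f[of a ?b] f[of ?c a] f[of a ?c] unfolding f3 by blast+
  have G: "before (map ?g xs) a ?b \<longleftrightarrow> before xs a ?c" "before (map ?g xs) ?b a \<longleftrightarrow> before xs ?c a"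
    "before (map ?g xs) ?c ?b \<longleftrightarrow> before xs ?b ?c" "before (map ?g xs) ?b ?c \<longleftrightarrow> before xs ?c ?b"
    using g[of a ?c] g[of ?c a] g[of ?b ?c] g[of ?c ?b] unfolding g3 by blast+
  have tot: "before xs a ?c \<or> before xs ?c a" "before xs ?b a \<or> before xs a ?b" "before xs ?b ?c \<or> before xs ?c ?b"
    by (rule before_total; use assms(2) in simp)+
  consider "before xs ?b a" "before xs ?b ?c" "before xs a ?c"
    | "before xs ?b a" "before xs ?b ?c" "before xs ?c a"
    | "before xs a ?b" "before xs ?c ?b" "before xs a ?c"
    | "before xs a ?b" "before xs ?c ?b" "before xs ?c a"
    using tot assms(3) by blast
  then show ?thesis
  proof cases
    case 1
    then have "dual_knuth a xs (map ?g xs)" unfolding dual_knuth_def G by blast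
    then show ?thesis by blast
  next
    case 2
    then have "dual_knuth a xs (map ?f xs)" unfolding dual_knuth_def F by blast
    then show ?thesis by blast
  next
    case 3
    then have "dual_knuth a (map ?f xs) xs" unfolding dual_knuth_def F
      using ff(1)[symmetric] by blast
    then show ?thesis by blast
  next
    case 4
    then have "dual_knuth a (map ?g xs) xs" unfolding dual_knuth_def G
      using ff(2)[symmetric] by blast
    then show ?thesis by blast
  qed
qed

section \<open>Evacuation by reversing and complementing words\<close>

text \<open>The word of \<open>w\<^sub>0 w w\<^sub>0\<close> if \<open>xs\<close> is the word of \<open>w\<close>.\<close>

definition reverse_complement :: "nat \<Rightarrow> nat list \<Rightarrow> nat list" where
  "reverse_complement n xs = map (\<lambda>v. Suc n - v) (rev xs)"

lemma before_reverse_complement: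
  assumes "set xs = {1..n}" "u \<in> {1..n}" "v \<in> {1..n}"
  shows "before (reverse_complement n xs) (Suc n - u) (Suc n - v) \<longleftrightarrow> before xs v u"
  unfolding reverse_complement_def
  by (subst before_map) (use assms in \<open>auto simp: inj_on_def before_rev\<close>)

lemma reverse_complement_permutation:
  assumes "distinct xs" "set xs = {1..n}"
  shows "distinct (reverse_complement n xs)" "set (reverse_complement n xs) = {1..n}"
proof -
  show "distinct (reverse_complement n xs)"
    using assms by (auto simp: reverse_complement_def distinct_map inj_on_def)
  have "(\<lambda>v. Suc n - v) ` {1..n} = {1..n}"
  proof
    show "{1..n} \<subseteq> (\<lambda>v. Suc n - v) ` {1..n}"
    proof
      fix v assume "v \<in> {1..n}"
      then show "v \<in> (\<lambda>v. Suc n - v) ` {1..n}" by (intro image_eqI[of _ _ "Suc n - v"]) auto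
    qed
  qed auto
  then show "set (reverse_complement n xs) = {1..n}" using assms(2) by (simp add: reverse_complement_def)
qed

lemma evacuation_insertion_tableau:
  assumes ev: "is_evacuation n ev" and xs: "distinct xs" "set xs = {1..n}"
  shows "ev (insertion_tableau xs) = insertion_tableau (reverse_complement n xs)"
proof -
  have len: "length xs = n" using distinct_card[OF xs(1)] xs(2) by simp
  define w where "w i = (if i \<in> {1..n} then xs ! (i - 1) else i)" for i
  have "bij_betw w {1..n} {1..n}"
  proof -
    have "bij_betw (\<lambda>i. i - 1) {1..n} {..<n}"
      by (rule bij_betw_byWitness[where f' = Suc]) auto
    moreover have "bij_betw (nth xs) {..<n} {1..n}"
      using bij_betw_nth[OF xs(1), of "{..<n}" "{1..n}"] len xs(2) by simp
    ultimately have "bij_betw (nth xs \<circ> (\<lambda>i. i - 1)) {1..n} {1..n}" by (rule bij_betw_trans)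
    then show ?thesis by (rule bij_betw_cong[THEN iffD1, rotated]) (simp add: w_def)
  qed
  then have w: "w permutes {1..n}" by (rule bij_imp_permutes) (auto simp: w_def)
  have wxs: "map w [1..<Suc n] = xs"
    by (rule nth_equalityI) (auto simp: len w_def simp del: upt_Suc)
  have "map (longest_perm n \<circ> w \<circ> longest_perm n) [1..<Suc n] = reverse_complement n xs"
  proof (rule nth_equalityI)
    show "length (map (longest_perm n \<circ> w \<circ> longest_perm n) [1..<Suc n]) = length (reverse_complement n xs)"
      by (simp add: reverse_complement_def len)
    fix i assume "i < length (map (longest_perm n \<circ> w \<circ> longest_perm n) [1..<Suc n])"
    then have i: "i < n" by (simp del: upt_Suc)
    have "xs ! (n - Suc i) \<in> {1..n}" using i len xs(2) nth_mem[of "n - Suc i" xs] by auto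
    then show "map (longest_perm n \<circ> w \<circ> longest_perm n) [1..<Suc n] ! i = reverse_complement n xs ! i"
      using i by (simp add: reverse_complement_def len rev_nth longest_perm_def w_def del: upt_Suc)
  qed
  moreover obtain P Q where PQ: "RS n w = (P, Q)" by (cases "RS n w")
  moreover have "RS n (longest_perm n \<circ> w \<circ> longest_perm n) = (ev P, ev Q)"
    using ev w PQ by (simp add: is_evacuation_def)
  ultimately show ?thesis
    using fst_RS[of n w] fst_RS[of n "longest_perm n \<circ> w \<circ> longest_perm n"] wxs by simp
qed

lemma dual_knuth_reverse_complement:
  assumes "dual_knuth a xs xs'" "set xs = {1..n}" "set xs' = {1..n}" "1 \<le> a" "a + 2 \<le> n"
  shows "dual_knuth (n - 1 - a) (reverse_complement n xs') (reverse_complement n xs)"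
proof -
  define k where "k = n - 1 - a"
  have k: "Suc n - a = Suc (Suc k)" "Suc n - Suc a = Suc k" "Suc n - Suc (Suc a) = k"
    using assms(4,5) by (auto simp: k_def)
  obtain v where v: "v \<in> {a, Suc a}" "xs' = map (Transposition.transpose v (Suc v)) xs"
    using assms(1) by (auto simp: dual_knuth_def)
  note ord = assms(1)[unfolded dual_knuth_def, THEN conjunct2]
  have in3: "a \<in> {1..n}" "Suc a \<in> {1..n}" "Suc (Suc a) \<in> {1..n}" using assms by auto
  note B = before_reverse_complement[OF assms(2)] before_reverse_complement[OF assms(3)]
  have b: "before (reverse_complement n xs) k (Suc k)" "before (reverse_complement n xs) (Suc (Suc k)) (Suc k)"
    "before (reverse_complement n xs') (Suc k) k" "before (reverse_complement n xs') (Suc k) (Suc (Suc k))"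
    using B(1)[OF in3(3,2)] B(1)[OF in3(1,2)] B(2)[OF in3(2,3)] B(2)[OF in3(2,1)] ord unfolding k by blast+
  define u where "u = n - v"
  have u: "u \<in> {k, Suc k}" using v(1) assms(4,5) by (auto simp: u_def k_def)
  have "Transposition.transpose u (Suc u) (Suc n - Transposition.transpose v (Suc v) x) = Suc n - x"
    if "x \<in> {1..n}" for x
    using that v(1) assms(4,5) unfolding u_def Transposition.transpose_def by auto
  then have "reverse_complement n xs = map (Transposition.transpose u (Suc u)) (reverse_complement n xs')"
    unfolding v(2) reverse_complement_def using assms(2) by (auto simp: rev_map)
  then show ?thesis unfolding dual_knuth_def k_def[symmetric] using u b by blast
qed

section \<open>Standard tableaux and their words\<close>

lemma standard_tableauD:
  assumes "standard_tableau n T"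
  shows "is_partition n (shape T)" "distinct (concat T)" "set (concat T) = {1..n}"
    "\<And>R. R \<in> set T \<Longrightarrow> sorted_wrt (<) R \<and> R \<noteq> []"
    "\<And>r. Suc r < length T \<Longrightarrow> length (T ! Suc r) \<le> length (T ! r)"
    "\<And>r j. Suc r < length T \<Longrightarrow> j < length (T ! Suc r) \<Longrightarrow> T ! r ! j < T ! Suc r ! j"
proof -
  show "is_partition n (shape T)" "distinct (concat T)" "set (concat T) = {1..n}"
    "\<And>r j. Suc r < length T \<Longrightarrow> j < length (T ! Suc r) \<Longrightarrow> T ! r ! j < T ! Suc r ! j"
    using assms by (simp_all add: standard_tableau_def)
  show "\<And>R. R \<in> set T \<Longrightarrow> sorted_wrt (<) R \<and> R \<noteq> []"
    using assms by (force simp: standard_tableau_def is_partition_def shape_def)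
  show "length (T ! Suc r) \<le> length (T ! r)" if "Suc r < length T" for r
  proof -
    have "sorted_wrt (\<ge>) (map length T)"
      using assms by (simp add: standard_tableau_def is_partition_def shape_def)
    from sorted_wrt_nth_less[OF this, of r "Suc r"] show ?thesis using that by simp
  qed
qed

lemma standard_tableau_insertion:
  assumes "standard_tableau n T"
  obtains xs where "distinct xs" "set xs = {1..n}" "insertion_tableau xs = T"
proof
  note s = standard_tableauD[OF assms]
  show "distinct (concat (rev T))" using s(2) by (simp add: distinct_concat_iff removeAll_filter_not_eq flip: rev_filter)
  show "set (concat (rev T)) = {1..n}" using s(3) by simp
  show "insertion_tableau (concat (rev T)) = T"
    by (rule insertion_tableau_reading_word) (use s(4-6) in auto)
qed

lemma disjoint_rows:
  assumes "standard_tableau n T" "r < length T" "s < length T" "r \<noteq> s"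
  shows "set (T ! r) \<inter> set (T ! s) = {}"
proof -
  have "distinct (concat T)" by (rule standard_tableauD(2)[OF assms(1)])
  then show ?thesis
    using assms(2-4)
  proof (induction T arbitrary: r s)
    case (Cons R T)
    have sub: "set (T ! q) \<subseteq> set (concat T)" if "q < length T" for q
      using nth_mem[OF that] by auto
    have "distinct (concat T)" "set R \<inter> set (concat T) = {}" using Cons.prems(1) by auto
    then have d: "set R \<inter> set (T ! q) = {}" if "q < length T" for q
      using sub[OF that] by blast
    show ?case
    proof (cases r)
      case 0
      then obtain q where "s = Suc q" using Cons.prems(4) by (cases s) auto
      then show ?thesis using 0 d[of q] Cons.prems(3) by simp
    next
      case (Suc p)
      show ?thesis
      proof (cases s)
        case 0
        then show ?thesis using Suc d[of p] Cons.prems(2) by (simp add: Int_commute)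
      next
        case (Suc q)
        then show ?thesis using \<open>r = Suc p\<close> Cons.IH[OF \<open>distinct (concat T)\<close>, of p q] Cons.prems(2-4)
          by simp
      qed
    qed
  qed simp
qed

lemma associated_tabloid_in_tabloids:
  assumes "standard_tableau n T"
  shows "associated_tabloid n T \<in> tabloids n (shape T)"
  unfolding tabloids_def
proof (intro CollectI conjI allI impI)
  note s = standard_tableauD[OF assms]
  have sub: "set R \<subseteq> {1..n}" if "R \<in> set T" for R using s(3) that by auto
  have inj: "inj_on (\<lambda>a. int a mod int n) {1..n}" by (rule inj_onI) (rule mod_inj_entries)
  have "card ((\<lambda>a. int a mod int n) ` set R) = length R" if "R \<in> set T" for R
  proof -
    have "distinct R" using s(4)[OF that] by (simp add: strict_sorted_iff)
    then show ?thesis using card_image[OF inj_on_subset[OF inj sub[OF that]]] distinct_card by simp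
  qed
  then show "map card (associated_tabloid n T) = shape T" by (simp add: associated_tabloid_def shape_def)
  show "associated_tabloid n T ! r \<inter> associated_tabloid n T ! t = {}"
    if "r < t \<and> t < length (associated_tabloid n T)" for r t
  proof -
    have rt: "r < t" "t < length T" using that by (auto simp: associated_tabloid_def)
    have "set (T ! r) \<inter> set (T ! t) = {}" using disjoint_rows[OF assms, of r t] rt by simp
    then show ?thesis
      using rt inj_on_image_Int[OF inj sub sub, of "T ! r" "T ! t"]
      by (simp add: associated_tabloid_def)
  qed
  have "\<Union> (set (associated_tabloid n T)) = (\<lambda>a. int a mod int n) ` {1..n}"
    unfolding s(3)[symmetric] by (auto simp: associated_tabloid_def)
  also have "\<dots> = residue_classes n"
  proof
    show "(\<lambda>a. int a mod int n) ` {1..n} \<subseteq> residue_classes n" by (auto simp: residue_classes_def)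
    show "residue_classes n \<subseteq> (\<lambda>a. int a mod int n) ` {1..n}"
    proof
      fix i assume i: "i \<in> residue_classes n"
      show "i \<in> (\<lambda>a. int a mod int n) ` {1..n}"
      proof (cases "i = 0")
        case True
        then show ?thesis using i by (intro image_eqI[of _ _ n]) (auto simp: residue_classes_def)
      next
        case False
        then show ?thesis using i by (intro image_eqI[of _ _ "nat i"]) (auto simp: residue_classes_def)
      qed
    qed
  qed
  finally show "\<Union> (set (associated_tabloid n T)) = residue_classes n" .
qed

text \<open>The rows of a standard tableau are increasing, hence determined by their sets of entries.\<close>

lemma associated_tabloid_inject:
  assumes "standard_tableau n T" "standard_tableau n S" "associated_tabloid n T = associated_tabloid n S"
  shows "T = S"
proof (rule nth_equalityI)
  note t = standard_tableauD[OF assms(1)] and s = standard_tableauD[OF assms(2)]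
  show len: "length T = length S" using arg_cong[OF assms(3), of length] by (simp add: associated_tabloid_def)
  fix r assume r: "r < length T"
  then have rS: "r < length S" using len by simp
  have "set (T ! r) \<subseteq> {1..n}" unfolding t(3)[symmetric] using nth_mem[OF r] by auto
  moreover have "set (S ! r) \<subseteq> {1..n}" unfolding s(3)[symmetric] using nth_mem[OF rS] by auto
  ultimately have "set (T ! r) = set (S ! r)"
    using in_associated_tabloid[OF t(3) r] in_associated_tabloid[OF s(3) rS] unfolding assms(3) by blast
  then show "T ! r = S ! r"
    using t(4)[OF nth_mem[OF r]] s(4)[OF nth_mem[OF rS]] strict_sorted_equal by blast
qed

text \<open>The exchange moves \<open>a + 1\<close> from row \<open>r\<close> to row \<open>r + 1\<close>; it can only make a difference for the descent
  \<open>a\<close> if \<open>a\<close> is in row \<open>r\<close>.\<close>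

lemma witness_row_upper:
  assumes T: "standard_tableau n T" and flip: "descent a T \<noteq> descent a (swap_entries (Suc a) T)"
    and r: "Suc r < length T" "Suc a \<in> set (T ! r)" "Suc (Suc a) \<in> set (T ! Suc r)"
  shows "a \<in> set (T ! r)"
proof (rule ccontr)
  assume na: "a \<notin> set (T ! r)"
  have b: "Suc a \<in> set (T ! q) \<longleftrightarrow> q = r" if "q < length T" for q
    using disjoint_rows[OF T that, of r] r by auto
  have c: "Suc (Suc a) \<in> set (T ! q) \<longleftrightarrow> q = Suc r" if "q < length T" for q
    using disjoint_rows[OF T that, of "Suc r"] r by auto
  have sw: "a \<in> set (swap_entries (Suc a) T ! q) \<longleftrightarrow> a \<in> set (T ! q)"
    "Suc a \<in> set (swap_entries (Suc a) T ! q) \<longleftrightarrow> Suc (Suc a) \<in> set (T ! q)" if "q < length T" for q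
    using that by (simp_all add: in_transpose_image_iff)
  have "descent a T \<longleftrightarrow> (\<exists>p<r. a \<in> set (T ! p))"
  proof
    assume "descent a T"
    then obtain p q where h: "p < q" "q < length T" "a \<in> set (T ! p)" "Suc a \<in> set (T ! q)"
      unfolding descent_iff_nth by blast
    then show "\<exists>p<r. a \<in> set (T ! p)" using b[of q] by blast
  next
    assume "\<exists>p<r. a \<in> set (T ! p)"
    then show "descent a T" unfolding descent_iff_nth using r Suc_lessD[OF r(1)] by blast
  qed
  moreover have "descent a (swap_entries (Suc a) T) \<longleftrightarrow> (\<exists>p<Suc r. a \<in> set (T ! p))"
  proof
    assume "descent a (swap_entries (Suc a) T)"
    then obtain p q where h: "p < q" "q < length T" "a \<in> set (swap_entries (Suc a) T ! p)"
      "Suc a \<in> set (swap_entries (Suc a) T ! q)" unfolding descent_iff_nth length_map by blast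
    then have "q = Suc r" using sw(2)[of q] c[of q] by blast
    then show "\<exists>p<Suc r. a \<in> set (T ! p)" using h sw(1)[of p] by auto
  next
    assume "\<exists>p<Suc r. a \<in> set (T ! p)"
    then obtain p where "p < Suc r" "a \<in> set (T ! p)" by blast
    then show "descent a (swap_entries (Suc a) T)"
      unfolding descent_iff_nth length_map using sw(1)[of p] sw(2)[OF r(1)] r by (meson less_trans)
  qed
  ultimately show False using flip na by (auto simp: less_Suc_eq)
qed

text \<open>The exchange moves \<open>a + 1\<close> from row \<open>r + 1\<close> to row \<open>r\<close>; it can only make a difference for the descent
  \<open>a + 1\<close> if \<open>a + 2\<close> is in row \<open>r + 1\<close>.\<close>

lemma witness_row_lower:
  assumes T: "standard_tableau n T" and flip: "descent (Suc a) T \<noteq> descent (Suc a) (swap_entries a T)"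
    and r: "Suc r < length T" "a \<in> set (T ! r)" "Suc a \<in> set (T ! Suc r)"
  shows "Suc (Suc a) \<in> set (T ! Suc r)"
proof (rule ccontr)
  assume nc: "Suc (Suc a) \<notin> set (T ! Suc r)"
  have b: "Suc a \<in> set (T ! q) \<longleftrightarrow> q = Suc r" if "q < length T" for q
    using disjoint_rows[OF T that, of "Suc r"] r by auto
  have c: "a \<in> set (T ! q) \<longleftrightarrow> q = r" if "q < length T" for q
    using disjoint_rows[OF T that, of r] r by auto
  have sw: "Suc (Suc a) \<in> set (swap_entries a T ! q) \<longleftrightarrow> Suc (Suc a) \<in> set (T ! q)"
    "Suc a \<in> set (swap_entries a T ! q) \<longleftrightarrow> a \<in> set (T ! q)" if "q < length T" for q
    using that by (simp_all add: in_transpose_image_iff)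
  have "descent (Suc a) T \<longleftrightarrow> (\<exists>q<length T. Suc r < q \<and> Suc (Suc a) \<in> set (T ! q))"
  proof
    assume "descent (Suc a) T"
    then obtain p q where h: "p < q" "q < length T" "Suc a \<in> set (T ! p)" "Suc (Suc a) \<in> set (T ! q)"
      unfolding descent_iff_nth by blast
    then have "p < length T" by simp
    then have "p = Suc r" using h b[of p] by blast
    then show "\<exists>q<length T. Suc r < q \<and> Suc (Suc a) \<in> set (T ! q)" using h by blast
  next
    assume "\<exists>q<length T. Suc r < q \<and> Suc (Suc a) \<in> set (T ! q)"
    then show "descent (Suc a) T" unfolding descent_iff_nth using r by blast
  qed
  moreover have "descent (Suc a) (swap_entries a T) \<longleftrightarrow> (\<exists>q<length T. r < q \<and> Suc (Suc a) \<in> set (T ! q))"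
  proof
    assume "descent (Suc a) (swap_entries a T)"
    then obtain p q where h: "p < q" "q < length T" "Suc a \<in> set (swap_entries a T ! p)"
      "Suc (Suc a) \<in> set (swap_entries a T ! q)" unfolding descent_iff_nth length_map by blast
    then have "p < length T" by simp
    then have "p = r" using h sw(2)[of p] c[of p] by blast
    then show "\<exists>q<length T. r < q \<and> Suc (Suc a) \<in> set (T ! q)" using h sw(1)[of q] by auto
  next
    assume "\<exists>q<length T. r < q \<and> Suc (Suc a) \<in> set (T ! q)"
    then obtain q where q: "q < length T" "r < q" "Suc (Suc a) \<in> set (T ! q)" by blast
    then have "r < length T" by simp
    then show "descent (Suc a) (swap_entries a T)"
      unfolding descent_iff_nth length_map using q sw(1)[of q] sw(2)[of r] r by meson
  qed
  ultimately show False using flip nc by (metis Suc_lessI Suc_lessD)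
qed

text \<open>Standardness could only fail in a column in which \<open>v + 1\<close> is directly below \<open>v\<close>.  The third entry
  of the move then shares its row with one of these two.  In its column, the other one of the two rows
  would have to contain the middle one of the three consecutive entries, which is already in the row of
  the third entry.\<close>

lemma standard_swap:
  assumes T: "standard_tableau n T" and v: "v \<in> {a, Suc a}" and a: "1 \<le> a" "a + 2 \<le> n"
    and strict: "row_strict (swap_entries v T)"
    and flip: "descent a T \<noteq> descent a (swap_entries v T)"
      "descent (Suc a) T \<noteq> descent (Suc a) (swap_entries v T)"
  shows "standard_tableau n (swap_entries v T)"
proof -
  note s = standard_tableauD[OF T]
  let ?f = "Transposition.transpose v (Suc v)"
  have no: False if r: "Suc r < length T" "j < length (T ! Suc r)" and eq: "T ! r ! j = v" "T ! Suc r ! j = Suc v" for r j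
  proof -
    have j: "j < length (T ! r)" using s(5)[OF r(1)] r(2) by simp
    have mem: "v \<in> set (T ! r)" "Suc v \<in> set (T ! Suc r)" using nth_mem[OF j] nth_mem[OF r(2)] eq by simp_all
    have srt: "sorted_wrt (<) (T ! r)" "sorted_wrt (<) (T ! Suc r)" using s(4) r(1) by (simp_all)
    have disj: "set (T ! r) \<inter> set (T ! Suc r) = {}" using disjoint_rows[OF T, of r "Suc r"] r(1) by simp
    consider "v = Suc a" | "v = a" using v by blast
    then show False
    proof cases
      case 1
      then have "a \<in> set (T ! r)" using witness_row_upper[OF T _ r(1)] flip(1) mem by simp
      then obtain i where i: "i < length (T ! r)" "T ! r ! i = a" by (auto simp: in_set_conv_nth)
      have ij: "i < j"
        using sorted_wrt_nth_less[OF srt(1), of j i] i j eq(1) 1 by (cases i j rule: linorder_cases) auto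
      have "a < T ! Suc r ! i" using s(6)[OF r(1), of i] i ij r(2) by simp
      moreover have "T ! Suc r ! i < Suc v" using sorted_wrt_nth_less[OF srt(2) ij r(2)] eq(2) by simp
      ultimately have "T ! Suc r ! i = v" using 1 by simp
      then have "v \<in> set (T ! Suc r)" using nth_mem[of i "T ! Suc r"] ij r(2) by simp
      then show False using mem(1) disj by blast
    next
      case 2
      then have "Suc (Suc a) \<in> set (T ! Suc r)" using witness_row_lower[OF T _ r(1)] flip(2) mem by simp
      then obtain i where i: "i < length (T ! Suc r)" "T ! Suc r ! i = Suc (Suc a)" by (auto simp: in_set_conv_nth)
      have ij: "j < i"
        using sorted_wrt_nth_less[OF srt(2), of i j] i r(2) eq(2) 2 by (cases i j rule: linorder_cases) auto
      have ir: "i < length (T ! r)" using i s(5)[OF r(1)] by simp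
      have "T ! r ! i < Suc (Suc a)" using s(6)[OF r(1) i(1)] i(2) by simp
      moreover have "v < T ! r ! i" using sorted_wrt_nth_less[OF srt(1) ij ir] eq(1) by simp
      ultimately have "T ! r ! i = Suc v" using 2 by simp
      then have "Suc v \<in> set (T ! r)" using nth_mem[OF ir] by simp
      then show False using mem(2) disj by blast
    qed
  qed
  have shp: "shape (swap_entries v T) = shape T" by (simp add: shape_def)
  have entries: "set (concat (swap_entries v T)) = {1..n}"
    unfolding set_concat_swap_entries s(3) by (rule transpose_image_eq) (use v a in auto)
  have columns: "swap_entries v T ! r ! j < swap_entries v T ! Suc r ! j"
    if rj: "Suc r < length (swap_entries v T)" "j < length (swap_entries v T ! Suc r)" for r j
  proof -
    have r: "Suc r < length T" "j < length (T ! Suc r)" using rj by simp_all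
    have j: "j < length (T ! r)" using s(5)[OF r(1)] r(2) by simp
    have "T ! r ! j < T ! Suc r ! j" by (rule s(6)[OF r])
    moreover have "\<not> (T ! r ! j = v \<and> T ! Suc r ! j = Suc v)" using no[OF r] by blast
    ultimately have "?f (T ! r ! j) < ?f (T ! Suc r ! j)" by (auto simp: Transposition.transpose_def)
    then show ?thesis using r j by simp
  qed
  show ?thesis
    unfolding standard_tableau_def shp
    using s(1) strict[unfolded row_strict_def] entries columns by blast
qed

lemma yamanouchiI: "(\<And>m. dominant (mset (drop m w))) \<Longrightarrow> yamanouchi w"
proof (induction w)
  case (Cons x w)
  have "dominant (mset (drop m w))" for m using Cons.prems[of "Suc m"] by simp
  then show ?case using Cons.IH Cons.prems[of 0] by simp
qed simp

text \<open>A suffix of the word describes the rows of the entries up to some bound.  In each column, the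
  entries up to the bound are the topmost ones, so no row contains more of them than the row above.\<close>

lemma standard_tableau_word:
  assumes T: "standard_tableau n T" and n: "0 < n"
  obtains w where "associated_tabloid n T = tabloid_of_word (length T) w 0" "length w = n"
    "has_content (shape T) w" "yamanouchi w"
proof -
  note s = standard_tableauD[OF T]
  let ?l = "length T"
  have shp: "length (shape T) = ?l" by (simp add: shape_def)
  obtain w where w: "associated_tabloid n T = tabloid_of_word ?l w 0" "length w = n" "set w \<subseteq> {..<?l}"
    and cnt: "\<And>r. r < ?l \<Longrightarrow> count (mset w) r = shape T ! r"
    using tabloid_of_word_exists[OF associated_tabloid_in_tabloids[OF T] n] unfolding shp by blast
  have "count (mset w) r = count (mset (rows_up (shape T) ?l)) r" for r
  proof (cases "r < ?l")
    case True
    then show ?thesis using cnt by (simp add: count_rows_up)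
  next
    case False
    then have "r \<notin> set w" using w(3) by auto
    then have "count (mset w) r = 0" by (metis count_inI set_mset_mset)
    then show ?thesis using False by (simp only: count_rows_up if_False)
  qed
  then have content: "has_content (shape T) w" unfolding has_content_def shp by (rule multiset_eqI)
  \<comment> \<open>Letter number \<open>m\<close> belongs to the entry \<open>n - m\<close>; for \<open>m = 0\<close> this is \<open>n\<close>, the residue \<open>0\<close>.\<close>
  have pos: "w ! m = r \<longleftrightarrow> n - m \<in> set (T ! r)" if "m < n" "r < ?l" for m r
  proof -
    have nm: "n - m \<in> {1..n}" using that by auto
    have "int (n - m) mod int n = (int n + (- int m)) mod int n" using that by (simp add: of_nat_diff)
    also have "\<dots> = (0 - int m) mod int n" by (simp only: mod_add_self1) simp
    finally have res: "int (n - m) mod int n = (0 - int m) mod int n" .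
    have "n - m \<in> set (T ! r) \<longleftrightarrow> (0 - int m) mod int n \<in> tabloid_of_word ?l w 0 ! r"
      unfolding in_associated_tabloid[OF s(3) that(2) nm, symmetric] w(1)[symmetric] res ..
    also have "\<dots> \<longleftrightarrow> w ! m = r"
    proof -
      have "m' = m" if "m' < n" "(0 - int m') mod int n = (0 - int m) mod int n" for m'
        using position_residue[of m n 0] position_residue[of m' n 0] that \<open>m < n\<close> by metis
      then show ?thesis unfolding nth_tabloid_of_word[OF that(2)] w(2) using that(1) by fastforce
    qed
    finally show ?thesis ..
  qed
  have suffix: "count (mset (drop m w)) r = card {j. j < length (T ! r) \<and> T ! r ! j \<le> n - m}"
    if r: "r < ?l" for m r
  proof -
    have "count (mset (drop m w)) r = card {i. i < n - m \<and> w ! (m + i) = r}"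
      using w(2) by (cases "m \<le> n")
        (simp_all add: count_mset count_list_eq_length_filter length_filter_conv_card eq_commute[of r])
    also have "\<dots> = card {j. j < length (T ! r) \<and> T ! r ! j \<le> n - m}"
    proof (rule bij_betw_same_card[symmetric], rule bij_betw_imageI)
      let ?J = "{j. j < length (T ! r) \<and> T ! r ! j \<le> n - m}"
      let ?g = "\<lambda>j. n - m - T ! r ! j"
      have srt: "sorted_wrt (<) (T ! r)" using s(4)[OF nth_mem[OF r]] by simp
      then have dist: "distinct (T ! r)" by (simp add: strict_sorted_iff)
      have pos1: "1 \<le> T ! r ! j" if "j < length (T ! r)" for j
      proof -
        have "T ! r ! j \<in> set (concat T)" using nth_mem[OF r] nth_mem[OF that] by auto
        then show ?thesis unfolding s(3) by simp
      qed
      show "inj_on ?g ?J"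
      proof (rule inj_onI)
        fix i j assume ij: "i \<in> ?J" "j \<in> ?J" "?g i = ?g j"
        then have "T ! r ! i = T ! r ! j" by auto
        then show "i = j" using nth_eq_iff_index_eq[OF dist] ij by simp
      qed
      show "?g ` ?J = {i. i < n - m \<and> w ! (m + i) = r}"
      proof (intro set_eqI iffI)
        fix i assume "i \<in> ?g ` ?J"
        then obtain j where j: "j < length (T ! r)" "T ! r ! j \<le> n - m" "i = ?g j" by blast
        have "n - (m + i) = T ! r ! j" "i < n - m" using j pos1[OF j(1)] by auto
        then show "i \<in> {i. i < n - m \<and> w ! (m + i) = r}"
          using pos[of "m + i" r] r nth_mem[OF j(1)] by simp
      next
        fix i assume "i \<in> {i. i < n - m \<and> w ! (m + i) = r}"
        then have i: "i < n - m" "w ! (m + i) = r" by auto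
        then have "n - (m + i) \<in> set (T ! r)" using pos[of "m + i" r] r by simp
        then obtain j where "j < length (T ! r)" "T ! r ! j = n - (m + i)" by (auto simp: in_set_conv_nth)
        then show "i \<in> ?g ` ?J" using i by (intro image_eqI[of _ _ j]) auto
      qed
    qed
    finally show ?thesis .
  qed
  have "dominant (mset (drop m w))" for m
    unfolding dominant_def
  proof
    fix r
    show "count (mset (drop m w)) (Suc r) \<le> count (mset (drop m w)) r"
    proof (cases "Suc r < ?l")
      case True
      have "{j. j < length (T ! Suc r) \<and> T ! Suc r ! j \<le> n - m} \<subseteq> {j. j < length (T ! r) \<and> T ! r ! j \<le> n - m}"
        using s(5)[OF True] s(6)[OF True] by (fastforce intro: less_imp_le order_trans)
      then show ?thesis using suffix[OF True] suffix[of r] True by (simp add: card_mono)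
    next
      case False
      then have "Suc r \<notin> set (drop m w)" using w(3) set_drop_subset[of m w] by auto
      then have "count (mset (drop m w)) (Suc r) = 0" by (metis count_inI set_mset_mset)
      then show ?thesis by linarith
    qed
  qed
  then have "yamanouchi w" by (rule yamanouchiI)
  then show ?thesis using that w content by blast
qed

section \<open>Comparison of the two evacuations\<close>

text \<open>The move is realized by a dual Knuth move on a word that inserts to \<open>T\<close>, which shows that the new
  tabloid comes from a standard tableau.  The images under both evacuations are neighbours along the
  same type of the same tabloid, hence equal.\<close>

lemma evacuations_agree_step:
  assumes T: "standard_tableau n T" and e: "is_affine_evacuation n (shape T) e" and ev: "is_evacuation n ev"
    and u: "associated_tabloid n T = tabloid_of_word (length T) u 0" "has_content (shape T) u"
    and step: "knuth_step u u' \<or> knuth_step u' u"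
  shows "\<exists>T'. standard_tableau n T' \<and> shape T' = shape T
    \<and> associated_tabloid n T' = tabloid_of_word (length T) u' 0
    \<and> (e (associated_tabloid n T) = associated_tabloid n (ev T)
        \<longrightarrow> e (associated_tabloid n T') = associated_tabloid n (ev T'))"
proof -
  let ?l = "length T"
  let ?as = "associated_tabloid n"
  note s = standard_tableauD[OF T]
  have sum: "sum_list (shape T) = n" using s(1) by (simp add: is_partition_def)
  have shp: "length (shape T) = ?l" by (simp add: shape_def)
  have u': "has_content (shape T) u'" using u(2) step by (auto simp: has_content_def dest: knuth_step_mset)
  note cu = has_contentD[OF u(2) sum, unfolded shp] and cu' = has_contentD[OF u' sum, unfolded shp]
  obtain j where j: "j + 2 < n"
    "knuth_move_of_type n ((0 - int j - 2) mod int n) (?as T) (tabloid_of_word ?l u' 0)"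
    unfolding u(1) using step knuth_step_type[of u u' ?l 0] knuth_step_type[of u' u ?l 0] cu cu'
    by (metis knuth_move_of_type_sym)
  \<comment> \<open>The three letters belong to entries \<open>a, a + 1, a + 2\<close> in \<open>{1..n}\<close>, so \<open>a\<close> is also the type.\<close>
  define a where "a = n - 2 - j"
  have a: "1 \<le> a" "a + 2 \<le> n" using j(1) by (auto simp: a_def)
  have n3: "3 \<le> n" using j(1) by simp
  have "(0 - int j - 2) mod int n = (int n + (- int j - 2)) mod int n" by (simp only: mod_add_self1) simp
  also have "int n + (- int j - 2) = int a" using j(1) by (simp add: a_def of_nat_diff)
  also have "int a mod int n = int a" using a by simp
  finally have type: "knuth_move_of_type n (int a) (?as T) (tabloid_of_word ?l u' 0)" using j(2) by simp
  have ar: "int a \<in> residue_classes n" using a by (simp add: residue_classes_def)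
  obtain xs where xs: "distinct xs" "set xs = {1..n}" "insertion_tableau xs = T"
    using standard_tableau_insertion[OF T] by blast
  have "int a \<in> Des n (?as T) \<longleftrightarrow> int (Suc a) \<notin> Des n (?as T)"
  proof -
    have "(int a + 1) mod int n = int (Suc a)" using a by simp
    then show ?thesis using type by (auto simp: knuth_move_of_type_def)
  qed
  then have "descent a T \<longleftrightarrow> \<not> descent (Suc a) T"
    using Des_associated_tabloid[OF s(3), of a] Des_associated_tabloid[OF s(3), of "Suc a"] a by simp
  then have bef: "before xs (Suc a) a \<longleftrightarrow> \<not> before xs (Suc (Suc a)) (Suc a)"
    using descent_insertion_tableau[OF xs(1)] xs(3) by simp
  have "{a, Suc a, Suc (Suc a)} \<subseteq> set xs" using a xs(2) by auto
  then obtain xs' where dk: "dual_knuth a xs xs' \<or> dual_knuth a xs' xs"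
    using dual_knuth_exists[OF xs(1) _ bef] by blast
  have "\<exists>v \<in> {a, Suc a}. xs' = map (Transposition.transpose v (Suc v)) xs"
  proof -
    have "map (Transposition.transpose v (Suc v)) (map (Transposition.transpose v (Suc v)) zs) = zs" for v zs
      by (simp add: map_idI)
    then show ?thesis using dk unfolding dual_knuth_def by metis
  qed
  then obtain v0 where v0: "v0 \<in> {a, Suc a}" "xs' = map (Transposition.transpose v0 (Suc v0)) xs" by blast
  have xs': "distinct xs'" "set xs' = {1..n}"
  proof -
    show "distinct xs'" unfolding v0(2) using xs(1) by (simp only: distinct_map inj_on_transpose simp_thms)
    show "set xs' = {1..n}" unfolding v0(2) set_map xs(2) by (rule transpose_image_eq) (use v0 a in auto)
  qed
  have type_of: "knuth_move_of_type n (int b) (?as (insertion_tableau ys)) (?as (insertion_tableau ys'))"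
    if "distinct ys" "set ys = {1..n}" "distinct ys'" "set ys' = {1..n}" "1 \<le> b" "b + 2 \<le> n"
      "dual_knuth b ys ys' \<or> dual_knuth b ys' ys" for b ys ys'
    using that dual_knuth_type knuth_move_of_type_sym by blast
  define T' where "T' = insertion_tableau xs'"
  have type': "knuth_move_of_type n (int a) (?as T) (?as T')"
    unfolding T'_def xs(3)[symmetric] by (rule type_of[OF xs(1,2) xs' a dk])
  then have eq: "?as T' = tabloid_of_word ?l u' 0"
    using knuth_move_type_unique[OF associated_tabloid_in_tabloids[OF T] n3 ar] type by blast
  obtain v where v: "v \<in> {a, Suc a}" "T' = swap_entries v T"
  proof -
    from dk have "\<exists>v \<in> {a, Suc a}. T' = swap_entries v T"
    proof
      assume "dual_knuth a xs xs'"
      then show ?thesis using insertion_tableau_dual_knuth[OF xs(1)] xs(3) by (simp add: T'_def)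
    next
      assume "dual_knuth a xs' xs"
      then obtain v where "v \<in> {a, Suc a}" "T = swap_entries v T'"
        using insertion_tableau_dual_knuth[OF xs'(1)] xs(3) by (auto simp: T'_def)
      moreover have "swap_entries v (swap_entries v T') = T'" by (simp add: comp_def map_idI)
      ultimately show ?thesis by metis
    qed
    then show ?thesis using that by blast
  qed
  have std': "standard_tableau n T'"
    unfolding v(2)
  proof (rule standard_swap[OF T v(1) a])
    show "row_strict (swap_entries v T)"
      using row_strict_insertion_tableau[OF xs'(1)] v(2) by (simp add: T'_def)
    have "descent i T \<longleftrightarrow> before xs (Suc i) i" "descent i (swap_entries v T) \<longleftrightarrow> before xs' (Suc i) i" for i
      using descent_insertion_tableau[OF xs(1), of i] descent_insertion_tableau[OF xs'(1), of i] xs(3) v(2)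
      by (simp_all add: T'_def)
    then show "descent a T \<noteq> descent a (swap_entries v T)"
      "descent (Suc a) T \<noteq> descent (Suc a) (swap_entries v T)"
      using dk before_asym[OF xs(1)] before_asym[OF xs'(1)] unfolding dual_knuth_def by blast+
  qed
  have shape': "shape T' = shape T" by (simp add: v(2) shape_def)
  have "e (?as T') = ?as (ev T')" if agree: "e (?as T) = ?as (ev T)"
  proof -
    define b where "b = n - 1 - a"
    have b: "1 \<le> b" "b + 2 \<le> n" using a by (auto simp: b_def)
    have bk: "(int n - int a - 1) mod int n = int b" using a by (simp add: b_def of_nat_diff)
    have br: "int b \<in> residue_classes n" using b by (simp add: residue_classes_def)
    have "knuth_move_of_type n (int b) (e (?as T)) (e (?as T'))"
      using e ar associated_tabloid_in_tabloids[OF T] associated_tabloid_in_tabloids[OF std'] type'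
      unfolding is_affine_evacuation_def bk[symmetric] shape' by blast
    moreover have "knuth_move_of_type n (int b) (e (?as T)) (?as (ev T'))"
    proof -
      let ?rc = "reverse_complement n"
      have evT: "ev T = insertion_tableau (?rc xs)" "ev T' = insertion_tableau (?rc xs')"
        using evacuation_insertion_tableau[OF ev xs(1,2)] evacuation_insertion_tableau[OF ev xs'] xs(3)
        by (simp_all add: T'_def)
      have "dual_knuth b (?rc xs) (?rc xs') \<or> dual_knuth b (?rc xs') (?rc xs)"
        using dk dual_knuth_reverse_complement[of a xs xs' n] dual_knuth_reverse_complement[of a xs' xs n]
          xs(2) xs'(2) a unfolding b_def by blast
      then show ?thesis
        unfolding agree evT
        by (intro type_of reverse_complement_permutation xs(1,2) xs' b)
    qed
    ultimately show ?thesis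
      using knuth_move_type_unique[OF affine_evacuation_tabloid[OF e associated_tabloid_in_tabloids[OF T]] n3 br]
      by blast
  qed
  then show ?thesis using std' shape' eq by blast
qed

lemma evacuations_agree_connected:
  assumes "u \<approx> v" and T: "standard_tableau n T" and e: "is_affine_evacuation n (shape T) e"
    and ev: "is_evacuation n ev"
    and u: "associated_tabloid n T = tabloid_of_word (length T) u 0" "has_content (shape T) u"
  shows "\<exists>T'. standard_tableau n T' \<and> shape T' = shape T
    \<and> associated_tabloid n T' = tabloid_of_word (length T) v 0
    \<and> (e (associated_tabloid n T) = associated_tabloid n (ev T)
        \<longrightarrow> e (associated_tabloid n T') = associated_tabloid n (ev T'))"
  using assms(1)
proof (induction rule: equivclp_induct)
  case base
  show ?case using T u by blast
next
  case (step y z)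
  then obtain T' where T': "standard_tableau n T'" "shape T' = shape T"
    "associated_tabloid n T' = tabloid_of_word (length T) y 0"
    "e (associated_tabloid n T) = associated_tabloid n (ev T)
      \<longrightarrow> e (associated_tabloid n T') = associated_tabloid n (ev T')" by blast
  have len: "length T' = length T" using T'(2) by (metis length_map shape_def)
  have y: "has_content (shape T) y"
    using u(2) knuth_equiv_mset[OF step.hyps(1)] by (simp add: has_content_def)
  show ?case
    using evacuations_agree_step[OF T'(1) _ ev, of e y z] e T'(2-4) y step.hyps(2) unfolding len by auto
qed

text \<open>The agreement is established for \<open>D = ev C\<close>, where \<open>C\<close> has a column word, and carried from \<open>D\<close> to \<open>T\<close>.
  The tableau \<open>C\<close> itself is reached from \<open>T\<close> by Knuth moves, so that it need not be constructed.\<close>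

theorem evacuations_agree:
  assumes T: "standard_tableau n T" and e: "is_affine_evacuation n (shape T) e" and ev: "is_evacuation n ev"
    and n: "0 < n"
  shows "e (associated_tabloid n T) = associated_tabloid n (ev T)"
proof -
  let ?l = "length T" and ?lam = "shape T"
  let ?as = "associated_tabloid n"
  note s = standard_tableauD[OF T]
  have sum: "sum_list ?lam = n" using s(1) by (simp add: is_partition_def)
  have shp: "length ?lam = ?l" by (simp add: shape_def)
  obtain u where u: "?as T = tabloid_of_word ?l u 0" "has_content ?lam u" "yamanouchi u"
    using standard_tableau_word[OF T n] by blast
  obtain c where c: "mset c = mset u" "yamanouchi c" "column_word c"
    using column_word_exists[OF yamanouchi_dominant[OF u(3)]] by blast
  have cc: "has_content ?lam c" using u(2) c(1) by (simp add: has_content_def)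
  obtain C where C: "standard_tableau n C" "shape C = ?lam" "?as C = tabloid_of_word ?l c 0"
    using evacuations_agree_connected[OF yamanouchi_connected[OF u(3) c(2) c(1)[symmetric]] T e ev u(1,2)] by blast
  define D where "D = ev C"
  have D: "standard_tableau n D" "shape D = ?lam" "ev D = C"
    using ev C unfolding is_evacuation_def D_def by auto
  have lenD: "length D = ?l" using D(2) by (metis length_map shape_def)
  obtain d where d: "?as D = tabloid_of_word ?l d 0" "has_content ?lam d" "yamanouchi d"
    using standard_tableau_word[OF D(1) n] unfolding lenD D(2) by blast
  have neg: "negates_Des n e (?as D)"
    using negates_Des_yamanouchi[OF e s(1) n d(3,2)] unfolding shp d(1) .
  have eD: "e (?as D) \<in> tabloids n ?lam"
    using affine_evacuation_tabloid[OF e] associated_tabloid_in_tabloids[OF D(1)] D(2) by simp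
  obtain v where v: "e (?as D) = tabloid_of_word ?l v 0" "length v = n" "set v \<subseteq> {..<?l}"
    "\<And>r. r < ?l \<Longrightarrow> count (mset v) r = ?lam ! r"
    using tabloid_of_word_exists[OF eD n, where k = 0] unfolding shp by blast
  note cD = has_contentD[OF cc sum, unfolded shp]
  have "mset v = mset c"
  proof (rule multiset_eqI)
    fix r
    show "count (mset v) r = count (mset c) r"
    proof (cases "r < ?l")
      case False
      then have "r \<notin> set v" "r \<notin> set c" using v(3) cD(2) by auto
      then show ?thesis by (metis count_inI set_mset_mset)
    qed (simp add: v(4) cD(3))
  qed
  moreover have "v ! Suc j < v ! j" if j: "Suc j < length c" "c ! Suc j < c ! j" for j
  proof -
    \<comment> \<open>The descent of the word after letter number \<open>j\<close> is the descent \<open>b\<close> of the tableau \<open>C\<close>.\<close>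
    define b where "b = n - Suc j"
    have b: "1 \<le> b" "b < n" "b \<in> {1..<n}" "n - b \<in> {1..<n}" using j(1) cD(1) by (auto simp: b_def)
    have res: "(0 - int j - 1) mod int n = int b"
    proof -
      have "(0 - int j - 1) mod int n = (int n + (- int j - 1)) mod int n" by (simp only: mod_add_self1) simp
      also have "int n + (- int j - 1) = int b" using j(1) cD(1) by (simp add: b_def of_nat_diff)
      finally show ?thesis using b by simp
    qed
    have "int b \<in> Des n (?as C)"
      using Des_tabloid_of_word_position[OF cD(2) cD(1)[symmetric], of j 0] j cD(1) unfolding res C(3) by simp
    then have "descent b C"
      using Des_associated_tabloid[OF standard_tableauD(3)[OF C(1)] b(3)] by simp
    obtain xs where xs: "distinct xs" "set xs = {1..n}" "insertion_tableau xs = C"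
      using standard_tableau_insertion[OF C(1)] by blast
    have "before xs (Suc b) b"
      using \<open>descent b C\<close> descent_insertion_tableau[OF xs(1)] xs(3) by simp
    then have "before (reverse_complement n xs) (Suc (n - b)) (n - b)"
      using before_reverse_complement[OF xs(2), of b "Suc b"] b by (simp add: Suc_diff_le)
    then have "descent (n - b) D"
      using evacuation_insertion_tableau[OF ev xs(1,2)] xs(3)
        descent_insertion_tableau[OF reverse_complement_permutation(1)[OF xs(1,2)]]
      by (simp add: D_def)
    then have "int (n - b) \<in> Des n (?as D)"
      using Des_associated_tabloid[OF standard_tableauD(3)[OF D(1)] b(4)] by simp
    moreover have "(- int b) mod int n = int (n - b)"
    proof -
      have "(- int b) mod int n = (int n + (- int b)) mod int n" by (simp only: mod_add_self1)
      also have "int n + (- int b) = int (n - b)" using b by (simp add: of_nat_diff)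
      also have "int (n - b) mod int n = int (n - b)" by (rule mod_pos_pos_trivial) (use b in auto)
      finally show ?thesis .
    qed
    moreover have "int b \<in> residue_classes n" using b by (simp add: residue_classes_def)
    ultimately have "int b \<in> Des n (e (?as D))" using neg unfolding negates_Des_def by simp
    then show ?thesis
      using Des_tabloid_of_word_position[OF v(3) v(2)[symmetric], of j 0] j cD(1) unfolding res v(1) by simp
  qed
  ultimately have "v = c" using column_word_unique[OF c(3)] by blast
  then have agree: "e (?as D) = ?as (ev D)" using v(1) C(3) D(3) by simp
  have "d \<approx> u" using yamanouchi_connected[OF d(3) u(3)] d(2) u(2) by (simp add: has_content_def)
  then obtain T' where T': "standard_tableau n T'" "?as T' = ?as T" "e (?as T') = ?as (ev T')"
    using evacuations_agree_connected[OF _ D(1) _ ev, of d u e] e D(2) d(1,2) agree u(1)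
    unfolding lenD by auto
  then have "T' = T" using associated_tabloid_inject[OF _ T] by blast
  then show ?thesis using T' by simp
qed

theorem proposition3p9:
  fixes n :: nat and T :: tableau
    and e :: "tabloid \<Rightarrow> tabloid" and ev :: "tableau \<Rightarrow> tableau"
  assumes "standard_tableau n T"
    and "is_affine_evacuation n (shape T) e"
    and "is_evacuation n ev"
  shows "standardizable n (e (associated_tabloid n T))
    \<and> (\<forall>S. standard_tableau n S \<and> associated_tabloid n S = e (associated_tabloid n T)
          \<longrightarrow> S = ev T)"
proof -
  have evT: "standard_tableau n (ev T)" "shape (ev T) = shape T"
    using assms(1,3) by (simp_all add: is_evacuation_def)
  have "e (associated_tabloid n T) = associated_tabloid n (ev T)"
  proof (cases "n = 0")
    case True
    have "shape T = []" using assms(1) True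
      by (cases "shape T") (auto simp: standard_tableau_def is_partition_def)
    then have "T = []" "ev T = []" using evT(2) by (simp_all add: shape_def)
    moreover have "tabloids n (shape T) = {[]}"
      using \<open>shape T = []\<close> True by (auto simp: tabloids_def residue_classes_def)
    ultimately show ?thesis
      using affine_evacuation_tabloid[OF assms(2), of "[]"] by (simp add: associated_tabloid_def)
  next
    case False
    then show ?thesis using evacuations_agree assms by simp
  qed
  then show ?thesis
    using evT(1) associated_tabloid_inject unfolding standardizable_def by metis
qed

end
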